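(* The category $\mathcal{HT}$ of Hopf trusses (with Hopf truss morphisms) and the category $\mathcal{WTH}$ of weak twisted post-Hopf algebras (with weak twisted post-Hopf algebra homomorphisms) are isomorphic.
   Context: Base field $\mathbb F$ of characteristic zero; Sweedler notation $\Delta(x)=x_1\otimes x_2$. A Hopf truss $(H,\cdot,\circ,\Phi)$ consists of a cocommutative Hopf algebra $(H,\cdot,1,\Delta,\epsilon,S)$, a bilinear operation $\circ$ on $H$ such that $(H,\circ,\Delta,\epsilon)$ is a nonunital bialgebra (i.e. $\circ$ is associative and compatible with $\Delta$ and $\epsilon$), and a coalgebra homomorphism $\Phi:H\to H$ such that $x\circ(y\cdot z)=(x_1\circ y)\cdot S(\Phi(x_2))\cdot(x_3\circ z)$ for all $x,y,z\in H$. A Hopf truss morphism is a Hopf algebra morphism $F$ with $F(x\circ_H y)=F(x)\circ_{H'}F(y)$ and $F(\Phi_H(x))=\Phi_{H'}(F(x))$. A weak twisted post-Hopf algebra $(H,\rhd,\Phi)$ is a cocommutative Hopf algebra $H$ with coalgebra morphisms $\rhd:H\otimes H\to H$ and $\Phi:H\to H$ such that, setting $x\circ y=\Phi(x_1)\cdot(x_2\rhd y)$, for all $x,y,z\in H$: $x\rhd(y\cdot z)=(x_1\rhd y)\cdot(x_2\rhd z)$; $(x\circ y)\rhd z=x\rhd(y\rhd z)$; $\Phi(x\circ y)=x\circ\Phi(y)$. A homomorphism of weak twisted post-Hopf algebras is a Hopf algebra morphism $F$ with $F(x\rhd y)=F(x)\rhd'F(y)$ and $F(\Phi(x))=\Phi'(F(x))$.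 *)

theory Defs
  imports "HOL-Algebra.Module" "HOL-Algebra.Free_Abelian_Groups"
begin

section \<open>Tensor products of modules\<close>

text \<open>The tensor product of the \<open>R\<close>-modules \<open>M\<close> and \<open>N\<close> is the free abelian group on
  \<open>carrier M \<times> carrier N\<close> modulo the subgroup generated by the relations of biadditivity and
  balancedness. Its elements are cosets of finitely supported \<open>int\<close>-valued functions.\<close>

definition tensor_rels ::
    "('k, 'm) ring_scheme \<Rightarrow> ('k, 'a, 'x) module_scheme \<Rightarrow> ('k, 'b, 'y) module_scheme
      \<Rightarrow> ('a \<times> 'b \<Rightarrow>\<^sub>0 int) set" where
  "tensor_rels R M N =
     {frag_of (x \<oplus>\<^bsub>M\<^esub> x', y) - frag_of (x, y) - frag_of (x', y) | x x' y.
        x \<in> carrier M \<and> x' \<in> carrier M \<and> y \<in> carrier N} \<union>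
     {frag_of (x, y \<oplus>\<^bsub>N\<^esub> y') - frag_of (x, y) - frag_of (x, y') | x y y'.
        x \<in> carrier M \<and> y \<in> carrier N \<and> y' \<in> carrier N} \<union>
     {frag_of (r \<odot>\<^bsub>M\<^esub> x, y) - frag_of (x, r \<odot>\<^bsub>N\<^esub> y) | r x y.
        r \<in> carrier R \<and> x \<in> carrier M \<and> y \<in> carrier N}"

definition tensor_kernel ::
    "('k, 'm) ring_scheme \<Rightarrow> ('k, 'a, 'x) module_scheme \<Rightarrow> ('k, 'b, 'y) module_scheme
      \<Rightarrow> ('a \<times> 'b \<Rightarrow>\<^sub>0 int) set" where
  "tensor_kernel R M N =
     generate (free_Abelian_group (carrier M \<times> carrier N)) (tensor_rels R M N)"

definition tensor_group ::
    "('k, 'm) ring_scheme \<Rightarrow> ('k, 'a, 'x) module_scheme \<Rightarrow> ('k, 'b, 'y) module_scheme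
      \<Rightarrow> ('a \<times> 'b \<Rightarrow>\<^sub>0 int) set monoid" where
  "tensor_group R M N =
     free_Abelian_group (carrier M \<times> carrier N) Mod tensor_kernel R M N"

definition pure_tensor ::
    "('k, 'm) ring_scheme \<Rightarrow> ('k, 'a, 'x) module_scheme \<Rightarrow> ('k, 'b, 'y) module_scheme
      \<Rightarrow> 'a \<Rightarrow> 'b \<Rightarrow> ('a \<times> 'b \<Rightarrow>\<^sub>0 int) set" where
  "pure_tensor R M N x y =
     tensor_kernel R M N #>\<^bsub>free_Abelian_group (carrier M \<times> carrier N)\<^esub> frag_of (x, y)"

text \<open>The additive map induced on \<open>M \<otimes> N\<close> by a biadditive balanced map \<open>f\<close> into the abelian
  group \<open>G\<close>. Only meaningful for such \<open>f\<close>; extensionality makes the description unique.\<close>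

definition tensor_lift ::
    "('k, 'm) ring_scheme \<Rightarrow> ('k, 'a, 'x) module_scheme \<Rightarrow> ('k, 'b, 'y) module_scheme
      \<Rightarrow> ('c, 'z) monoid_scheme \<Rightarrow> ('a \<Rightarrow> 'b \<Rightarrow> 'c) \<Rightarrow> ('a \<times> 'b \<Rightarrow>\<^sub>0 int) set \<Rightarrow> 'c" where
  "tensor_lift R M N G f =
     (THE h. h \<in> extensional (carrier (tensor_group R M N)) \<and> h \<in> hom (tensor_group R M N) G \<and>
       (\<forall>x \<in> carrier M. \<forall>y \<in> carrier N. h (pure_tensor R M N x y) = f x y))"

text \<open>The ring fields \<open>mult\<close> and \<open>one\<close> are part of the library's record of modules but play no
  role for modules.\<close>

definition tensor ::
    "('k, 'm) ring_scheme \<Rightarrow> ('k, 'a, 'x) module_scheme \<Rightarrow> ('k, 'b, 'y) module_scheme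
      \<Rightarrow> ('k, ('a \<times> 'b \<Rightarrow>\<^sub>0 int) set) module" where
  "tensor R M N =
     \<lparr>carrier = carrier (tensor_group R M N), monoid.mult = (\<lambda>_ _. undefined), one = undefined,
      ring.zero = \<one>\<^bsub>tensor_group R M N\<^esub>, ring.add = monoid.mult (tensor_group R M N),
      module.smult = (\<lambda>r. tensor_lift R M N (tensor_group R M N)
                     (\<lambda>x y. pure_tensor R M N (r \<odot>\<^bsub>M\<^esub> x) y))\<rparr>"

definition linear_map ::
    "('k, 'm) ring_scheme \<Rightarrow> ('k, 'a, 'x) module_scheme \<Rightarrow> ('k, 'b, 'y) module_scheme
      \<Rightarrow> ('a \<Rightarrow> 'b) \<Rightarrow> bool" where
  "linear_map R M N f \<longleftrightarrow>
     f \<in> carrier M \<rightarrow> carrier N \<and>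
     (\<forall>x \<in> carrier M. \<forall>y \<in> carrier M. f (x \<oplus>\<^bsub>M\<^esub> y) = f x \<oplus>\<^bsub>N\<^esub> f y) \<and>
     (\<forall>r \<in> carrier R. \<forall>x \<in> carrier M. f (r \<odot>\<^bsub>M\<^esub> x) = r \<odot>\<^bsub>N\<^esub> f x)"

definition linear_form ::
    "('k, 'm) ring_scheme \<Rightarrow> ('k, 'a, 'x) module_scheme \<Rightarrow> ('a \<Rightarrow> 'k) \<Rightarrow> bool" where
  "linear_form R M f \<longleftrightarrow>
     f \<in> carrier M \<rightarrow> carrier R \<and>
     (\<forall>x \<in> carrier M. \<forall>y \<in> carrier M. f (x \<oplus>\<^bsub>M\<^esub> y) = f x \<oplus>\<^bsub>R\<^esub> f y) \<and>
     (\<forall>r \<in> carrier R. \<forall>x \<in> carrier M. f (r \<odot>\<^bsub>M\<^esub> x) = r \<otimes>\<^bsub>R\<^esub> f x)"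

definition bilinear_map ::
    "('k, 'm) ring_scheme \<Rightarrow> ('k, 'a, 'x) module_scheme \<Rightarrow> ('k, 'b, 'y) module_scheme
      \<Rightarrow> ('k, 'c, 'z) module_scheme \<Rightarrow> ('a \<Rightarrow> 'b \<Rightarrow> 'c) \<Rightarrow> bool" where
  "bilinear_map R M N P f \<longleftrightarrow>
     (\<forall>x \<in> carrier M. linear_map R N P (f x)) \<and>
     (\<forall>y \<in> carrier N. linear_map R M P (\<lambda>x. f x y))"


section \<open>Coalgebras\<close>

record ('k, 'a) coalgebra = "('k, 'a) module" +
  comult :: "'a \<Rightarrow> ('a \<times> 'a \<Rightarrow>\<^sub>0 int) set"
  counit :: "'a \<Rightarrow> 'k"

text \<open>\<open>sweedler R C P f x\<close> is the Sweedler sum of \<open>f x\<^sub>1 x\<^sub>2\<close> computed in \<open>P\<close>, for a bilinear map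
  \<open>f\<close> to \<open>P\<close>.\<close>

definition sweedler ::
    "('k, 'm) ring_scheme \<Rightarrow> ('k, 'a, 'x) coalgebra_scheme \<Rightarrow> ('c, 'z) ring_scheme
      \<Rightarrow> ('a \<Rightarrow> 'a \<Rightarrow> 'c) \<Rightarrow> 'a \<Rightarrow> 'c" where
  "sweedler R C P f x = tensor_lift R C C (add_monoid P) f (comult C x)"

text \<open>The two iterated coproducts are compared in \<open>C \<otimes> (C \<otimes> C)\<close>.\<close>

locale coalgebra = field R + module R C for R (structure) and C (structure) +
  assumes comult_linear: "linear_map R C (tensor R C C) (comult C)"
    and counit_linear: "linear_form R C (counit C)"
    and coassoc: "x \<in> carrier C \<Longrightarrow>
      sweedler R C (tensor R C (tensor R C C)) (\<lambda>u v.
        sweedler R C (tensor R C (tensor R C C)) (\<lambda>a b.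
          pure_tensor R C (tensor R C C) a (pure_tensor R C C b v)) u) x =
      sweedler R C (tensor R C (tensor R C C)) (\<lambda>u v.
        pure_tensor R C (tensor R C C) u (comult C v)) x"
    and counit_left: "x \<in> carrier C \<Longrightarrow> sweedler R C C (\<lambda>a b. counit C a \<odot>\<^bsub>C\<^esub> b) x = x"
    and counit_right: "x \<in> carrier C \<Longrightarrow> sweedler R C C (\<lambda>a b. counit C b \<odot>\<^bsub>C\<^esub> a) x = x"

definition cocommutative ::
    "('k, 'm) ring_scheme \<Rightarrow> ('k, 'a, 'x) coalgebra_scheme \<Rightarrow> bool" where
  "cocommutative R C \<longleftrightarrow>
     (\<forall>x \<in> carrier C. sweedler R C (tensor R C C) (\<lambda>a b. pure_tensor R C C b a) x = comult C x)"

definition coalgebra_hom ::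
    "('k, 'm) ring_scheme \<Rightarrow> ('k, 'a, 'x) coalgebra_scheme \<Rightarrow> ('k, 'b, 'y) coalgebra_scheme
      \<Rightarrow> ('a \<Rightarrow> 'b) \<Rightarrow> bool" where
  "coalgebra_hom R C D f \<longleftrightarrow>
     linear_map R C D f \<and>
     (\<forall>x \<in> carrier C.
        comult D (f x) = sweedler R C (tensor R D D) (\<lambda>a b. pure_tensor R D D (f a) (f b)) x) \<and>
     (\<forall>x \<in> carrier C. counit D (f x) = counit C x)"

text \<open>The tensor product coalgebra, with
  \<open>\<Delta>(x \<otimes> y) = (x\<^sub>1 \<otimes> y\<^sub>1) \<otimes> (x\<^sub>2 \<otimes> y\<^sub>2)\<close> and \<open>\<epsilon>(x \<otimes> y) = \<epsilon>(x) \<epsilon>(y)\<close>.\<close>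

definition tensor_coalgebra ::
    "('k, 'm) ring_scheme \<Rightarrow> ('k, 'a, 'x) coalgebra_scheme \<Rightarrow> ('k, 'b, 'y) coalgebra_scheme
      \<Rightarrow> ('k, ('a \<times> 'b \<Rightarrow>\<^sub>0 int) set) coalgebra" where
  "tensor_coalgebra R C D =
     (let T = tensor R C D; TT = tensor R T T in
      module.extend T (coalgebra.fields
        (tensor_lift R C D (add_monoid TT) (\<lambda>x y.
           sweedler R C TT (\<lambda>x1 x2.
             sweedler R D TT (\<lambda>y1 y2.
               pure_tensor R T T (pure_tensor R C D x1 y1) (pure_tensor R C D x2 y2)) y) x))
        (tensor_lift R C D (add_monoid R) (\<lambda>x y. counit C x \<otimes>\<^bsub>R\<^esub> counit D y))))"

text \<open>A bilinear operation that is a coalgebra morphism \<open>C \<otimes> C \<rightarrow> C\<close>.\<close>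

definition coalgebra_operation ::
    "('k, 'm) ring_scheme \<Rightarrow> ('k, 'a, 'x) coalgebra_scheme \<Rightarrow> ('a \<Rightarrow> 'a \<Rightarrow> 'a) \<Rightarrow> bool" where
  "coalgebra_operation R C f \<longleftrightarrow>
     bilinear_map R C C C f \<and>
     coalgebra_hom R (tensor_coalgebra R C C) C (tensor_lift R C C (add_monoid C) f)"


section \<open>Hopf algebras\<close>

record ('k, 'a) hopf_algebra = "('k, 'a) coalgebra" +
  antipode :: "'a \<Rightarrow> 'a"

text \<open>The ring operations of \<open>H\<close> together with \<open>smult\<close> form a unital associative algebra; the
  library's locale for algebras is not used because it requires commutativity. Bilinearity of the
  product is part of \<open>mult_coalgebra\<close>.\<close>

locale hopf_algebra = coalgebra R H + ring H for R (structure) and H (structure) +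
  assumes mult_coalgebra: "coalgebra_operation R H (\<lambda>x y. x \<otimes>\<^bsub>H\<^esub> y)"
    and comult_one: "comult H \<one>\<^bsub>H\<^esub> = pure_tensor R H H \<one>\<^bsub>H\<^esub> \<one>\<^bsub>H\<^esub>"
    and counit_one: "counit H \<one>\<^bsub>H\<^esub> = \<one>\<^bsub>R\<^esub>"
    and antipode_linear: "linear_map R H H (antipode H)"
    and antipode_left: "x \<in> carrier H \<Longrightarrow>
      sweedler R H H (\<lambda>a b. antipode H a \<otimes>\<^bsub>H\<^esub> b) x = counit H x \<odot>\<^bsub>H\<^esub> \<one>\<^bsub>H\<^esub>"
    and antipode_right: "x \<in> carrier H \<Longrightarrow>
      sweedler R H H (\<lambda>a b. a \<otimes>\<^bsub>H\<^esub> antipode H b) x = counit H x \<odot>\<^bsub>H\<^esub> \<one>\<^bsub>H\<^esub>"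

definition hopf_algebra_hom ::
    "('k, 'm) ring_scheme \<Rightarrow> ('k, 'a, 'x) hopf_algebra_scheme \<Rightarrow> ('k, 'b, 'y) hopf_algebra_scheme
      \<Rightarrow> ('a \<Rightarrow> 'b) \<Rightarrow> bool" where
  "hopf_algebra_hom R H K f \<longleftrightarrow>
     f \<in> ring_hom H K \<and> coalgebra_hom R H K f \<and>
     (\<forall>x \<in> carrier H. f (antipode H x) = antipode K (f x))"

text \<open>All data take the value \<open>undefined\<close> outside their domain. This removes the arbitrary values
  of HOL functions outside the carriers, so that equality of records is equality of structures.\<close>

definition hopf_algebra_extensional ::
    "('k, 'm) ring_scheme \<Rightarrow> ('k, 'a, 'x) hopf_algebra_scheme \<Rightarrow> bool" where
  "hopf_algebra_extensional R H \<longleftrightarrow>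
     case_prod (ring.add H) \<in> extensional (carrier H \<times> carrier H) \<and>
     case_prod (monoid.mult H) \<in> extensional (carrier H \<times> carrier H) \<and>
     case_prod (smult H) \<in> extensional (carrier R \<times> carrier H) \<and>
     comult H \<in> extensional (carrier H) \<and>
     counit H \<in> extensional (carrier H) \<and>
     antipode H \<in> extensional (carrier H)"


section \<open>Hopf trusses\<close>

record ('k, 'a) hopf_truss = "('k, 'a) hopf_algebra" +
  circ :: "'a \<Rightarrow> 'a \<Rightarrow> 'a" (infixl \<open>\<star>\<index>\<close> 70)
  truss_map :: "'a \<Rightarrow> 'a"

text \<open>The map \<open>\<Phi>\<close> is \<open>truss_map\<close>.\<close>

locale hopf_truss = hopf_algebra R H for R (structure) and H (structure) +
  assumes cocomm: "cocommutative R H"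
    and circ_coalgebra: "coalgebra_operation R H (\<lambda>x y. x \<star>\<^bsub>H\<^esub> y)"
    and circ_assoc: "\<lbrakk>x \<in> carrier H; y \<in> carrier H; z \<in> carrier H\<rbrakk> \<Longrightarrow>
      (x \<star>\<^bsub>H\<^esub> y) \<star>\<^bsub>H\<^esub> z = x \<star>\<^bsub>H\<^esub> (y \<star>\<^bsub>H\<^esub> z)"
    and truss_map_coalgebra: "coalgebra_hom R H H (truss_map H)"
    and circ_mult: "\<lbrakk>x \<in> carrier H; y \<in> carrier H; z \<in> carrier H\<rbrakk> \<Longrightarrow>
      x \<star>\<^bsub>H\<^esub> (y \<otimes>\<^bsub>H\<^esub> z) =
      sweedler R H H (\<lambda>x1 u. sweedler R H H (\<lambda>x2 x3.
        (x1 \<star>\<^bsub>H\<^esub> y) \<otimes>\<^bsub>H\<^esub> antipode H (truss_map H x2) \<otimes>\<^bsub>H\<^esub> (x3 \<star>\<^bsub>H\<^esub> z)) u) x"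

definition hopf_truss_hom ::
    "('k, 'm) ring_scheme \<Rightarrow> ('k, 'a, 'x) hopf_truss_scheme \<Rightarrow> ('k, 'b, 'y) hopf_truss_scheme
      \<Rightarrow> ('a \<Rightarrow> 'b) \<Rightarrow> bool" where
  "hopf_truss_hom R H K f \<longleftrightarrow>
     hopf_algebra_hom R H K f \<and>
     (\<forall>x \<in> carrier H. \<forall>y \<in> carrier H. f (x \<star>\<^bsub>H\<^esub> y) = f x \<star>\<^bsub>K\<^esub> f y) \<and>
     (\<forall>x \<in> carrier H. f (truss_map H x) = truss_map K (f x))"


section \<open>Weak twisted post-Hopf algebras\<close>

record ('k, 'a) wtp_hopf = "('k, 'a) hopf_algebra" +
  rhd :: "'a \<Rightarrow> 'a \<Rightarrow> 'a" (infixr \<open>\<rhd>\<index>\<close> 70)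
  twist_map :: "'a \<Rightarrow> 'a"

definition wtp_circ ::
    "('k, 'm) ring_scheme \<Rightarrow> ('k, 'a, 'x) wtp_hopf_scheme \<Rightarrow> 'a \<Rightarrow> 'a \<Rightarrow> 'a" where
  "wtp_circ R H x y = sweedler R H H (\<lambda>x1 x2. twist_map H x1 \<otimes>\<^bsub>H\<^esub> (x2 \<rhd>\<^bsub>H\<^esub> y)) x"

text \<open>The map \<open>\<Phi>\<close> is \<open>twist_map\<close>.\<close>

locale wtp_hopf = hopf_algebra R H for R (structure) and H (structure) +
  assumes cocomm: "cocommutative R H"
    and rhd_coalgebra: "coalgebra_operation R H (\<lambda>x y. x \<rhd>\<^bsub>H\<^esub> y)"
    and twist_map_coalgebra: "coalgebra_hom R H H (twist_map H)"
    and rhd_mult: "\<lbrakk>x \<in> carrier H; y \<in> carrier H; z \<in> carrier H\<rbrakk> \<Longrightarrow>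
      x \<rhd>\<^bsub>H\<^esub> (y \<otimes>\<^bsub>H\<^esub> z) = sweedler R H H (\<lambda>x1 x2. (x1 \<rhd>\<^bsub>H\<^esub> y) \<otimes>\<^bsub>H\<^esub> (x2 \<rhd>\<^bsub>H\<^esub> z)) x"
    and circ_rhd: "\<lbrakk>x \<in> carrier H; y \<in> carrier H; z \<in> carrier H\<rbrakk> \<Longrightarrow>
      wtp_circ R H x y \<rhd>\<^bsub>H\<^esub> z = x \<rhd>\<^bsub>H\<^esub> (y \<rhd>\<^bsub>H\<^esub> z)"
    and twist_map_circ: "\<lbrakk>x \<in> carrier H; y \<in> carrier H\<rbrakk> \<Longrightarrow>
      twist_map H (wtp_circ R H x y) = wtp_circ R H x (twist_map H y)"

definition wtp_hopf_hom ::
    "('k, 'm) ring_scheme \<Rightarrow> ('k, 'a, 'x) wtp_hopf_scheme \<Rightarrow> ('k, 'b, 'y) wtp_hopf_scheme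
      \<Rightarrow> ('a \<Rightarrow> 'b) \<Rightarrow> bool" where
  "wtp_hopf_hom R H K f \<longleftrightarrow>
     hopf_algebra_hom R H K f \<and>
     (\<forall>x \<in> carrier H. \<forall>y \<in> carrier H. f (x \<rhd>\<^bsub>H\<^esub> y) = f x \<rhd>\<^bsub>K\<^esub> f y) \<and>
     (\<forall>x \<in> carrier H. f (twist_map H x) = twist_map K (f x))"


section \<open>Categories\<close>

text \<open>Hom-sets for different pairs of objects need not be disjoint, so identities, composition and
  the action of functors on arrows take the objects involved as arguments.\<close>

record ('o, 'f) category =
  Ob :: "'o set"
  Hom :: "'o \<Rightarrow> 'o \<Rightarrow> 'f set"
  Id :: "'o \<Rightarrow> 'f"
  Comp :: "'o \<Rightarrow> 'o \<Rightarrow> 'o \<Rightarrow> 'f \<Rightarrow> 'f \<Rightarrow> 'f" \<comment> \<open>\<open>Comp A B C g f\<close> is \<open>g \<circ> f\<close> for \<open>f : A \<rightarrow> B\<close> and \<open>g : B \<rightarrow> C\<close>\<close>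

locale category =
  fixes C :: "('o, 'f) category"
  assumes Id_in: "A \<in> Ob C \<Longrightarrow> Id C A \<in> Hom C A A"
    and Comp_in: "\<lbrakk>A \<in> Ob C; B \<in> Ob C; D \<in> Ob C; f \<in> Hom C A B; g \<in> Hom C B D\<rbrakk> \<Longrightarrow>
      Comp C A B D g f \<in> Hom C A D"
    and Comp_Id: "\<lbrakk>A \<in> Ob C; B \<in> Ob C; f \<in> Hom C A B\<rbrakk> \<Longrightarrow> Comp C A A B f (Id C A) = f"
    and Id_Comp: "\<lbrakk>A \<in> Ob C; B \<in> Ob C; f \<in> Hom C A B\<rbrakk> \<Longrightarrow> Comp C A B B (Id C B) f = f"
    and Comp_assoc: "\<lbrakk>A \<in> Ob C; B \<in> Ob C; D \<in> Ob C; E \<in> Ob C;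
        f \<in> Hom C A B; g \<in> Hom C B D; h \<in> Hom C D E\<rbrakk> \<Longrightarrow>
      Comp C A D E h (Comp C A B D g f) = Comp C A B E (Comp C B D E h g) f"

definition is_functor ::
    "('o, 'f) category \<Rightarrow> ('p, 'g) category \<Rightarrow> ('o \<Rightarrow> 'p) \<Rightarrow> ('o \<Rightarrow> 'o \<Rightarrow> 'f \<Rightarrow> 'g) \<Rightarrow> bool" where
  "is_functor C D F0 F1 \<longleftrightarrow>
     F0 \<in> Ob C \<rightarrow> Ob D \<and>
     (\<forall>A \<in> Ob C. \<forall>B \<in> Ob C. F1 A B \<in> Hom C A B \<rightarrow> Hom D (F0 A) (F0 B)) \<and>
     (\<forall>A \<in> Ob C. F1 A A (Id C A) = Id D (F0 A)) \<and>
     (\<forall>A \<in> Ob C. \<forall>B \<in> Ob C. \<forall>E \<in> Ob C. \<forall>f \<in> Hom C A B. \<forall>g \<in> Hom C B E.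
        F1 A E (Comp C A B E g f) = Comp D (F0 A) (F0 B) (F0 E) (F1 B E g) (F1 A B f))"

definition isomorphic_categories :: "('o, 'f) category \<Rightarrow> ('p, 'g) category \<Rightarrow> bool" where
  "isomorphic_categories C D \<longleftrightarrow>
     category C \<and> category D \<and>
     (\<exists>F0 F1 G0 G1. is_functor C D F0 F1 \<and> is_functor D C G0 G1 \<and>
        (\<forall>A \<in> Ob C. G0 (F0 A) = A) \<and>
        (\<forall>A \<in> Ob C. \<forall>B \<in> Ob C. \<forall>f \<in> Hom C A B. G1 (F0 A) (F0 B) (F1 A B f) = f) \<and>
        (\<forall>A \<in> Ob D. F0 (G0 A) = A) \<and>
        (\<forall>A \<in> Ob D. \<forall>B \<in> Ob D. \<forall>g \<in> Hom D A B. F1 (G0 A) (G0 B) (G1 A B g) = g))"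

text \<open>The categories of structures over \<open>R\<close> whose carriers are subsets of the type \<open>'a\<close>; here
  \<open>'a\<close>, being arbitrary, plays the role of a universe.\<close>

definition HT :: "('k, 'm) ring_scheme \<Rightarrow> (('k, 'a) hopf_truss, 'a \<Rightarrow> 'a) category" where
  "HT R =
     \<lparr>Ob = {H. hopf_truss R H \<and> hopf_algebra_extensional R H \<and>
               case_prod (circ H) \<in> extensional (carrier H \<times> carrier H) \<and>
               truss_map H \<in> extensional (carrier H)},
      Hom = (\<lambda>H K. {f \<in> extensional (carrier H). hopf_truss_hom R H K f}),
      Id = (\<lambda>H. \<lambda>x \<in> carrier H. x),
      Comp = (\<lambda>H K L g f. compose (carrier H) g f)\<rparr>"

definition WTH :: "('k, 'm) ring_scheme \<Rightarrow> (('k, 'a) wtp_hopf, 'a \<Rightarrow> 'a) category" where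
  "WTH R =
     \<lparr>Ob = {H. wtp_hopf R H \<and> hopf_algebra_extensional R H \<and>
               case_prod (rhd H) \<in> extensional (carrier H \<times> carrier H) \<and>
               twist_map H \<in> extensional (carrier H)},
      Hom = (\<lambda>H K. {f \<in> extensional (carrier H). wtp_hopf_hom R H K f}),
      Id = (\<lambda>H. \<lambda>x \<in> carrier H. x),
      Comp = (\<lambda>H K L g f. compose (carrier H) g f)\<rparr>"

end

theory Submission
  imports Defs
begin

text \<open>A Hopf truss has an operation \<open>\<circ>\<close> and a weak twisted post-Hopf algebra an
  operation \<open>\<rhd>\<close> on a cocommutative Hopf algebra \<open>H\<close> with a
  coalgebra map \<open>\<Phi>\<close>. The two are linked by \<open>x \<circ> y =
  \<Phi>(x\<^sub>1) (x\<^sub>2 \<rhd> y)\<close>, which says that for each \<open>y\<close> the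
  map \<open>_ \<circ> y\<close> is the convolution of \<open>\<Phi>\<close> with \<open>_ \<rhd>
  y\<close>. A coalgebra map is invertible for convolution, its inverse being its composition with
  the antipode. So \<open>\<rhd>\<close> is recovered as \<open>x \<rhd> y = S(\<Phi>(x\<^sub>1))
  (x\<^sub>2 \<circ> y)\<close>, and the two passages are mutually inverse. Cocommutativity makes
  the new operation a coalgebra morphism (\<open>convolution_operation\<close>); in the direction
  that involves \<open>S\<close> it is also needed to see that \<open>S\<close> is a coalgebra map
  (\<open>antipode_coalgebra_hom\<close>).

  The axioms correspond by cancelling convolution factors. The truss law is the law \<open>x
  \<rhd> (yz) = (x\<^sub>1 \<rhd> y)(x\<^sub>2 \<rhd> z)\<close> convolved with
  \<open>\<Phi>\<close> (\<open>circ_mult_iff_tri_mult\<close>). Associativity of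
  \<open>\<circ>\<close> is the law \<open>(x \<circ> y) \<rhd> z = x \<rhd> (y \<rhd> z)\<close>
  convolved, in the two variables \<open>x\<close> and \<open>y\<close>, with the coalgebra map
  \<open>\<Phi>(x \<circ> y)\<close> (\<open>circ_assoc_iff_tri_circ\<close>); this presupposes
  \<open>\<Phi>(x \<circ> y) = x \<circ> \<Phi>(y)\<close>. That last law is an axiom on one side,
  and on the other it follows from associativity because \<open>\<Phi>(x) = x \<circ> 1\<close> in
  every Hopf truss (\<open>truss_map_eq_circ_one\<close>). Finally, a Hopf algebra map that
  commutes with \<open>\<Phi>\<close> preserves one operation if and only if it preserves the
  other (\<open>hopf_twist_hom_iff\<close>), so the functors are the identity on arrows.

  Sweedler sums are lifts of bilinear maps to tensor products, so the universal property of the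
  tensor product comes first. It yields the rules of the calculus for multilinear maps:
  interchange of independent sums (\<open>sw_swap\<close>), rebracketing
  (\<open>sw_coassoc\<close>) and exchange of the inner factors of a fourfold coproduct
  (\<open>sw_middle_swap\<close>).\<close>

section \<open>Tensor products of modules\<close>

locale module_pair = M: module R M + N: module R N for R (structure) and M and N
begin

abbreviation "F \<equiv> free_Abelian_group (carrier M \<times> carrier N)"
abbreviation "K \<equiv> tensor_kernel R M N"
abbreviation "TG \<equiv> tensor_group R M N"
abbreviation "T \<equiv> tensor R M N"
abbreviation "pure \<equiv> pure_tensor R M N"

lemma frag_of_closed: "\<lbrakk>x \<in> carrier M; y \<in> carrier N\<rbrakk> \<Longrightarrow> frag_of (x, y) \<in> carrier F"
  and frag_add_closed: "\<lbrakk>a \<in> carrier F; b \<in> carrier F\<rbrakk> \<Longrightarrow> a + b \<in> carrier F"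
  and frag_diff_closed: "\<lbrakk>a \<in> carrier F; b \<in> carrier F\<rbrakk> \<Longrightarrow> a - b \<in> carrier F"
  using keys_add[of a b] keys_diff[of a b] by auto

lemmas frag_closed = frag_of_closed frag_add_closed frag_diff_closed

lemma tensor_rels_subset: "tensor_rels R M N \<subseteq> carrier F"
  unfolding tensor_rels_def
  by (auto intro!: frag_closed simp del: carrier_free_Abelian_group_iff)

lemma tensor_kernel_normal: "K \<lhd> F"
proof -
  interpret F: comm_group F by (rule abelian_free_Abelian_group)
  show ?thesis
    unfolding tensor_kernel_def
    by (simp add: F.normal_iff_subgroup F.generate_is_subgroup tensor_rels_subset)
qed

lemma comm_group_tensor: "comm_group TG"
  unfolding tensor_group_def
  using comm_group.abelian_FactGroup[OF abelian_free_Abelian_group]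
    tensor_kernel_normal normal_imp_subgroup by blast

lemma coset_eqI:
  assumes "a \<in> carrier F" "b \<in> carrier F" "a - b \<in> K"
  shows "K #>\<^bsub>F\<^esub> a = K #>\<^bsub>F\<^esub> b"
proof -
  interpret normal K F by (rule tensor_kernel_normal)
  have "a \<in> K #>\<^bsub>F\<^esub> b"
    using assms by (subst rcos_module) auto
  then show ?thesis
    using assms repr_independence subgroup_axioms by metis
qed

lemma tensor_group_mult_coset:
  assumes "a \<in> carrier F" "b \<in> carrier F"
  shows "(K #>\<^bsub>F\<^esub> a) \<otimes>\<^bsub>TG\<^esub> (K #>\<^bsub>F\<^esub> b) = K #>\<^bsub>F\<^esub> (a + b)"
  using normal.rcos_sum[OF tensor_kernel_normal assms]
  by (simp add: tensor_group_def)

lemma carrier_tensor [simp]: "carrier T = carrier TG"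
  and zero_tensor: "\<zero>\<^bsub>T\<^esub> = \<one>\<^bsub>TG\<^esub>"
  and add_tensor: "x \<oplus>\<^bsub>T\<^esub> y = x \<otimes>\<^bsub>TG\<^esub> y"
  by (simp_all add: tensor_def)

lemma pure_closed [simp, intro]:
  "\<lbrakk>x \<in> carrier M; y \<in> carrier N\<rbrakk> \<Longrightarrow> pure x y \<in> carrier TG"
  by (auto simp: pure_tensor_def tensor_group_def carrier_FactGroup)

lemma rel_in_kernel: "c \<in> tensor_rels R M N \<Longrightarrow> c \<in> K"
  unfolding tensor_kernel_def by (rule generate.incl)

lemma pure_add_left:
  assumes "x \<in> carrier M" "x' \<in> carrier M" "y \<in> carrier N"
  shows "pure (x \<oplus>\<^bsub>M\<^esub> x') y = pure x y \<otimes>\<^bsub>TG\<^esub> pure x' y"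
proof -
  have "frag_of (x \<oplus>\<^bsub>M\<^esub> x', y) - (frag_of (x, y) + frag_of (x', y)) \<in> K"
    unfolding diff_diff_eq[symmetric]
    by (rule rel_in_kernel) (use assms in \<open>auto simp: tensor_rels_def\<close>)
  then show ?thesis
    unfolding pure_tensor_def using assms
    by (simp add: tensor_group_mult_coset frag_closed coset_eqI del: carrier_free_Abelian_group_iff)
qed

lemma pure_add_right:
  assumes "x \<in> carrier M" "y \<in> carrier N" "y' \<in> carrier N"
  shows "pure x (y \<oplus>\<^bsub>N\<^esub> y') = pure x y \<otimes>\<^bsub>TG\<^esub> pure x y'"
proof -
  have "frag_of (x, y \<oplus>\<^bsub>N\<^esub> y') - (frag_of (x, y) + frag_of (x, y')) \<in> K"
    unfolding diff_diff_eq[symmetric]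
    by (rule rel_in_kernel) (use assms in \<open>auto simp: tensor_rels_def\<close>)
  then show ?thesis
    unfolding pure_tensor_def using assms
    by (simp add: tensor_group_mult_coset frag_closed coset_eqI del: carrier_free_Abelian_group_iff)
qed

lemma pure_smult:
  assumes "r \<in> carrier R" "x \<in> carrier M" "y \<in> carrier N"
  shows "pure (r \<odot>\<^bsub>M\<^esub> x) y = pure x (r \<odot>\<^bsub>N\<^esub> y)"
  unfolding pure_tensor_def
  by (rule coset_eqI) (use assms in \<open>auto intro!: rel_in_kernel simp: tensor_rels_def\<close>)

lemma inv_pure:
  assumes "x \<in> carrier M" "y \<in> carrier N"
  shows "inv\<^bsub>TG\<^esub> (pure x y) = pure (\<ominus>\<^bsub>M\<^esub> x) y"
proof -
  interpret TG: comm_group TG by (rule comm_group_tensor)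
  have "pure \<zero>\<^bsub>M\<^esub> y \<otimes>\<^bsub>TG\<^esub> pure \<zero>\<^bsub>M\<^esub> y = pure \<zero>\<^bsub>M\<^esub> y"
    using pure_add_left[of "\<zero>\<^bsub>M\<^esub>" "\<zero>\<^bsub>M\<^esub>" y] assms by simp
  then have "pure \<zero>\<^bsub>M\<^esub> y = \<one>\<^bsub>TG\<^esub>"
    using assms TG.l_cancel_one' by (metis M.zero_closed pure_closed)
  then have "pure (\<ominus>\<^bsub>M\<^esub> x) y \<otimes>\<^bsub>TG\<^esub> pure x y = \<one>\<^bsub>TG\<^esub>"
    using pure_add_left[of "\<ominus>\<^bsub>M\<^esub> x" x y] assms by (simp add: M.l_neg)
  then show ?thesis
    using assms by (intro TG.inv_equality) auto
qed

text \<open>A coset of a finitely supported function is a sum of pure tensors and of their inverses. Since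
  \<open>-(x \<otimes> y) = (-x) \<otimes> y\<close> is again pure, sums suffice.\<close>

lemma tensor_group_induct [consumes 1, case_names pure add]:
  assumes "t \<in> carrier TG"
    and pure: "\<And>x y. \<lbrakk>x \<in> carrier M; y \<in> carrier N\<rbrakk> \<Longrightarrow> P (pure x y)"
    and add: "\<And>s t. \<lbrakk>s \<in> carrier TG; t \<in> carrier TG; P s; P t\<rbrakk> \<Longrightarrow> P (s \<otimes>\<^bsub>TG\<^esub> t)"
  shows "P t"
proof -
  interpret TG: comm_group TG by (rule comm_group_tensor)
  interpret NK: normal K F by (rule tensor_kernel_normal)
  have coset_closed: "K #>\<^bsub>F\<^esub> c \<in> carrier TG" if "c \<in> carrier F" for c
    using that by (auto simp: tensor_group_def carrier_FactGroup)
  have one: "\<one>\<^bsub>TG\<^esub> = K #>\<^bsub>F\<^esub> 0"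
    using NK.coset_mult_one[OF NK.subset] by (simp add: tensor_group_def)
  have inv_coset: "inv\<^bsub>TG\<^esub> (K #>\<^bsub>F\<^esub> c) = K #>\<^bsub>F\<^esub> (- c)" if "c \<in> carrier F" for c
    using that tensor_group_mult_coset[of "- c" c] one
    by (intro TG.inv_equality) (auto simp: coset_closed)
  \<comment> \<open>The induction proceeds by differences, so the inverse is carried along.\<close>
  have "P (K #>\<^bsub>F\<^esub> c) \<and> P (inv\<^bsub>TG\<^esub> (K #>\<^bsub>F\<^esub> c)) \<and> c \<in> carrier F"
    if "Poly_Mapping.keys c \<subseteq> carrier M \<times> carrier N" for c
    using that
  proof (induction rule: frag_induction)
    case zero
    have "P (pure \<zero>\<^bsub>M\<^esub> \<zero>\<^bsub>N\<^esub> \<otimes>\<^bsub>TG\<^esub> pure (\<ominus>\<^bsub>M\<^esub> \<zero>\<^bsub>M\<^esub>) \<zero>\<^bsub>N\<^esub>)"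
      by (intro add pure pure_closed) auto
    then have "P \<one>\<^bsub>TG\<^esub>"
      by (simp flip: inv_pure del: M.minus_zero)
    then show ?case by (simp flip: one)
  next
    case (one c)
    then obtain x y where c: "c = (x, y)" "x \<in> carrier M" "y \<in> carrier N" by auto
    then show ?case
      using pure[of x y] pure[of "\<ominus>\<^bsub>M\<^esub> x" y] by (auto simp flip: inv_pure) (auto simp: pure_tensor_def)
  next
    case (diff a b)
    then have ab: "a \<in> carrier F" "b \<in> carrier F" and mb: "- b \<in> carrier F" by auto
    have eq: "K #>\<^bsub>F\<^esub> (a - b) = (K #>\<^bsub>F\<^esub> a) \<otimes>\<^bsub>TG\<^esub> inv\<^bsub>TG\<^esub> (K #>\<^bsub>F\<^esub> b)"
      using tensor_group_mult_coset[OF ab(1) mb] by (simp add: inv_coset[OF ab(2)])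
    have "inv\<^bsub>TG\<^esub> (K #>\<^bsub>F\<^esub> (a - b)) = inv\<^bsub>TG\<^esub> (K #>\<^bsub>F\<^esub> a) \<otimes>\<^bsub>TG\<^esub> (K #>\<^bsub>F\<^esub> b)"
      unfolding eq using coset_closed[OF ab(1)] coset_closed[OF ab(2)]
      by (simp add: TG.inv_mult)
    with eq diff show ?case
      using coset_closed[OF ab(1)] coset_closed[OF ab(2)] frag_diff_closed[OF ab]
      by (auto intro!: add)
  qed
  moreover obtain c where "c \<in> carrier F" "t = K #>\<^bsub>F\<^esub> c"
    using assms(1) by (auto simp: tensor_group_def carrier_FactGroup)
  ultimately show ?thesis by auto
qed

end

text \<open>The target is only a group, so compatibility with scalars is a relation between the two
  arguments.\<close>

definition balanced ::
    "('k, 'm) ring_scheme \<Rightarrow> ('k, 'a, 'x) module_scheme \<Rightarrow> ('k, 'b, 'y) module_scheme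
      \<Rightarrow> ('c, 'z) monoid_scheme \<Rightarrow> ('a \<Rightarrow> 'b \<Rightarrow> 'c) \<Rightarrow> bool" where
  "balanced R M N G f \<longleftrightarrow>
     (\<forall>x \<in> carrier M. \<forall>y \<in> carrier N. f x y \<in> carrier G) \<and>
     (\<forall>x \<in> carrier M. \<forall>x' \<in> carrier M. \<forall>y \<in> carrier N. f (x \<oplus>\<^bsub>M\<^esub> x') y = f x y \<otimes>\<^bsub>G\<^esub> f x' y) \<and>
     (\<forall>x \<in> carrier M. \<forall>y \<in> carrier N. \<forall>y' \<in> carrier N. f x (y \<oplus>\<^bsub>N\<^esub> y') = f x y \<otimes>\<^bsub>G\<^esub> f x y') \<and>
     (\<forall>r \<in> carrier R. \<forall>x \<in> carrier M. \<forall>y \<in> carrier N. f (r \<odot>\<^bsub>M\<^esub> x) y = f x (r \<odot>\<^bsub>N\<^esub> y))"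

context module_pair begin

lemma tensor_hom_unique:
  assumes "h \<in> hom TG G" "h' \<in> hom TG G"
    and "\<And>x y. \<lbrakk>x \<in> carrier M; y \<in> carrier N\<rbrakk> \<Longrightarrow> h (pure x y) = h' (pure x y)"
    and "t \<in> carrier TG"
  shows "h t = h' t"
  using assms(4) by (induction rule: tensor_group_induct) (use assms in \<open>auto simp: hom_mult\<close>)

text \<open>The map extends additively to the free abelian group. Being balanced means that this extension
  vanishes on the generating relations, so that it descends to the quotient.\<close>

lemma tensor_hom_exists:
  assumes "comm_group G" "balanced R M N G f"
  obtains h where "h \<in> hom TG G" "\<And>x y. \<lbrakk>x \<in> carrier M; y \<in> carrier N\<rbrakk> \<Longrightarrow> h (pure x y) = f x y"
proof -
  interpret G: comm_group G by fact
  have "case_prod f ` (carrier M \<times> carrier N) \<subseteq> carrier G"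
    using assms(2) by (auto simp: balanced_def)
  then obtain h where h: "h \<in> hom F G"
    and h_frag: "\<And>z. z \<in> carrier M \<times> carrier N \<Longrightarrow> h (frag_of z) = case_prod f z"
    using G.free_Abelian_group_universal by blast
  interpret h: group_hom F G h
    by (simp add: group_hom_def group_hom_axioms_def h)
  have h_diff: "h (a - b) = h a \<otimes>\<^bsub>G\<^esub> inv\<^bsub>G\<^esub> (h b)" if "a \<in> carrier F" "b \<in> carrier F" for a b
    using h.hom_mult[of a "inv\<^bsub>F\<^esub> b"] h.hom_inv[of b] that by simp
  have frag: "frag_of (x, y) \<in> carrier F" "h (frag_of (x, y)) = f x y" "f x y \<in> carrier G"
    if "x \<in> carrier M" "y \<in> carrier N" for x y
    using that h_frag assms(2) by (auto simp: balanced_def)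
  have one: "h (a - b) = \<one>\<^bsub>G\<^esub>" if "a \<in> carrier F" "b \<in> carrier F" "h a = h b" for a b
    using that h.hom_closed[OF that(2)] by (simp add: h_diff del: carrier_free_Abelian_group_iff)
  have h_add: "h (a + b) = h a \<otimes>\<^bsub>G\<^esub> h b" if "a \<in> carrier F" "b \<in> carrier F" for a b
    using h.hom_mult that by simp
  have "tensor_rels R M N \<subseteq> kernel F G h"
    using assms(2) unfolding tensor_rels_def kernel_def balanced_def
    by (auto simp: diff_diff_eq frag frag_closed h_add intro!: one
        simp del: carrier_free_Abelian_group_iff)
  then have "K \<subseteq> kernel F G h"
    unfolding tensor_kernel_def
    by (intro h.generate_subgroup_incl h.subgroup_kernel)
  then obtain g where "g \<in> hom TG G" "\<And>c. c \<in> carrier F \<Longrightarrow> g (K #>\<^bsub>F\<^esub> c) = h c"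
    using h.FactGroup_universal_kernel tensor_kernel_normal unfolding tensor_group_def by metis
  then show thesis
    by (intro that[of g]) (auto simp: pure_tensor_def frag)
qed

text \<open>The definite description in \<open>tensor_lift\<close> is proper: extensionality fixes the value
  outside the carrier, and inside it two candidates agree because pure tensors generate.\<close>

lemma tensor_lift_properties:
  assumes "comm_group G" "balanced R M N G f"
  shows "tensor_lift R M N G f \<in> hom TG G"
    and "\<And>x y. \<lbrakk>x \<in> carrier M; y \<in> carrier N\<rbrakk> \<Longrightarrow> tensor_lift R M N G f (pure x y) = f x y"
proof -
  interpret TG: comm_group TG by (rule comm_group_tensor)
  obtain h where h: "h \<in> hom TG G" "\<And>x y. \<lbrakk>x \<in> carrier M; y \<in> carrier N\<rbrakk> \<Longrightarrow> h (pure x y) = f x y"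
    using tensor_hom_exists[OF assms] by blast
  let ?P = "\<lambda>h. h \<in> extensional (carrier TG) \<and> h \<in> hom TG G \<and>
       (\<forall>x \<in> carrier M. \<forall>y \<in> carrier N. h (pure x y) = f x y)"
  have "\<exists>!h. ?P h"
  proof (rule ex1I[of _ "restrict h (carrier TG)"])
    show "?P (restrict h (carrier TG))"
      using h by (auto simp: hom_def)
    show "g = restrict h (carrier TG)" if "?P g" for g
    proof (rule extensionalityI[of _ "carrier TG"])
      show "g t = restrict h (carrier TG) t" if "t \<in> carrier TG" for t
        using tensor_hom_unique[of g G h t] h \<open>?P g\<close> that by auto
    qed (use that in auto)
  qed
  then have "?P (tensor_lift R M N G f)"
    unfolding tensor_lift_def by (rule theI')
  then show "tensor_lift R M N G f \<in> hom TG G"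
    and "\<And>x y. \<lbrakk>x \<in> carrier M; y \<in> carrier N\<rbrakk> \<Longrightarrow> tensor_lift R M N G f (pure x y) = f x y"
    by auto
qed

end

lemma tensor_lift_cong:
  assumes "\<And>x y. \<lbrakk>x \<in> carrier M; y \<in> carrier N\<rbrakk> \<Longrightarrow> f x y = g x y"
  shows "tensor_lift R M N G f = tensor_lift R M N G g"
  unfolding tensor_lift_def using assms by (auto intro!: arg_cong[where f = The])

lemma module_comm_group: "module R P \<Longrightarrow> comm_group (add_monoid P)"
  using abelian_group.a_comm_group module.axioms(2) by blast

context module_pair begin

text \<open>Scalar multiplication on the tensor product is itself a lift, and this is the condition that
  makes it well defined.\<close>

lemma pure_smult_balanced:
  assumes "r \<in> carrier R"
  shows "balanced R M N TG (\<lambda>x y. pure (r \<odot>\<^bsub>M\<^esub> x) y)"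
proof -
  have "pure (r \<odot>\<^bsub>M\<^esub> (s \<odot>\<^bsub>M\<^esub> x)) y = pure (r \<odot>\<^bsub>M\<^esub> x) (s \<odot>\<^bsub>N\<^esub> y)"
    if "s \<in> carrier R" "x \<in> carrier M" "y \<in> carrier N" for s x y
  proof -
    have "r \<odot>\<^bsub>M\<^esub> (s \<odot>\<^bsub>M\<^esub> x) = s \<odot>\<^bsub>M\<^esub> (r \<odot>\<^bsub>M\<^esub> x)"
      using assms that by (metis M.smult_assoc1 M.R.m_comm)
    then show ?thesis
      using assms that by (simp add: pure_smult)
  qed
  with assms show ?thesis
    unfolding balanced_def by (simp add: M.smult_r_distr pure_add_left pure_add_right)
qed

lemma smult_hom: "r \<in> carrier R \<Longrightarrow> (\<lambda>t. r \<odot>\<^bsub>T\<^esub> t) \<in> hom TG TG"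
  using tensor_lift_properties(1)[OF comm_group_tensor pure_smult_balanced]
  by (simp add: tensor_def)

lemma smult_pure:
  "\<lbrakk>r \<in> carrier R; x \<in> carrier M; y \<in> carrier N\<rbrakk> \<Longrightarrow> r \<odot>\<^bsub>T\<^esub> pure x y = pure (r \<odot>\<^bsub>M\<^esub> x) y"
  using tensor_lift_properties(2)[OF comm_group_tensor pure_smult_balanced]
  by (simp add: tensor_def)

text \<open>Both sides of a module law are additive in the tensor, so it is enough to compare them on pure
  tensors.\<close>

lemma module_tensor: "module R T"
proof -
  interpret TG: comm_group TG by (rule comm_group_tensor)
  have smult_closed: "r \<odot>\<^bsub>T\<^esub> t \<in> carrier TG" if "r \<in> carrier R" "t \<in> carrier TG" for r t
    using smult_hom[OF that(1)] that(2) by (rule hom_in_carrier)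
  have smult_mult: "r \<odot>\<^bsub>T\<^esub> (s \<otimes>\<^bsub>TG\<^esub> t) = (r \<odot>\<^bsub>T\<^esub> s) \<otimes>\<^bsub>TG\<^esub> (r \<odot>\<^bsub>T\<^esub> t)"
    if "r \<in> carrier R" "s \<in> carrier TG" "t \<in> carrier TG" for r s t
    using smult_hom[OF that(1)] that(2,3) by (rule hom_mult)
  show ?thesis
  proof (rule moduleI)
    show "cring R" by (rule M.R.is_cring)
    show "abelian_group T"
    proof (rule abelian_groupI)
      show "\<exists>s \<in> carrier T. s \<oplus>\<^bsub>T\<^esub> t = \<zero>\<^bsub>T\<^esub>" if "t \<in> carrier T" for t
        using that by (intro bexI[of _ "inv\<^bsub>TG\<^esub> t"]) (auto simp: add_tensor zero_tensor)
    qed (simp_all add: add_tensor zero_tensor TG.m_ac)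
  next
    fix r s t assume "r \<in> carrier R" "s \<in> carrier R" "t \<in> carrier T"
    then have r: "r \<in> carrier R" "s \<in> carrier R" "t \<in> carrier TG" by auto
    show "(r \<oplus>\<^bsub>R\<^esub> s) \<odot>\<^bsub>T\<^esub> t = r \<odot>\<^bsub>T\<^esub> t \<oplus>\<^bsub>T\<^esub> s \<odot>\<^bsub>T\<^esub> t"
      using r(3) unfolding add_tensor
    proof (induction rule: tensor_group_induct)
      case (add a b)
      then show ?case
        using r(1,2) by (simp add: smult_mult smult_closed TG.m_ac)
    qed (use r in \<open>auto simp: smult_pure M.smult_l_distr pure_add_left\<close>)
    show "(r \<otimes>\<^bsub>R\<^esub> s) \<odot>\<^bsub>T\<^esub> t = r \<odot>\<^bsub>T\<^esub> (s \<odot>\<^bsub>T\<^esub> t)"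
      using r(3)
    proof (induction rule: tensor_group_induct)
      case (add a b)
      then show ?case
        using r(1,2) by (simp add: smult_mult smult_closed)
    qed (use r in \<open>auto simp: smult_pure M.smult_assoc1\<close>)
  next
    fix t assume "t \<in> carrier T"
    then have "t \<in> carrier TG" by simp
    then show "\<one>\<^bsub>R\<^esub> \<odot>\<^bsub>T\<^esub> t = t"
      by (induction rule: tensor_group_induct) (auto simp: smult_pure smult_mult)
  qed (auto simp: smult_closed smult_mult add_tensor)
qed

lemma tensor_induct [consumes 1, case_names pure add]:
  assumes "t \<in> carrier T"
    and "\<And>x y. \<lbrakk>x \<in> carrier M; y \<in> carrier N\<rbrakk> \<Longrightarrow> P (pure x y)"
    and "\<And>s t. \<lbrakk>s \<in> carrier T; t \<in> carrier T; P s; P t\<rbrakk> \<Longrightarrow> P (s \<oplus>\<^bsub>T\<^esub> t)"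
  shows "P t"
  using assms(1)[unfolded carrier_tensor] 
  by (induction rule: tensor_group_induct) (use assms(2,3) in \<open>auto simp: add_tensor\<close>)

end

lemma linear_mapI:
  assumes "\<And>x. x \<in> carrier M \<Longrightarrow> f x \<in> carrier N"
    and "\<And>x y. \<lbrakk>x \<in> carrier M; y \<in> carrier M\<rbrakk> \<Longrightarrow> f (x \<oplus>\<^bsub>M\<^esub> y) = f x \<oplus>\<^bsub>N\<^esub> f y"
    and "\<And>r x. \<lbrakk>r \<in> carrier R; x \<in> carrier M\<rbrakk> \<Longrightarrow> f (r \<odot>\<^bsub>M\<^esub> x) = r \<odot>\<^bsub>N\<^esub> f x"
  shows "linear_map R M N f"
  using assms by (auto simp: linear_map_def)

lemma linear_mapD:
  assumes "linear_map R M N f"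
  shows "x \<in> carrier M \<Longrightarrow> f x \<in> carrier N"
    and "\<lbrakk>x \<in> carrier M; y \<in> carrier M\<rbrakk> \<Longrightarrow> f (x \<oplus>\<^bsub>M\<^esub> y) = f x \<oplus>\<^bsub>N\<^esub> f y"
    and "\<lbrakk>r \<in> carrier R; x \<in> carrier M\<rbrakk> \<Longrightarrow> f (r \<odot>\<^bsub>M\<^esub> x) = r \<odot>\<^bsub>N\<^esub> f x"
  using assms by (auto simp: linear_map_def)

lemma bilinear_mapI:
  assumes "\<And>x. x \<in> carrier M \<Longrightarrow> linear_map R N P (\<lambda>y. f x y)"
    and "\<And>y. y \<in> carrier N \<Longrightarrow> linear_map R M P (\<lambda>x. f x y)"
  shows "bilinear_map R M N P f"
  using assms by (auto simp: bilinear_map_def)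

lemma bilinear_mapD:
  assumes "bilinear_map R M N P f"
  shows "x \<in> carrier M \<Longrightarrow> linear_map R N P (\<lambda>y. f x y)"
    and "y \<in> carrier N \<Longrightarrow> linear_map R M P (\<lambda>x. f x y)"
    and "\<lbrakk>x \<in> carrier M; y \<in> carrier N\<rbrakk> \<Longrightarrow> f x y \<in> carrier P"
  using assms by (auto simp: bilinear_map_def linear_map_def)

lemma bilinear_map_balanced:
  "bilinear_map R M N P f \<Longrightarrow> balanced R M N (add_monoid P) f"
  by (auto simp: balanced_def bilinear_map_def linear_map_def)

context module_pair begin

lemma pure_bilinear: "bilinear_map R M N T pure"
proof (intro bilinear_mapI linear_mapI)
qed (auto simp: pure_add_left pure_add_right add_tensor smult_pure pure_smult)

lemma lift_pure:
  assumes "module R P" "bilinear_map R M N P f" "x \<in> carrier M" "y \<in> carrier N"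
  shows "tensor_lift R M N (add_monoid P) f (pure x y) = f x y"
  using tensor_lift_properties(2) module_comm_group bilinear_map_balanced assms by blast

lemma lift_linear:
  assumes "module R P" "bilinear_map R M N P f"
  shows "linear_map R T P (tensor_lift R M N (add_monoid P) f)"
proof -
  interpret P: module R P by fact
  let ?L = "tensor_lift R M N (add_monoid P) f"
  have hom: "?L \<in> hom TG (add_monoid P)"
    using tensor_lift_properties(1) module_comm_group bilinear_map_balanced assms by blast
  have closed: "?L t \<in> carrier P" if "t \<in> carrier T" for t
    using hom_in_carrier[OF hom] that by simp
  have L_add: "?L (s \<oplus>\<^bsub>T\<^esub> t) = ?L s \<oplus>\<^bsub>P\<^esub> ?L t" if "s \<in> carrier T" "t \<in> carrier T" for s t
    using hom_mult[OF hom] that by (simp add: add_tensor)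
  interpret T: module R T by (rule module_tensor)
  have "?L (r \<odot>\<^bsub>T\<^esub> t) = r \<odot>\<^bsub>P\<^esub> ?L t" if "r \<in> carrier R" "t \<in> carrier T" for r t
    using that(2)
  proof (induction rule: tensor_induct)
    case (pure x y)
    then show ?case
      using that assms linear_mapD(3)[OF bilinear_mapD(2)[OF assms(2)]]
      by (simp add: smult_pure lift_pure)
  next
    case (add s t)
    then show ?case
      using that(1) by (simp add: add L_add closed T.smult_r_distr P.smult_r_distr del: carrier_tensor)
  qed
  with closed L_add show ?thesis by (rule linear_mapI)
qed

text \<open>The uniqueness half of the universal property, in the form in which all identities between maps
  on tensor products are proved below.\<close>

lemma tensor_linear_eqI:
  assumes "linear_map R T P h" "linear_map R T P h'"
    and "\<And>x y. \<lbrakk>x \<in> carrier M; y \<in> carrier N\<rbrakk> \<Longrightarrow> h (pure x y) = h' (pure x y)"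
    and "t \<in> carrier T"
  shows "h t = h' t"
  using assms(4)
  by (induction rule: tensor_induct) (use assms(1-3) in \<open>auto simp: linear_mapD simp del: carrier_tensor\<close>)

lemmas pure_tensor_closed = bilinear_mapD(3)[OF pure_bilinear]

text \<open>From here on the tensor product is used through its module structure alone, and its carrier is no
  longer unfolded.\<close>

declare carrier_tensor [simp del]

end

section \<open>Linear maps on tensor products\<close>

lemma linear_id: "linear_map R M M (\<lambda>x. x)"
  by (simp add: linear_map_def)

lemma linear_comp:
  assumes "linear_map R N P g" "linear_map R M N f"
  shows "linear_map R M P (\<lambda>x. g (f x))"
  by (rule linear_mapI) (simp_all add: linear_mapD[OF assms(1)] linear_mapD[OF assms(2)])

lemma linear_bilinear_left:
  assumes "bilinear_map R N P Q b" "linear_map R M N f" "p \<in> carrier P"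
  shows "linear_map R M Q (\<lambda>x. b (f x) p)"
  using linear_comp[OF bilinear_mapD(2)[OF assms(1,3)] assms(2)] .

lemma linear_bilinear_right:
  assumes "bilinear_map R N P Q b" "linear_map R M P f" "n \<in> carrier N"
  shows "linear_map R M Q (\<lambda>x. b n (f x))"
  using linear_comp[OF bilinear_mapD(1)[OF assms(1,3)] assms(2)] .

lemma bilinear_comp:
  assumes "linear_map R P Q g" "bilinear_map R M N P f"
  shows "bilinear_map R M N Q (\<lambda>x y. g (f x y))"
  using assms by (auto intro!: bilinear_mapI linear_comp[OF assms(1)] dest: bilinear_mapD)

lemma linear_add:
  assumes "module R P" "linear_map R M P f" "linear_map R M P g"
  shows "linear_map R M P (\<lambda>x. f x \<oplus>\<^bsub>P\<^esub> g x)"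
proof -
  interpret module R P by fact
  show ?thesis
    by (rule linear_mapI) (use assms(2,3) in \<open>simp_all add: linear_mapD M.a_ac smult_r_distr\<close>)
qed

lemma linear_smult:
  assumes "module R P" "r \<in> carrier R" "linear_map R M P f"
  shows "linear_map R M P (\<lambda>x. r \<odot>\<^bsub>P\<^esub> f x)"
proof -
  interpret module R P by fact
  have "r \<odot>\<^bsub>P\<^esub> (s \<odot>\<^bsub>P\<^esub> p) = s \<odot>\<^bsub>P\<^esub> (r \<odot>\<^bsub>P\<^esub> p)" if "s \<in> carrier R" "p \<in> carrier P" for s p
    using that assms(2) by (metis smult_assoc1 R.m_comm)
  then show ?thesis
    by (intro linear_mapI) (use assms(2,3) in \<open>simp_all add: linear_mapD smult_r_distr\<close>)
qed

context module_pair begin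

lemma lift_add:
  assumes "module R P" "bilinear_map R M N P f" "bilinear_map R M N P g" "t \<in> carrier T"
  shows "tensor_lift R M N (add_monoid P) (\<lambda>x y. f x y \<oplus>\<^bsub>P\<^esub> g x y) t =
    tensor_lift R M N (add_monoid P) f t \<oplus>\<^bsub>P\<^esub> tensor_lift R M N (add_monoid P) g t"
proof -
  have b: "bilinear_map R M N P (\<lambda>x y. f x y \<oplus>\<^bsub>P\<^esub> g x y)"
    using assms by (auto intro!: bilinear_mapI linear_add[OF assms(1)] dest: bilinear_mapD)
  show ?thesis
  proof (rule tensor_linear_eqI[OF _ _ _ assms(4)])
    from b show "linear_map R T P (tensor_lift R M N (add_monoid P) (\<lambda>x y. f x y \<oplus>\<^bsub>P\<^esub> g x y))"
    by (rule lift_linear[OF assms(1)])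
  show "linear_map R T P (\<lambda>t. tensor_lift R M N (add_monoid P) f t \<oplus>\<^bsub>P\<^esub>
    tensor_lift R M N (add_monoid P) g t)"
    using assms by (intro linear_add lift_linear)
qed (use assms b in \<open>simp add: lift_pure\<close>)
qed

lemma lift_smult:
  assumes "module R P" "bilinear_map R M N P f" "r \<in> carrier R" "t \<in> carrier T"
  shows "tensor_lift R M N (add_monoid P) (\<lambda>x y. r \<odot>\<^bsub>P\<^esub> f x y) t =
    r \<odot>\<^bsub>P\<^esub> tensor_lift R M N (add_monoid P) f t"
proof -
  have b: "bilinear_map R M N P (\<lambda>x y. r \<odot>\<^bsub>P\<^esub> f x y)"
    using assms by (auto intro!: bilinear_mapI linear_smult[OF assms(1)] dest: bilinear_mapD)
  show ?thesis
  proof (rule tensor_linear_eqI[OF _ _ _ assms(4)])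
    from b show "linear_map R T P (tensor_lift R M N (add_monoid P) (\<lambda>x y. r \<odot>\<^bsub>P\<^esub> f x y))"
    by (rule lift_linear[OF assms(1)])
  show "linear_map R T P (\<lambda>t. r \<odot>\<^bsub>P\<^esub> tensor_lift R M N (add_monoid P) f t)"
    using assms by (intro linear_smult lift_linear)
qed (use assms b in \<open>simp add: lift_pure\<close>)
qed

text \<open>This is what makes nested Sweedler sums multilinear: a lift inherits linearity in a parameter
  from the map that is lifted, because lifting is itself linear.\<close>

lemma lift_linear_arg:
  assumes P: "module R P"
    and f: "\<And>q. q \<in> carrier Q \<Longrightarrow> bilinear_map R M N P (f q)"
      "\<And>x y. \<lbrakk>x \<in> carrier M; y \<in> carrier N\<rbrakk> \<Longrightarrow> linear_map R Q P (\<lambda>q. f q x y)"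
    and Q: "module R Q" and t: "t \<in> carrier T"
  shows "linear_map R Q P (\<lambda>q. tensor_lift R M N (add_monoid P) (f q) t)"
proof (rule linear_mapI)
  interpret Q: module R Q by fact
  show "tensor_lift R M N (add_monoid P) (f q) t \<in> carrier P" if "q \<in> carrier Q" for q
    using linear_mapD(1)[OF lift_linear[OF P f(1)[OF that]] t] .
  show "tensor_lift R M N (add_monoid P) (f (q \<oplus>\<^bsub>Q\<^esub> q')) t =
    tensor_lift R M N (add_monoid P) (f q) t \<oplus>\<^bsub>P\<^esub> tensor_lift R M N (add_monoid P) (f q') t"
    if "q \<in> carrier Q" "q' \<in> carrier Q" for q q'
    using lift_add[OF P f(1)[OF that(1)] f(1)[OF that(2)] t]
      tensor_lift_cong[of M N "f (q \<oplus>\<^bsub>Q\<^esub> q')" "\<lambda>x y. f q x y \<oplus>\<^bsub>P\<^esub> f q' x y" R "add_monoid P"]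
      linear_mapD(2)[OF f(2) that] by simp
  show "tensor_lift R M N (add_monoid P) (f (r \<odot>\<^bsub>Q\<^esub> q)) t =
    r \<odot>\<^bsub>P\<^esub> tensor_lift R M N (add_monoid P) (f q) t"
    if "r \<in> carrier R" "q \<in> carrier Q" for r q
    using lift_smult[OF P f(1)[OF that(2)] that(1) t]
      tensor_lift_cong[of M N "f (r \<odot>\<^bsub>Q\<^esub> q)" "\<lambda>x y. r \<odot>\<^bsub>P\<^esub> f q x y" R "add_monoid P"]
      linear_mapD(3)[OF f(2) that] by simp
qed

lemma linear_lift:
  assumes "module R P" "linear_map R P Q h" "module R Q" "bilinear_map R M N P f" "t \<in> carrier T"
  shows "h (tensor_lift R M N (add_monoid P) f t) =
    tensor_lift R M N (add_monoid Q) (\<lambda>x y. h (f x y)) t"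
proof (rule tensor_linear_eqI[OF _ _ _ assms(5)])
  show "linear_map R T Q (\<lambda>t. h (tensor_lift R M N (add_monoid P) f t))"
    by (intro linear_comp[OF assms(2)] lift_linear assms)
qed (use assms bilinear_comp[OF assms(2,4)] in \<open>simp_all add: lift_pure lift_linear\<close>)

end

section \<open>Sweedler sums of multilinear maps\<close>

context coalgebra begin

sublocale CC: module_pair R C C
  by (simp add: module_pair_def module_axioms)

abbreviation "T \<equiv> tensor R C C"
abbreviation "sw \<equiv> sweedler R C"
abbreviation pt (infixl "\<otimes>\<^sub>T" 75) where "a \<otimes>\<^sub>T b \<equiv> pure_tensor R C C a b"

lemma module_C: "module R C" by unfold_locales

lemma sw_linear:
  assumes "module R P" "bilinear_map R C C P f"
  shows "linear_map R C P (sw P f)"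
  unfolding sweedler_def[abs_def]
  using linear_comp[OF CC.lift_linear[OF assms] comult_linear] .

lemma sw_linear_comp:
  assumes "module R P" "linear_map R M C e" "bilinear_map R C C P f"
  shows "linear_map R M P (\<lambda>x. sw P f (e x))"
  using linear_comp[OF sw_linear[OF assms(1,3)] assms(2)] .

lemma sw_closed:
  assumes "module R P" "bilinear_map R C C P f" "x \<in> carrier C"
  shows "sw P f x \<in> carrier P"
  using linear_mapD(1)[OF sw_linear] assms .

lemma sw_cong:
  assumes "\<And>a b. \<lbrakk>a \<in> carrier C; b \<in> carrier C\<rbrakk> \<Longrightarrow> f a b = g a b"
  shows "sw P f x = sw P g x"
  unfolding sweedler_def using tensor_lift_cong[of C C f g R "add_monoid P"] assms by simp

lemma comult_closed: "x \<in> carrier C \<Longrightarrow> comult C x \<in> carrier T"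
  using linear_mapD(1)[OF comult_linear] .

lemma sw_linear_arg:
  assumes P: "module R P"
    and f: "\<And>q. q \<in> carrier Q \<Longrightarrow> bilinear_map R C C P (f q)"
      "\<And>x y. \<lbrakk>x \<in> carrier C; y \<in> carrier C\<rbrakk> \<Longrightarrow> linear_map R Q P (\<lambda>q. f q x y)"
    and Q: "module R Q" and x: "x \<in> carrier C"
  shows "linear_map R Q P (\<lambda>q. sw P (f q) x)"
  unfolding sweedler_def using assms comult_closed by (intro CC.lift_linear_arg)

lemma linear_sw:
  assumes "module R P" "module R Q" "linear_map R P Q h" "bilinear_map R C C P f" "x \<in> carrier C"
  shows "h (sw P f x) = sw Q (\<lambda>a b. h (f a b)) x"
  unfolding sweedler_def using assms comult_closed by (intro CC.linear_lift)

text \<open>Introduction rules that prove, by recursion on the term, that a nested Sweedler sum lies in the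
  carrier and is linear in each variable. They are extended below by rules for further operations.\<close>

lemmas sweedler_linear = module_C CC.module_tensor linear_id sw_linear_comp sw_linear_arg
  linear_bilinear_left[OF CC.pure_bilinear] linear_bilinear_right[OF CC.pure_bilinear]
  bilinear_mapI sw_closed CC.pure_tensor_closed comult_closed
  linear_comp[OF comult_linear]

text \<open>Sums over two unrelated coproducts can be interchanged. For fixed \<open>y\<close> both sides
  are linear in \<open>\<Delta>(x)\<close>; replacing \<open>\<Delta>(x)\<close> by a pure tensor
  turns the sum over \<open>x\<close> into a single term.\<close>

lemma sw_swap:
  assumes P: "module R P"
    and f: "\<And>a b c. \<lbrakk>a \<in> carrier C; b \<in> carrier C; c \<in> carrier C\<rbrakk> \<Longrightarrow> linear_map R C P (\<lambda>d. f a b c d)"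
      "\<And>a b d. \<lbrakk>a \<in> carrier C; b \<in> carrier C; d \<in> carrier C\<rbrakk> \<Longrightarrow> linear_map R C P (\<lambda>c. f a b c d)"
      "\<And>a c d. \<lbrakk>a \<in> carrier C; c \<in> carrier C; d \<in> carrier C\<rbrakk> \<Longrightarrow> linear_map R C P (\<lambda>b. f a b c d)"
      "\<And>b c d. \<lbrakk>b \<in> carrier C; c \<in> carrier C; d \<in> carrier C\<rbrakk> \<Longrightarrow> linear_map R C P (\<lambda>a. f a b c d)"
    and x: "x \<in> carrier C" and y: "y \<in> carrier C"
  shows "sw P (\<lambda>a b. sw P (\<lambda>c d. f a b c d) y) x = sw P (\<lambda>c d. sw P (\<lambda>a b. f a b c d) x) y"
proof -
  let ?L = "tensor_lift R C C (add_monoid P)"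
  have "?L (\<lambda>a b. sw P (\<lambda>c d. f a b c d) y) t = sw P (\<lambda>c d. ?L (\<lambda>a b. f a b c d) t) y"
    if "t \<in> carrier T" for t
    using that
  proof (rule CC.tensor_linear_eqI[rotated -1])
    have b: "bilinear_map R C C P (\<lambda>a b. sw P (\<lambda>c d. f a b c d) y)"
      by (rule sweedler_linear P f y | assumption)+
    then show "linear_map R T P (?L (\<lambda>a b. sw P (\<lambda>c d. f a b c d) y))"
      by (rule CC.lift_linear[OF P])
    show "linear_map R T P (\<lambda>t. sw P (\<lambda>c d. ?L (\<lambda>a b. f a b c d) t) y)"
      by (rule P sweedler_linear CC.lift_linear_arg CC.lift_linear f y | assumption)+
    show "?L (\<lambda>a b. sw P (\<lambda>c d. f a b c d) y) (a \<otimes>\<^sub>T b) =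
        sw P (\<lambda>c d. ?L (\<lambda>a b. f a b c d) (a \<otimes>\<^sub>T b)) y"
      if "a \<in> carrier C" "b \<in> carrier C" for a b
    proof -
      have "?L (\<lambda>a b. f a b c d) (a \<otimes>\<^sub>T b) = f a b c d" if cd: "c \<in> carrier C" "d \<in> carrier C" for c d
        by (rule CC.lift_pure[OF P _ \<open>a \<in> carrier C\<close> \<open>b \<in> carrier C\<close>])
          (rule bilinear_mapI f cd | assumption)+
      then have "sw P (\<lambda>c d. ?L (\<lambda>a b. f a b c d) (a \<otimes>\<^sub>T b)) y = sw P (\<lambda>c d. f a b c d) y"
        by (rule sw_cong)
      then show ?thesis
        using CC.lift_pure[OF P b that] by simp
    qed
  qed
  from this[OF comult_closed[OF x]] show ?thesis
    by (simp add: sweedler_def)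
qed

text \<open>A trilinear map induces a linear map on \<open>C \<otimes> (C \<otimes> C)\<close>. Applied to
  both sides of the coassociativity axiom, it gives the two ways of summing \<open>f x\<^sub>1
  x\<^sub>2 x\<^sub>3\<close>.\<close>

lemma sw_coassoc:
  assumes P: "module R P"
    and f: "\<And>a b. \<lbrakk>a \<in> carrier C; b \<in> carrier C\<rbrakk> \<Longrightarrow> linear_map R C P (\<lambda>c. f a b c)"
      "\<And>a c. \<lbrakk>a \<in> carrier C; c \<in> carrier C\<rbrakk> \<Longrightarrow> linear_map R C P (\<lambda>b. f a b c)"
      "\<And>b c. \<lbrakk>b \<in> carrier C; c \<in> carrier C\<rbrakk> \<Longrightarrow> linear_map R C P (\<lambda>a. f a b c)"
    and x: "x \<in> carrier C"
  shows "sw P (\<lambda>u c. sw P (\<lambda>a b. f a b c) u) x = sw P (\<lambda>a u. sw P (\<lambda>b c. f a b c) u) x"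
proof -
  interpret CT: module_pair R C T
    by (simp add: module_pair_def module_C CC.module_tensor)
  let ?T3 = "tensor R C T"
  let ?l = "\<lambda>a. tensor_lift R C C (add_monoid P) (f a)"
  let ?L = "tensor_lift R C T (add_monoid P) ?l"
  note linear_rules = sweedler_linear P CT.module_tensor linear_bilinear_left[OF CT.pure_bilinear]
    linear_bilinear_right[OF CT.pure_bilinear] CT.pure_tensor_closed f
  have l: "bilinear_map R C T P ?l"
    by (rule linear_rules CC.lift_linear CC.lift_linear_arg | assumption)+
  note L = CT.lift_linear[OF P l]
  have fa: "bilinear_map R C C P (f a)" if "a \<in> carrier C" for a
    by (rule linear_rules that | assumption)+
  have L_pure: "?L (pure_tensor R C T a (b \<otimes>\<^sub>T c)) = f a b c"
    if "a \<in> carrier C" "b \<in> carrier C" "c \<in> carrier C" for a b c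
    using CT.lift_pure[OF P l that(1) CC.pure_tensor_closed[OF that(2,3)]]
      CC.lift_pure[OF P fa[OF that(1)] that(2,3)] by simp
  have "?L (sw ?T3 (\<lambda>u v. sw ?T3 (\<lambda>a b. pure_tensor R C T a (b \<otimes>\<^sub>T v)) u) x) =
    sw P (\<lambda>u v. ?L (sw ?T3 (\<lambda>a b. pure_tensor R C T a (b \<otimes>\<^sub>T v)) u)) x"
    by (rule linear_sw[OF _ P L _ x] linear_rules | assumption)+
  also have "\<dots> = sw P (\<lambda>u v. sw P (\<lambda>a b. ?L (pure_tensor R C T a (b \<otimes>\<^sub>T v))) u) x"
    by (rule sw_cong linear_sw[OF _ P L] linear_rules | assumption)+
  also have "\<dots> = sw P (\<lambda>u v. sw P (\<lambda>a b. f a b v) u) x"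
    by (rule sw_cong L_pure | assumption)+
  finally have lhs: "?L (sw ?T3 (\<lambda>u v. sw ?T3 (\<lambda>a b. pure_tensor R C T a (b \<otimes>\<^sub>T v)) u) x) =
    sw P (\<lambda>u v. sw P (\<lambda>a b. f a b v) u) x" .
  have "?L (sw ?T3 (\<lambda>u v. pure_tensor R C T u (comult C v)) x) =
    sw P (\<lambda>u v. ?L (pure_tensor R C T u (comult C v))) x"
    by (rule linear_sw[OF _ P L _ x] linear_rules | assumption)+
  also have "\<dots> = sw P (\<lambda>u v. sw P (\<lambda>b c. f u b c) v) x"
    by (rule sw_cong) (simp add: CT.lift_pure[OF P l] comult_closed sweedler_def)
  finally show ?thesis
    using lhs coassoc[OF x] by simp
qed

lemma sw_cocomm:
  assumes "cocommutative R C" "module R P" "bilinear_map R C C P f" "x \<in> carrier C"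
  shows "sw P (\<lambda>a b. f b a) x = sw P f x"
proof -
  let ?L = "tensor_lift R C C (add_monoid P) f"
  have "sw P f x = ?L (sw T (\<lambda>a b. b \<otimes>\<^sub>T a) x)"
    using assms by (simp add: cocommutative_def sweedler_def)
  also have "\<dots> = sw P (\<lambda>a b. ?L (b \<otimes>\<^sub>T a)) x"
    by (rule linear_sw[OF _ assms(2) CC.lift_linear[OF assms(2,3)] _ assms(4)] sweedler_linear | assumption)+
  also have "\<dots> = sw P (\<lambda>a b. f b a) x"
    by (rule sw_cong) (simp add: CC.lift_pure assms)
  finally show ?thesis ..
qed

text \<open>Rebracketing the fourfold coproduct from \<open>(x\<^sub>1 x\<^sub>2)(x\<^sub>3
  x\<^sub>4)\<close> to \<open>x\<^sub>1((x\<^sub>2 x\<^sub>3) x\<^sub>4)\<close>, by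
  coassociativity once at \<open>x\<close> and once inside, isolates the two inner factors.\<close>

lemma sw_regroup:
  assumes P: "module R P"
    and f: "\<And>a b c. \<lbrakk>a \<in> carrier C; b \<in> carrier C; c \<in> carrier C\<rbrakk> \<Longrightarrow> linear_map R C P (\<lambda>d. f a b c d)"
      "\<And>a b d. \<lbrakk>a \<in> carrier C; b \<in> carrier C; d \<in> carrier C\<rbrakk> \<Longrightarrow> linear_map R C P (\<lambda>c. f a b c d)"
      "\<And>a c d. \<lbrakk>a \<in> carrier C; c \<in> carrier C; d \<in> carrier C\<rbrakk> \<Longrightarrow> linear_map R C P (\<lambda>b. f a b c d)"
      "\<And>b c d. \<lbrakk>b \<in> carrier C; c \<in> carrier C; d \<in> carrier C\<rbrakk> \<Longrightarrow> linear_map R C P (\<lambda>a. f a b c d)"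
    and x: "x \<in> carrier C"
  shows "sw P (\<lambda>u v. sw P (\<lambda>a b. sw P (\<lambda>c d. f a b c d) v) u) x =
    sw P (\<lambda>a w. sw P (\<lambda>m d. sw P (\<lambda>b c. f a b c d) m) w) x"
proof -
  have "sw P (\<lambda>u v. sw P (\<lambda>a b. sw P (\<lambda>c d. f a b c d) v) u) x =
      sw P (\<lambda>a w. sw P (\<lambda>b v. sw P (\<lambda>c d. f a b c d) v) w) x"
    by (rule sw_coassoc P sweedler_linear f x | assumption)+
  also have "\<dots> = sw P (\<lambda>a w. sw P (\<lambda>m d. sw P (\<lambda>b c. f a b c d) m) w) x"
    by (rule sw_cong sw_coassoc[symmetric] P f | assumption)+
  finally show ?thesis .
qed

text \<open>In the second bracketing of the fourfold coproduct the two inner factors are the coproduct of a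
  single element, where cocommutativity applies. So \<open>x\<^sub>2\<close> and
  \<open>x\<^sub>3\<close> may be exchanged.\<close>

lemma sw_middle_swap:
  assumes "cocommutative R C" and P: "module R P"
    and f: "\<And>a b c. \<lbrakk>a \<in> carrier C; b \<in> carrier C; c \<in> carrier C\<rbrakk> \<Longrightarrow> linear_map R C P (\<lambda>d. f a b c d)"
      "\<And>a b d. \<lbrakk>a \<in> carrier C; b \<in> carrier C; d \<in> carrier C\<rbrakk> \<Longrightarrow> linear_map R C P (\<lambda>c. f a b c d)"
      "\<And>a c d. \<lbrakk>a \<in> carrier C; c \<in> carrier C; d \<in> carrier C\<rbrakk> \<Longrightarrow> linear_map R C P (\<lambda>b. f a b c d)"
      "\<And>b c d. \<lbrakk>b \<in> carrier C; c \<in> carrier C; d \<in> carrier C\<rbrakk> \<Longrightarrow> linear_map R C P (\<lambda>a. f a b c d)"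
    and x: "x \<in> carrier C"
  shows "sw P (\<lambda>u v. sw P (\<lambda>a b. sw P (\<lambda>c d. f a b c d) v) u) x =
    sw P (\<lambda>u v. sw P (\<lambda>a b. sw P (\<lambda>c d. f a c b d) v) u) x"
proof -
  have "sw P (\<lambda>u v. sw P (\<lambda>a b. sw P (\<lambda>c d. f a b c d) v) u) x =
    sw P (\<lambda>a w. sw P (\<lambda>m d. sw P (\<lambda>b c. f a b c d) m) w) x"
    by (rule sw_regroup P f x | assumption)+
  also have "\<dots> = sw P (\<lambda>a w. sw P (\<lambda>m d. sw P (\<lambda>b c. f a c b d) m) w) x"
    by (rule sw_cong sw_cocomm[OF assms(1) P, symmetric] sweedler_linear f | assumption)+
  also have "\<dots> = sw P (\<lambda>u v. sw P (\<lambda>a b. sw P (\<lambda>c d. f a c b d) v) u) x"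
    by (rule sw_regroup[symmetric] P f x | assumption)+
  finally show ?thesis .
qed

lemma sw_counit_left:
  assumes "module R P" "linear_map R C P h" "x \<in> carrier C"
  shows "sw P (\<lambda>a b. counit C a \<odot>\<^bsub>P\<^esub> h b) x = h x"
proof -
  have c: "counit C a \<in> carrier R" if "a \<in> carrier C" for a
    using counit_linear that by (auto simp: linear_form_def)
  have b: "bilinear_map R C C C (\<lambda>a b. counit C a \<odot>\<^bsub>C\<^esub> b)"
    by (intro bilinear_mapI linear_mapI)
      (use counit_linear in \<open>auto simp: linear_form_def c smult_r_distr smult_l_distr
        smult_assoc1[symmetric] m_comm\<close>)
  have "h x = h (sw C (\<lambda>a b. counit C a \<odot>\<^bsub>C\<^esub> b) x)"
    by (simp add: counit_left assms)
  also have "\<dots> = sw P (\<lambda>a b. h (counit C a \<odot>\<^bsub>C\<^esub> b)) x"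
    by (rule linear_sw[OF module_C assms(1,2) b assms(3)])
  also have "\<dots> = sw P (\<lambda>a b. counit C a \<odot>\<^bsub>P\<^esub> h b) x"
    by (rule sw_cong) (simp add: linear_mapD[OF assms(2)] c)
  finally show ?thesis ..
qed

lemma sw_counit_right:
  assumes "module R P" "linear_map R C P h" "x \<in> carrier C"
  shows "sw P (\<lambda>a b. counit C b \<odot>\<^bsub>P\<^esub> h a) x = h x"
proof -
  have c: "counit C a \<in> carrier R" if "a \<in> carrier C" for a
    using counit_linear that by (auto simp: linear_form_def)
  have b: "bilinear_map R C C C (\<lambda>a b. counit C b \<odot>\<^bsub>C\<^esub> a)"
    by (intro bilinear_mapI linear_mapI)
      (use counit_linear in \<open>auto simp: linear_form_def c smult_r_distr smult_l_distr
        smult_assoc1[symmetric] m_comm\<close>)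
  have "h x = h (sw C (\<lambda>a b. counit C b \<odot>\<^bsub>C\<^esub> a) x)"
    by (simp add: counit_right assms)
  also have "\<dots> = sw P (\<lambda>a b. h (counit C b \<odot>\<^bsub>C\<^esub> a)) x"
    by (rule linear_sw[OF module_C assms(1,2) b assms(3)])
  also have "\<dots> = sw P (\<lambda>a b. counit C b \<odot>\<^bsub>P\<^esub> h a) x"
    by (rule sw_cong) (simp add: linear_mapD[OF assms(2)] c)
  finally show ?thesis ..
qed

end

section \<open>Coalgebra morphisms in Sweedler form\<close>

lemma tensor_rels_cong:
  assumes "carrier M' = carrier M" "ring.add M' = ring.add M" "smult M' = smult M"
    and "carrier N' = carrier N" "ring.add N' = ring.add N" "smult N' = smult N"
  shows "tensor_rels R M' N' = tensor_rels R M N"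
  unfolding tensor_rels_def assms ..

text \<open>Tensor products read only the carrier, the addition and the scalar multiplication of the
  factors. Records of different types, such as a coalgebra and its underlying module, can
  therefore be exchanged.\<close>

lemma tensor_cong:
  assumes "carrier M' = carrier M" "ring.add M' = ring.add M" "smult M' = smult M"
    and "carrier N' = carrier N" "ring.add N' = ring.add N" "smult N' = smult N"
  shows "tensor_lift R M' N' = tensor_lift R M N"
    and "pure_tensor R M' N' = pure_tensor R M N"
    and "tensor R M' N' = tensor R M N"
proof -
  note [simp] = tensor_rels_cong[OF assms] assms
  show pure: "pure_tensor R M' N' = pure_tensor R M N"
    by (intro ext) (simp add: pure_tensor_def tensor_kernel_def)
  show lift: "tensor_lift R M' N' = tensor_lift R M N"
    by (intro ext) (simp add: tensor_lift_def tensor_group_def tensor_kernel_def pure)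
  show "tensor R M' N' = tensor R M N"
    by (simp add: tensor_def lift pure tensor_group_def tensor_kernel_def)
qed

lemma linear_map_cong:
  assumes "carrier M' = carrier M" "ring.add M' = ring.add M" "smult M' = smult M"
    and "carrier N' = carrier N" "ring.add N' = ring.add N" "smult N' = smult N"
  shows "linear_map R M' N' f = linear_map R M N f"
  unfolding linear_map_def assms ..

lemma tensor_coalgebra_simps:
  "carrier (tensor_coalgebra R C D) = carrier (tensor R C D)"
  "ring.add (tensor_coalgebra R C D) = ring.add (tensor R C D)"
  "smult (tensor_coalgebra R C D) = smult (tensor R C D)"
  by (simp_all add: tensor_coalgebra_def Let_def module.extend_def)

text \<open>The base ring as a module over itself. With it, linear forms such as counits are linear maps.\<close>

definition scalars :: "('k, 'm) ring_scheme \<Rightarrow> ('k, 'k) module" where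
  "scalars R = \<lparr>carrier = carrier R, monoid.mult = monoid.mult R, one = \<one>\<^bsub>R\<^esub>,
     ring.zero = \<zero>\<^bsub>R\<^esub>, ring.add = ring.add R, module.smult = monoid.mult R\<rparr>"

lemma scalars_simps [simp]:
  "carrier (scalars R) = carrier R" "ring.add (scalars R) = ring.add R"
  "smult (scalars R) = monoid.mult R" "ring.zero (scalars R) = ring.zero R"
  by (simp_all add: scalars_def)

lemma module_scalars:
  assumes "cring R"
  shows "module R (scalars R)"
proof -
  interpret cring R by fact
  show ?thesis
  proof (rule moduleI)
    show "abelian_group (scalars R)"
    proof (rule abelian_groupI)
      show "\<exists>y \<in> carrier (scalars R). y \<oplus>\<^bsub>scalars R\<^esub> x = \<zero>\<^bsub>scalars R\<^esub>"
        if "x \<in> carrier (scalars R)" for x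
        using that by (intro bexI[of _ "\<ominus>\<^bsub>R\<^esub> x"]) (simp_all add: l_neg)
    qed (simp_all add: a_ac)
  qed (simp_all add: assms l_distr r_distr m_assoc)
qed

lemma linear_form_scalars: "linear_form R M f \<longleftrightarrow> linear_map R M (scalars R) f"
  by (simp add: linear_form_def linear_map_def)

lemma tensor_lift_scalars:
  "tensor_lift R M N (add_monoid R) f = tensor_lift R M N (add_monoid (scalars R)) f"
  by (simp add: tensor_lift_def hom_def)

context coalgebra begin

lemma linear_counit: "linear_map R C (scalars R) (counit C)"
  using counit_linear by (simp add: linear_form_scalars)

lemma counit_closed: "x \<in> carrier C \<Longrightarrow> counit C x \<in> carrier R"
  using linear_mapD(1)[OF linear_counit] by simp

lemma bilinear_counit: "bilinear_map R C C (scalars R) (\<lambda>x y. counit C x \<otimes>\<^bsub>R\<^esub> counit C y)"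
  by (intro bilinear_mapI linear_mapI)
    (use linear_mapD[OF linear_counit] in \<open>simp_all add: l_distr r_distr m_ac\<close>)

abbreviation "TC \<equiv> tensor_coalgebra R C C"

lemma comult_tensor_coalgebra:
  "\<lbrakk>x \<in> carrier C; y \<in> carrier C\<rbrakk> \<Longrightarrow> comult TC (x \<otimes>\<^sub>T y) = sw (tensor R T T) (\<lambda>x1 x2. sw (tensor R T T)
    (\<lambda>y1 y2. pure_tensor R T T (x1 \<otimes>\<^sub>T y1) (x2 \<otimes>\<^sub>T y2)) y) x"
  and comult_tensor_coalgebra_linear: "linear_map R T (tensor R T T) (comult TC)"
proof -
  interpret TT: module_pair R T T
    by (simp add: module_pair_def CC.module_tensor)
  note linear_rules = sweedler_linear TT.module_tensor linear_bilinear_left[OF TT.pure_bilinear]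
    linear_bilinear_right[OF TT.pure_bilinear] TT.pure_tensor_closed
  have b: "bilinear_map R C C (tensor R T T) (\<lambda>x y. sw (tensor R T T) (\<lambda>x1 x2. sw (tensor R T T)
      (\<lambda>y1 y2. pure_tensor R T T (x1 \<otimes>\<^sub>T y1) (x2 \<otimes>\<^sub>T y2)) y) x)"
    by (rule linear_rules | assumption)+
  have eq: "comult TC = tensor_lift R C C (add_monoid (tensor R T T)) (\<lambda>x y. sw (tensor R T T)
      (\<lambda>x1 x2. sw (tensor R T T) (\<lambda>y1 y2. pure_tensor R T T (x1 \<otimes>\<^sub>T y1) (x2 \<otimes>\<^sub>T y2)) y) x)"
    by (simp add: tensor_coalgebra_def Let_def module.extend_def coalgebra.fields_def)
  show "\<lbrakk>x \<in> carrier C; y \<in> carrier C\<rbrakk> \<Longrightarrow> comult TC (x \<otimes>\<^sub>T y) = sw (tensor R T T) (\<lambda>x1 x2. sw (tensor R T T)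
    (\<lambda>y1 y2. pure_tensor R T T (x1 \<otimes>\<^sub>T y1) (x2 \<otimes>\<^sub>T y2)) y) x"
    unfolding eq by (rule CC.lift_pure[OF TT.module_tensor b])
  show "linear_map R T (tensor R T T) (comult TC)"
    unfolding eq by (rule CC.lift_linear[OF TT.module_tensor b])
qed

lemma counit_tensor_coalgebra:
  shows "\<lbrakk>x \<in> carrier C; y \<in> carrier C\<rbrakk> \<Longrightarrow> counit TC (x \<otimes>\<^sub>T y) = counit C x \<otimes>\<^bsub>R\<^esub> counit C y"
    and "linear_map R T (scalars R) (counit TC)"
proof -
  have eq: "counit TC =
      tensor_lift R C C (add_monoid (scalars R)) (\<lambda>x y. counit C x \<otimes>\<^bsub>R\<^esub> counit C y)"
    by (simp add: tensor_coalgebra_def Let_def module.extend_def coalgebra.fields_def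
        tensor_lift_scalars)
  have S: "module R (scalars R)" by (rule module_scalars) (rule is_cring)
  show "\<lbrakk>x \<in> carrier C; y \<in> carrier C\<rbrakk> \<Longrightarrow> counit TC (x \<otimes>\<^sub>T y) = counit C x \<otimes>\<^bsub>R\<^esub> counit C y"
    unfolding eq by (rule CC.lift_pure[OF S bilinear_counit])
  show "linear_map R T (scalars R) (counit TC)"
    unfolding eq by (rule CC.lift_linear[OF S bilinear_counit])
qed

text \<open>To be a coalgebra morphism on \<open>C \<otimes> C\<close> is an equality of linear maps there,
  so it can be tested on pure tensors, where it says \<open>\<Delta>(f(x, y)) = f(x\<^sub>1,
  y\<^sub>1) \<otimes> f(x\<^sub>2, y\<^sub>2)\<close> and \<open>\<epsilon>(f(x, y)) =
  \<epsilon>(x) \<epsilon>(y)\<close>.\<close>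

lemma coalgebra_operation_iff:
  "coalgebra_operation R C f \<longleftrightarrow> bilinear_map R C C C f \<and>
    (\<forall>x \<in> carrier C. \<forall>y \<in> carrier C. comult C (f x y) =
      sw T (\<lambda>x1 x2. sw T (\<lambda>y1 y2. f x1 y1 \<otimes>\<^sub>T f x2 y2) y) x) \<and>
    (\<forall>x \<in> carrier C. \<forall>y \<in> carrier C. counit C (f x y) = counit C x \<otimes>\<^bsub>R\<^esub> counit C y)"
proof (cases "bilinear_map R C C C f")
  case True
  interpret TT: module_pair R T T
    by (simp add: module_pair_def CC.module_tensor)
  let ?L = "tensor_lift R C C (add_monoid C) f"
  note linear_rules = sweedler_linear TT.module_tensor linear_bilinear_left[OF TT.pure_bilinear]
    linear_bilinear_right[OF TT.pure_bilinear] TT.pure_tensor_closed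
  note L = CC.lift_linear[OF module_C True]
  have L_pure: "?L (x \<otimes>\<^sub>T y) = f x y" if "x \<in> carrier C" "y \<in> carrier C" for x y
    by (rule CC.lift_pure[OF module_C True that])
  let ?G = "tensor_lift R T T (add_monoid T) (\<lambda>s t. ?L s \<otimes>\<^sub>T ?L t)"
  have bG: "bilinear_map R T T T (\<lambda>s t. ?L s \<otimes>\<^sub>T ?L t)"
    by (rule sweedler_linear L linear_mapD(1)[OF L] | assumption)+
  note G = TT.lift_linear[OF CC.module_tensor bG]
  have G_pure: "?G (pure_tensor R T T (x1 \<otimes>\<^sub>T y1) (x2 \<otimes>\<^sub>T y2)) = f x1 y1 \<otimes>\<^sub>T f x2 y2"
    if "x1 \<in> carrier C" "x2 \<in> carrier C" "y1 \<in> carrier C" "y2 \<in> carrier C" for x1 x2 y1 y2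
    using TT.lift_pure[OF CC.module_tensor bG] that by (simp add: CC.pure_tensor_closed L_pure)
  have sw_TC: "sweedler R TC T (\<lambda>s t. ?L s \<otimes>\<^sub>T ?L t) t = ?G (comult TC t)" for t
    unfolding sweedler_def by (simp add: tensor_cong(1)[of TC T TC T] tensor_coalgebra_simps)
  have sw_TC_pure: "?G (comult TC (x \<otimes>\<^sub>T y)) = sw T (\<lambda>x1 x2. sw T (\<lambda>y1 y2. f x1 y1 \<otimes>\<^sub>T f x2 y2) y) x"
    if "x \<in> carrier C" "y \<in> carrier C" for x y
  proof -
    have "?G (comult TC (x \<otimes>\<^sub>T y)) = sw T (\<lambda>x1 x2. ?G (sw (tensor R T T)
        (\<lambda>y1 y2. pure_tensor R T T (x1 \<otimes>\<^sub>T y1) (x2 \<otimes>\<^sub>T y2)) y)) x"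
      unfolding comult_tensor_coalgebra[OF that]
      by (rule linear_sw[OF _ _ G] linear_rules that | assumption)+
    also have "\<dots> = sw T (\<lambda>x1 x2. sw T (\<lambda>y1 y2. ?G (pure_tensor R T T (x1 \<otimes>\<^sub>T y1) (x2 \<otimes>\<^sub>T y2))) y) x"
      by (rule sw_cong linear_sw[OF _ _ G] linear_rules that | assumption)+
    also have "\<dots> = sw T (\<lambda>x1 x2. sw T (\<lambda>y1 y2. f x1 y1 \<otimes>\<^sub>T f x2 y2) y) x"
      by (rule sw_cong G_pure | assumption)+
    finally show ?thesis .
  qed
  have "(\<forall>t \<in> carrier T. comult C (?L t) = ?G (comult TC t)) \<longleftrightarrow>
    (\<forall>x \<in> carrier C. \<forall>y \<in> carrier C. comult C (f x y) =
      sw T (\<lambda>x1 x2. sw T (\<lambda>y1 y2. f x1 y1 \<otimes>\<^sub>T f x2 y2) y) x)" (is "?l \<longleftrightarrow> ?r")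
  proof
    assume l: ?l
    show ?r
    proof (intro ballI)
      fix x y assume "x \<in> carrier C" "y \<in> carrier C"
      then show "comult C (f x y) = sw T (\<lambda>x1 x2. sw T (\<lambda>y1 y2. f x1 y1 \<otimes>\<^sub>T f x2 y2) y) x"
        using bspec[OF l CC.pure_tensor_closed] by (simp add: L_pure sw_TC_pure)
    qed
  next
    assume r: ?r
    show ?l
    proof
      fix t assume t: "t \<in> carrier T"
      show "comult C (?L t) = ?G (comult TC t)"
        by (rule CC.tensor_linear_eqI[OF linear_comp[OF comult_linear L]
              linear_comp[OF G comult_tensor_coalgebra_linear] _ t])
          (use r in \<open>simp_all add: L_pure sw_TC_pure\<close>)
    qed
  qed
  moreover have "(\<forall>t \<in> carrier T. counit C (?L t) = counit TC t) \<longleftrightarrow>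
    (\<forall>x \<in> carrier C. \<forall>y \<in> carrier C. counit C (f x y) = counit C x \<otimes>\<^bsub>R\<^esub> counit C y)" (is "?l \<longleftrightarrow> ?r")
  proof
    assume l: ?l
    show ?r
    proof (intro ballI)
      fix x y assume "x \<in> carrier C" "y \<in> carrier C"
      then show "counit C (f x y) = counit C x \<otimes>\<^bsub>R\<^esub> counit C y"
        using bspec[OF l CC.pure_tensor_closed] by (simp add: L_pure counit_tensor_coalgebra(1))
    qed
  next
    assume r: ?r
    show ?l
    proof
      fix t assume t: "t \<in> carrier T"
      show "counit C (?L t) = counit TC t"
        by (rule CC.tensor_linear_eqI[OF linear_comp[OF linear_counit L]
              counit_tensor_coalgebra(2) _ t])
          (use r in \<open>simp_all add: L_pure counit_tensor_coalgebra(1)\<close>)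
    qed
  qed
  moreover have "linear_map R TC C ?L"
    using L linear_map_cong[of TC T C C R ?L] by (simp add: tensor_coalgebra_simps)
  ultimately show ?thesis
    using True by (simp add: coalgebra_operation_def coalgebra_hom_def sw_TC tensor_coalgebra_simps)
qed (simp add: coalgebra_operation_def)

lemma operationD:
  assumes "coalgebra_operation R C f"
  shows "bilinear_map R C C C f"
    and "\<lbrakk>x \<in> carrier C; y \<in> carrier C\<rbrakk> \<Longrightarrow> comult C (f x y) =
      sw T (\<lambda>x1 x2. sw T (\<lambda>y1 y2. f x1 y1 \<otimes>\<^sub>T f x2 y2) y) x"
    and "\<lbrakk>x \<in> carrier C; y \<in> carrier C\<rbrakk> \<Longrightarrow> counit C (f x y) = counit C x \<otimes>\<^bsub>R\<^esub> counit C y"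
    and "\<lbrakk>x \<in> carrier C; y \<in> carrier C\<rbrakk> \<Longrightarrow> f x y \<in> carrier C"
  using assms bilinear_mapD(3) by (auto simp: coalgebra_operation_iff)

lemma sw_operation:
  assumes f: "coalgebra_operation R C f" and P: "module R P" and g: "bilinear_map R C C P g"
    and x: "x \<in> carrier C" and y: "y \<in> carrier C"
  shows "sw P g (f x y) = sw P (\<lambda>x1 x2. sw P (\<lambda>y1 y2. g (f x1 y1) (f x2 y2)) y) x"
proof -
  let ?L = "tensor_lift R C C (add_monoid P) g"
  note L = CC.lift_linear[OF P g]
  note linear_rules = sweedler_linear linear_bilinear_left[OF operationD(1)[OF f]]
    linear_bilinear_right[OF operationD(1)[OF f]] operationD(4)[OF f]
  have "sw P g (f x y) = ?L (sw T (\<lambda>x1 x2. sw T (\<lambda>y1 y2. f x1 y1 \<otimes>\<^sub>T f x2 y2) y) x)"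
    using operationD(2)[OF f x y] by (simp add: sweedler_def)
  also have "\<dots> = sw P (\<lambda>x1 x2. ?L (sw T (\<lambda>y1 y2. f x1 y1 \<otimes>\<^sub>T f x2 y2) y)) x"
    by (rule linear_sw[OF _ P L] linear_rules x y | assumption)+
  also have "\<dots> = sw P (\<lambda>x1 x2. sw P (\<lambda>y1 y2. ?L (f x1 y1 \<otimes>\<^sub>T f x2 y2)) y) x"
    by (rule sw_cong linear_sw[OF _ P L] linear_rules x y | assumption)+
  also have "\<dots> = sw P (\<lambda>x1 x2. sw P (\<lambda>y1 y2. g (f x1 y1) (f x2 y2)) y) x"
    by (rule sw_cong CC.lift_pure[OF P g] operationD(4)[OF f] | assumption)+
  finally show ?thesis .
qed

lemma sw_coalgebra_hom:
  assumes D: "coalgebra R D" and f: "coalgebra_hom R C D f"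
    and P: "module R P" and g: "bilinear_map R D D P g" and x: "x \<in> carrier C"
  shows "sweedler R D P g (f x) = sw P (\<lambda>a b. g (f a) (f b)) x"
proof -
  interpret D: coalgebra R D by fact
  let ?L = "tensor_lift R D D (add_monoid P) g"
  note L = D.CC.lift_linear[OF P g]
  have fl: "linear_map R C D f" using f by (simp add: coalgebra_hom_def)
  note linear_rules = D.sweedler_linear sweedler_linear fl linear_mapD(1)[OF fl] linear_bilinear_left[OF D.CC.pure_bilinear]
    linear_bilinear_right[OF D.CC.pure_bilinear]
  have "sweedler R D P g (f x) = ?L (sw D.T (\<lambda>a b. pure_tensor R D D (f a) (f b)) x)"
    using f x by (simp add: sweedler_def coalgebra_hom_def)
  also have "\<dots> = sw P (\<lambda>a b. ?L (pure_tensor R D D (f a) (f b))) x"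
    by (rule linear_sw[OF _ P L] linear_rules x | assumption)+
  also have "\<dots> = sw P (\<lambda>a b. g (f a) (f b)) x"
    by (rule sw_cong D.CC.lift_pure[OF P g] linear_mapD(1)[OF fl] | assumption)+
  finally show ?thesis .
qed

lemma coalgebra_homD:
  assumes "coalgebra_hom R C D f"
  shows "linear_map R C D f"
    and "x \<in> carrier C \<Longrightarrow> f x \<in> carrier D"
    and "x \<in> carrier C \<Longrightarrow> counit D (f x) = counit C x"
    and "x \<in> carrier C \<Longrightarrow>
      comult D (f x) = sw (tensor R D D) (\<lambda>a b. pure_tensor R D D (f a) (f b)) x"
  using assms by (auto simp: coalgebra_hom_def linear_map_def)

lemma coalgebra_hom_comp:
  assumes D: "coalgebra R D" and E: "coalgebra R E"
    and f: "coalgebra_hom R C D f" and g: "coalgebra_hom R D E g"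
  shows "coalgebra_hom R C E (\<lambda>x. g (f x))"
  unfolding coalgebra_hom_def
proof (intro conjI ballI)
  interpret D: coalgebra R D by fact
  interpret E: coalgebra R E by fact
  note fD = coalgebra_homD[OF f]
  note gD = D.coalgebra_homD[OF g]
  show "linear_map R C E (\<lambda>x. g (f x))"
    by (rule linear_comp[OF gD(1) fD(1)])
  fix x assume x: "x \<in> carrier C"
  show "counit E (g (f x)) = counit C x"
    using fD gD x by simp
  have b: "bilinear_map R D D E.T (\<lambda>a b. pure_tensor R E E (g a) (g b))"
    by (rule bilinear_mapI gD linear_bilinear_left[OF E.CC.pure_bilinear]
        linear_bilinear_right[OF E.CC.pure_bilinear] | assumption)+
  show "comult E (g (f x)) = sw E.T (\<lambda>a b. pure_tensor R E E (g (f a)) (g (f b))) x"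
    using gD(4)[OF fD(2)[OF x]] sw_coalgebra_hom[OF D f E.CC.module_tensor b x] by simp
qed

text \<open>The coproduct of \<open>g(x\<^sub>1) f(x\<^sub>2, y)\<close> is \<open>g(x\<^sub>1) f(x\<^sub>3,
  y\<^sub>1) \<otimes> g(x\<^sub>2) f(x\<^sub>4, y\<^sub>2)\<close>. Exchanging
  \<open>x\<^sub>2\<close> and \<open>x\<^sub>3\<close> by cocommutativity brings this into the
  form required of a coalgebra morphism. With \<open>g = \<Phi>\<close> this makes
  \<open>\<circ>\<close> a coalgebra morphism when \<open>\<rhd>\<close> is one, and with \<open>g
  = S \<circ> \<Phi>\<close> it gives the converse.\<close>

lemma convolution_operation:
  assumes cocomm: "cocommutative R C" and m: "coalgebra_operation R C m"
    and g: "coalgebra_hom R C C g" and f: "coalgebra_operation R C f"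
  shows "coalgebra_operation R C (\<lambda>x y. sw C (\<lambda>a b. m (g a) (f b y)) x)" (is "coalgebra_operation R C ?F")
proof -
  note mD = operationD[OF m] and gD = coalgebra_homD[OF g] and fD = operationD[OF f]
  have coalg: "coalgebra R C" by unfold_locales
  note linear_rules = sweedler_linear linear_bilinear_left[OF mD(1)] linear_bilinear_right[OF mD(1)]
    linear_bilinear_left[OF fD(1)] linear_bilinear_right[OF fD(1)] linear_comp[OF gD(1)]
    mD(4) fD(4) gD(2) linear_comp[OF linear_counit]
  have bil: "bilinear_map R C C C ?F"
    by (rule linear_rules | assumption)+
  have "comult C (?F x y) = sw T (\<lambda>u v. sw T (\<lambda>y1 y2. ?F u y1 \<otimes>\<^sub>T ?F v y2) y) x"
    if x: "x \<in> carrier C" and y: "y \<in> carrier C" for x y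
  proof -
    have "comult C (?F x y) = sw T (\<lambda>u v. comult C (m (g u) (f v y))) x"
      by (rule linear_sw[OF _ _ comult_linear] linear_rules x y | assumption)+
    also have "\<dots> = sw T (\<lambda>u v. sw T (\<lambda>p1 p2. sw T (\<lambda>q1 q2. m p1 q1 \<otimes>\<^sub>T m p2 q2) (f v y)) (g u)) x"
      by (rule sw_cong mD(2) linear_rules x y | assumption)+
    also have "\<dots> = sw T (\<lambda>u v. sw T (\<lambda>a b. sw T (\<lambda>q1 q2. m (g a) q1 \<otimes>\<^sub>T m (g b) q2) (f v y)) u) x"
      by (rule sw_cong sw_coalgebra_hom[OF coalg g] linear_rules x y | assumption)+
    also have "\<dots> = sw T (\<lambda>u v. sw T (\<lambda>a b. sw T (\<lambda>c d. sw T (\<lambda>y1 y2.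
        m (g a) (f c y1) \<otimes>\<^sub>T m (g b) (f d y2)) y) v) u) x"
      by (rule sw_cong sw_operation[OF f] linear_rules x y | assumption)+
    \<comment> \<open>The only use of cocommutativity; what follows regroups the sums.\<close>
    also have "\<dots> = sw T (\<lambda>u v. sw T (\<lambda>a b. sw T (\<lambda>c d. sw T (\<lambda>y1 y2.
        m (g a) (f b y1) \<otimes>\<^sub>T m (g c) (f d y2)) y) v) u) x"
      by (rule sw_middle_swap[OF cocomm] linear_rules x y | assumption)+
    also have "\<dots> = sw T (\<lambda>u v. sw T (\<lambda>a b. sw T (\<lambda>y1 y2. sw T (\<lambda>c d.
        m (g a) (f b y1) \<otimes>\<^sub>T m (g c) (f d y2)) v) y) u) x"
      by (rule sw_cong sw_swap linear_rules x y | assumption)+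
    also have "\<dots> = sw T (\<lambda>u v. sw T (\<lambda>y1 y2. sw T (\<lambda>a b. sw T (\<lambda>c d.
        m (g a) (f b y1) \<otimes>\<^sub>T m (g c) (f d y2)) v) u) y) x"
      by (rule sw_cong sw_swap linear_rules x y | assumption)+
    also have "\<dots> = sw T (\<lambda>u v. sw T (\<lambda>y1 y2. sw T (\<lambda>a b.
        m (g a) (f b y1) \<otimes>\<^sub>T ?F v y2) u) y) x"
      by (rule sw_cong linear_sw[symmetric] linear_rules x y | assumption)+
    also have "\<dots> = sw T (\<lambda>u v. sw T (\<lambda>y1 y2. ?F u y1 \<otimes>\<^sub>T ?F v y2) y) x"
      by (rule sw_cong linear_sw[symmetric, where h = "\<lambda>s. s \<otimes>\<^sub>T _"] linear_rules x y | assumption)+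
    finally show ?thesis .
  qed
  moreover have "counit C (?F x y) = counit C x \<otimes>\<^bsub>R\<^esub> counit C y"
    if x: "x \<in> carrier C" and y: "y \<in> carrier C" for x y
  proof -
    have S: "module R (scalars R)" by (rule module_scalars) (rule is_cring)
    have "counit C (?F x y) = sw (scalars R) (\<lambda>a b. counit C (m (g a) (f b y))) x"
      by (rule linear_sw[OF _ _ linear_counit] S linear_rules x y | assumption)+
    also have "\<dots> = sw (scalars R) (\<lambda>a b. counit C a \<odot>\<^bsub>scalars R\<^esub> (counit C b \<otimes>\<^bsub>R\<^esub> counit C y)) x"
      by (rule sw_cong) (simp add: mD fD gD y)
    also have "\<dots> = counit C x \<otimes>\<^bsub>R\<^esub> counit C y"
      by (rule sw_counit_left S x bilinear_mapD(2)[OF bilinear_counit] y)+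
    finally show ?thesis .
  qed
  ultimately show ?thesis
    using bil by (simp add: coalgebra_operation_iff)
qed

end

section \<open>Convolution algebras\<close>

text \<open>The structure that convolution needs of its target. The product is a parameter and not the
  record field \<open>mult\<close>, so that the locale covers \<open>H \<otimes> H\<close>, for
  which that field is undefined.\<close>

locale unital_algebra = module R A for R (structure) and A (structure) +
  fixes m :: "'c \<Rightarrow> 'c \<Rightarrow> 'c" and e :: 'c
  assumes m_bilinear: "bilinear_map R A A A m"
    and m_assoc: "\<lbrakk>x \<in> carrier A; y \<in> carrier A; z \<in> carrier A\<rbrakk> \<Longrightarrow> m (m x y) z = m x (m y z)"
    and e_closed: "e \<in> carrier A"
    and e_left: "x \<in> carrier A \<Longrightarrow> m e x = x"
    and e_right: "x \<in> carrier A \<Longrightarrow> m x e = x"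
begin

lemma module_A: "module R A" by unfold_locales

lemmas m_closed = bilinear_mapD(3)[OF m_bilinear]

lemmas algebra_linear = module_A linear_bilinear_left[OF m_bilinear] linear_bilinear_right[OF m_bilinear] m_closed

lemma smult_e_left:
  assumes "r \<in> carrier R" "x \<in> carrier A"
  shows "m (r \<odot>\<^bsub>A\<^esub> e) x = r \<odot>\<^bsub>A\<^esub> x"
  using linear_mapD(3)[OF bilinear_mapD(2)[OF m_bilinear]] assms by (simp add: e_closed e_left)

lemma smult_e_right:
  assumes "r \<in> carrier R" "x \<in> carrier A"
  shows "m x (r \<odot>\<^bsub>A\<^esub> e) = r \<odot>\<^bsub>A\<^esub> x"
  using linear_mapD(3)[OF bilinear_mapD(1)[OF m_bilinear]] assms by (simp add: e_closed e_right)

end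

context coalgebra begin

lemma convolution_assoc:
  assumes A: "unital_algebra R A m e"
    and f: "linear_map R C A f" and g: "linear_map R C A g" and h: "linear_map R C A h"
    and x: "x \<in> carrier C"
  shows "sw A (\<lambda>u c. m (sw A (\<lambda>a b. m (f a) (g b)) u) (h c)) x =
    sw A (\<lambda>a u. m (f a) (sw A (\<lambda>b c. m (g b) (h c)) u)) x"
proof -
  interpret A: unital_algebra R A m e by fact
  note linear_rules = sweedler_linear A.algebra_linear linear_comp[OF f] linear_comp[OF g] linear_comp[OF h]
    linear_mapD(1)[OF f] linear_mapD(1)[OF g] linear_mapD(1)[OF h]
  have "sw A (\<lambda>u c. m (sw A (\<lambda>a b. m (f a) (g b)) u) (h c)) x =
    sw A (\<lambda>u c. sw A (\<lambda>a b. m (m (f a) (g b)) (h c)) u) x"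
    by (rule sw_cong linear_sw[where h = "\<lambda>s. m s _"] linear_rules x | assumption)+
  also have "\<dots> = sw A (\<lambda>u c. sw A (\<lambda>a b. m (f a) (m (g b) (h c))) u) x"
    by (rule sw_cong A.m_assoc linear_rules x | assumption)+
  also have "\<dots> = sw A (\<lambda>a u. sw A (\<lambda>b c. m (f a) (m (g b) (h c))) u) x"
    by (rule sw_coassoc linear_rules x | assumption)+
  also have "\<dots> = sw A (\<lambda>a u. m (f a) (sw A (\<lambda>b c. m (g b) (h c)) u)) x"
    by (rule sw_cong linear_sw[symmetric] linear_rules x | assumption)+
  finally show ?thesis .
qed

text \<open>Associativity brings \<open>f\<close> next to \<open>g\<close>, and their convolution is the
  unit.\<close>

lemma convolution_cancel_left:
  assumes A: "unital_algebra R A m e"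
    and f: "linear_map R C A f" and g: "linear_map R C A g" and h: "linear_map R C A h"
    and inv: "\<And>x. x \<in> carrier C \<Longrightarrow> sw A (\<lambda>a b. m (f a) (g b)) x = counit C x \<odot>\<^bsub>A\<^esub> e"
    and x: "x \<in> carrier C"
  shows "sw A (\<lambda>a u. m (f a) (sw A (\<lambda>b c. m (g b) (h c)) u)) x = h x"
proof -
  interpret A: unital_algebra R A m e by fact
  have "sw A (\<lambda>a u. m (f a) (sw A (\<lambda>b c. m (g b) (h c)) u)) x =
    sw A (\<lambda>u c. m (sw A (\<lambda>a b. m (f a) (g b)) u) (h c)) x"
    using convolution_assoc[OF A f g h x] ..
  also have "\<dots> = sw A (\<lambda>u c. counit C u \<odot>\<^bsub>A\<^esub> h c) x"
    by (rule sw_cong) (simp add: inv A.smult_e_left counit_closed linear_mapD(1)[OF h])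
  also have "\<dots> = h x"
    by (rule sw_counit_left[OF A.module_A h x])
  finally show ?thesis .
qed

lemma convolution_inverse_unique:
  assumes A: "unital_algebra R A m e"
    and f: "linear_map R C A f" and g: "linear_map R C A g" and h: "linear_map R C A h"
    and left: "\<And>x. x \<in> carrier C \<Longrightarrow> sw A (\<lambda>a b. m (f a) (g b)) x = counit C x \<odot>\<^bsub>A\<^esub> e"
    and right: "\<And>x. x \<in> carrier C \<Longrightarrow> sw A (\<lambda>a b. m (g a) (h b)) x = counit C x \<odot>\<^bsub>A\<^esub> e"
    and x: "x \<in> carrier C"
  shows "f x = h x"
proof -
  interpret A: unital_algebra R A m e by fact
  have "h x = sw A (\<lambda>a u. m (f a) (sw A (\<lambda>b c. m (g b) (h c)) u)) x"
    using convolution_cancel_left[OF A f g h left x] ..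
  also have "\<dots> = sw A (\<lambda>a u. counit C u \<odot>\<^bsub>A\<^esub> f a) x"
    by (rule sw_cong) (simp add: right A.smult_e_right counit_closed linear_mapD(1)[OF f])
  also have "\<dots> = f x"
    by (rule sw_counit_right[OF A.module_A f x])
  finally show ?thesis ..
qed

end

section \<open>The tensor square of an algebra\<close>

context unital_algebra begin

sublocale AA: module_pair R A A
  by (simp add: module_pair_def module_axioms)

abbreviation "TA \<equiv> tensor R A A"

text \<open>The product with \<open>(a \<otimes> b)(c \<otimes> d) = ac \<otimes> bd\<close>.\<close>

definition tmult where
  "tmult s t = tensor_lift R A A (add_monoid TA) (\<lambda>a b.
     tensor_lift R A A (add_monoid TA) (\<lambda>c d. pure_tensor R A A (m a c) (m b d)) t) s"

lemmas tensor_square_linear = algebra_linear AA.module_tensor linear_id bilinear_mapI AA.lift_linear AA.lift_linear_arg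
  linear_bilinear_left[OF AA.pure_bilinear] linear_bilinear_right[OF AA.pure_bilinear]
  AA.pure_tensor_closed

lemma tmult_bilinear: "bilinear_map R TA TA TA tmult"
  unfolding tmult_def[abs_def] by (rule tensor_square_linear | assumption)+

lemma tmult_pure:
  assumes "a \<in> carrier A" "b \<in> carrier A" "c \<in> carrier A" "d \<in> carrier A"
  shows "tmult (pure_tensor R A A a b) (pure_tensor R A A c d) = pure_tensor R A A (m a c) (m b d)"
proof -
  have "tmult (pure_tensor R A A a b) (pure_tensor R A A c d) =
    tensor_lift R A A (add_monoid TA) (\<lambda>c d. pure_tensor R A A (m a c) (m b d)) (pure_tensor R A A c d)"
    unfolding tmult_def
    by (rule AA.lift_pure tensor_square_linear assms | assumption)+
  also have "\<dots> = pure_tensor R A A (m a c) (m b d)"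
    by (rule AA.lift_pure tensor_square_linear assms | assumption)+
  finally show ?thesis .
qed

lemma tensor_square_algebra: "unital_algebra R TA tmult (pure_tensor R A A e e)"
proof (intro unital_algebra.intro unital_algebra_axioms.intro)
  note tmD = bilinear_mapD[OF tmult_bilinear]
  note lin = linear_bilinear_left[OF tmult_bilinear] linear_bilinear_right[OF tmult_bilinear]
    tmD(3) linear_id AA.pure_tensor_closed
  show "module R TA" by (rule AA.module_tensor)
  show "bilinear_map R TA TA TA tmult" by (rule tmult_bilinear)
  show "pure_tensor R A A e e \<in> carrier TA"
    by (intro AA.pure_tensor_closed e_closed)
  show "tmult (pure_tensor R A A e e) t = t" if "t \<in> carrier TA" for t
    by (rule AA.tensor_linear_eqI[OF _ _ _ that])
      (rule lin e_closed | simp add: tmult_pure e_closed e_left)+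
  show "tmult t (pure_tensor R A A e e) = t" if "t \<in> carrier TA" for t
    by (rule AA.tensor_linear_eqI[OF _ _ _ that])
      (rule lin e_closed | simp add: tmult_pure e_closed e_right)+
  fix s t u assume s: "s \<in> carrier TA" and t: "t \<in> carrier TA" and u: "u \<in> carrier TA"
  show "tmult (tmult s t) u = tmult s (tmult t u)"
  proof (rule AA.tensor_linear_eqI[OF _ _ _ s])
    fix a b assume ab: "a \<in> carrier A" "b \<in> carrier A"
    show "tmult (tmult (pure_tensor R A A a b) t) u = tmult (pure_tensor R A A a b) (tmult t u)"
    proof (rule AA.tensor_linear_eqI[OF _ _ _ t])
      fix c d assume cd: "c \<in> carrier A" "d \<in> carrier A"
      show "tmult (tmult (pure_tensor R A A a b) (pure_tensor R A A c d)) u =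
        tmult (pure_tensor R A A a b) (tmult (pure_tensor R A A c d) u)"
      proof (rule AA.tensor_linear_eqI[OF _ _ _ u])
      qed (rule lin ab cd | assumption | simp add: tmult_pure m_closed m_assoc ab cd)+
    qed (rule lin ab u | assumption)+
  qed (rule lin t u | assumption)+
qed

end

section \<open>The antipode of a cocommutative Hopf algebra\<close>

context hopf_algebra begin

notation pt (infixl "\<otimes>\<^sub>T" 75)

abbreviation hmult (infixl "\<cdot>" 70) where "x \<cdot> y \<equiv> x \<otimes>\<^bsub>H\<^esub> y"
abbreviation "S \<equiv> antipode H"

lemmas multD = operationD[OF mult_coalgebra]

lemma mult_algebra: "unital_algebra R H (\<lambda>x y. x \<cdot> y) \<one>\<^bsub>H\<^esub>"
  by (intro unital_algebra.intro unital_algebra_axioms.intro)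
    (simp_all add: module_C multD(1) m_assoc)

sublocale A: unital_algebra R H "\<lambda>x y. x \<cdot> y" "\<one>\<^bsub>H\<^esub>"
  by (rule mult_algebra)

lemmas antipode_closed = linear_mapD(1)[OF antipode_linear]

lemmas hopf_linear = sweedler_linear A.algebra_linear linear_comp[OF antipode_linear] antipode_closed

lemma comult_mult:
  assumes "x \<in> carrier H" "y \<in> carrier H"
  shows "comult H (x \<cdot> y) = A.tmult (comult H x) (comult H y)"
  using multD(2)[OF assms] by (simp add: A.tmult_def sweedler_def)

lemma sw_one:
  assumes "module R P" "bilinear_map R H H P f"
  shows "sw P f \<one>\<^bsub>H\<^esub> = f \<one>\<^bsub>H\<^esub> \<one>\<^bsub>H\<^esub>"
  using CC.lift_pure[OF assms] by (simp add: sweedler_def comult_one)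

lemma linear_counit_one: "linear_map R H H (\<lambda>x. counit H x \<odot>\<^bsub>H\<^esub> \<one>\<^bsub>H\<^esub>)"
  by (intro linear_mapI)
    (use linear_mapD[OF linear_counit] in \<open>simp_all add: smult_l_distr smult_assoc1\<close>)

lemma counit_smult_one:
  assumes "r \<in> carrier R"
  shows "counit H (r \<odot>\<^bsub>H\<^esub> \<one>\<^bsub>H\<^esub>) = r"
  using linear_mapD(3)[OF linear_counit] assms by (simp add: counit_one)

text \<open>Apply \<open>\<epsilon>\<close> to \<open>S(x\<^sub>1) x\<^sub>2 = \<epsilon>(x) 1\<close>;
  since \<open>\<epsilon>\<close> is multiplicative, the factor
  \<open>\<epsilon>(x\<^sub>2)\<close> is absorbed by the counit law.\<close>

lemma counit_antipode:
  assumes x: "x \<in> carrier H"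
  shows "counit H (S x) = counit H x"
proof -
  have K: "module R (scalars R)" by (rule module_scalars) (rule is_cring)
  have "counit H x = counit H (sw H (\<lambda>a b. S a \<cdot> b) x)"
    by (simp add: antipode_left x counit_smult_one counit_closed)
  also have "\<dots> = sw (scalars R) (\<lambda>a b. counit H (S a \<cdot> b)) x"
    by (rule linear_sw[OF _ _ linear_counit] K hopf_linear x | assumption)+
  also have "\<dots> = sw (scalars R) (\<lambda>a b. counit H b \<odot>\<^bsub>scalars R\<^esub> counit H (S a)) x"
    by (rule sw_cong) (simp add: multD(3) antipode_closed counit_closed m_comm)
  also have "\<dots> = counit H (S x)"
    by (rule sw_counit_right[OF K linear_comp[OF linear_counit antipode_linear] x])
  finally show ?thesis ..
qed

text \<open>In the convolution algebra of maps from \<open>H\<close> to \<open>H \<otimes> H\<close>, the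
  map \<open>\<Delta> \<circ> S\<close> is a left inverse of \<open>\<Delta>\<close>, because
  \<open>\<Delta>\<close> is multiplicative, and \<open>(S \<otimes> S) \<circ> \<Delta>\<close>
  is a right inverse. Hence they coincide. The second claim needs cocommutativity: its product is
  \<open>x\<^sub>1 S(x\<^sub>3) \<otimes> x\<^sub>2 S(x\<^sub>4)\<close>, and exchanging
  \<open>x\<^sub>2\<close> and \<open>x\<^sub>3\<close> lets the antipode axiom act in both tensor
  factors.\<close>

lemma comult_antipode:
  assumes cocomm: "cocommutative R H" and x: "x \<in> carrier H"
  shows "comult H (S x) = sw T (\<lambda>a b. S a \<otimes>\<^sub>T S b) x"
proof (rule convolution_inverse_unique[OF A.tensor_square_algebra _ _ _ _ _ x])
  interpret TT: unital_algebra R T A.tmult "\<one>\<^bsub>H\<^esub> \<otimes>\<^sub>T \<one>\<^bsub>H\<^esub>"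
    by (rule A.tensor_square_algebra)
  note linear_rules = hopf_linear TT.algebra_linear linear_comp[OF linear_counit_one] linear_mapD(1)[OF linear_counit_one] A.e_closed
  show "linear_map R H T (\<lambda>x. comult H (S x))"
    by (rule linear_comp[OF comult_linear antipode_linear])
  show "linear_map R H T (comult H)"
    by (rule comult_linear)
  show "linear_map R H T (\<lambda>x. sw T (\<lambda>a b. S a \<otimes>\<^sub>T S b) x)"
    by (rule hopf_linear | assumption)+
  fix y assume y: "y \<in> carrier H"
  have "sw T (\<lambda>a b. A.tmult (comult H (S a)) (comult H b)) y = sw T (\<lambda>a b. comult H (S a \<cdot> b)) y"
    by (rule sw_cong comult_mult[symmetric] antipode_closed | assumption)+
  also have "\<dots> = comult H (sw H (\<lambda>a b. S a \<cdot> b) y)"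
    by (rule linear_sw[OF _ _ comult_linear, symmetric] hopf_linear y | assumption)+
  also have "\<dots> = counit H y \<odot>\<^bsub>T\<^esub> (\<one>\<^bsub>H\<^esub> \<otimes>\<^sub>T \<one>\<^bsub>H\<^esub>)"
    using linear_mapD(3)[OF comult_linear counit_closed[OF y] one_closed]
    by (simp add: antipode_left y comult_one)
  finally show "sw T (\<lambda>a b. A.tmult (comult H (S a)) (comult H b)) y =
    counit H y \<odot>\<^bsub>T\<^esub> (\<one>\<^bsub>H\<^esub> \<otimes>\<^sub>T \<one>\<^bsub>H\<^esub>)" .
  have "sw T (\<lambda>u v. A.tmult (comult H u) (sw T (\<lambda>c d. S c \<otimes>\<^sub>T S d) v)) y =
    sw T (\<lambda>u v. sw T (\<lambda>c d. A.tmult (comult H u) (S c \<otimes>\<^sub>T S d)) v) y"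
    by (rule sw_cong linear_sw linear_rules y | assumption)+
  also have "\<dots> = sw T (\<lambda>u v. sw T (\<lambda>c d. sw T (\<lambda>a b. (a \<cdot> S c) \<otimes>\<^sub>T (b \<cdot> S d)) u) v) y"
  proof (intro sw_cong)
    fix u v c d
    assume u: "u \<in> carrier H" and cd: "c \<in> carrier H" "d \<in> carrier H"
    have "sw T (\<lambda>a b. a \<otimes>\<^sub>T b) u = comult H u"
      unfolding sweedler_def
      by (rule CC.tensor_linear_eqI[OF CC.lift_linear linear_id _ comult_closed[OF u]])
        (simp_all add: CC.module_tensor CC.pure_bilinear CC.lift_pure)
    then have "A.tmult (comult H u) (S c \<otimes>\<^sub>T S d) = A.tmult (sw T (\<lambda>a b. a \<otimes>\<^sub>T b) u) (S c \<otimes>\<^sub>T S d)"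
      by simp
    also have "\<dots> = sw T (\<lambda>a b. A.tmult (a \<otimes>\<^sub>T b) (S c \<otimes>\<^sub>T S d)) u"
      by (rule linear_sw[where h = "\<lambda>s. A.tmult s _"] linear_rules u cd | assumption)+
    also have "\<dots> = sw T (\<lambda>a b. (a \<cdot> S c) \<otimes>\<^sub>T (b \<cdot> S d)) u"
      by (rule sw_cong A.tmult_pure antipode_closed cd | assumption)+
    finally show "A.tmult (comult H u) (S c \<otimes>\<^sub>T S d) = sw T (\<lambda>a b. (a \<cdot> S c) \<otimes>\<^sub>T (b \<cdot> S d)) u" .
  qed
  also have "\<dots> = sw T (\<lambda>u v. sw T (\<lambda>a b. sw T (\<lambda>c d. (a \<cdot> S c) \<otimes>\<^sub>T (b \<cdot> S d)) v) u) y"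
    by (rule sw_cong sw_swap hopf_linear y | assumption)+
  also have "\<dots> = sw T (\<lambda>u v. sw T (\<lambda>a b. sw T (\<lambda>c d. (a \<cdot> S b) \<otimes>\<^sub>T (c \<cdot> S d)) v) u) y"
    by (rule sw_middle_swap[OF cocomm] hopf_linear y | assumption)+
  also have "\<dots> = sw T (\<lambda>u v. sw T (\<lambda>a b. (a \<cdot> S b) \<otimes>\<^sub>T sw H (\<lambda>c d. c \<cdot> S d) v) u) y"
    by (rule sw_cong linear_sw[symmetric] hopf_linear y | assumption)+
  also have "\<dots> = sw T (\<lambda>u v. sw H (\<lambda>a b. a \<cdot> S b) u \<otimes>\<^sub>T sw H (\<lambda>c d. c \<cdot> S d) v) y"
    by (rule sw_cong linear_sw[symmetric, where h = "\<lambda>s. s \<otimes>\<^sub>T _"] hopf_linear y | assumption)+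
  also have "\<dots> = sw T (\<lambda>u v. counit H u \<odot>\<^bsub>T\<^esub> (\<one>\<^bsub>H\<^esub> \<otimes>\<^sub>T (counit H v \<odot>\<^bsub>H\<^esub> \<one>\<^bsub>H\<^esub>))) y"
  proof (rule sw_cong)
    fix u v assume uv: "u \<in> carrier H" "v \<in> carrier H"
    have "(counit H u \<odot>\<^bsub>H\<^esub> \<one>\<^bsub>H\<^esub>) \<otimes>\<^sub>T (counit H v \<odot>\<^bsub>H\<^esub> \<one>\<^bsub>H\<^esub>) =
      counit H u \<odot>\<^bsub>T\<^esub> (\<one>\<^bsub>H\<^esub> \<otimes>\<^sub>T (counit H v \<odot>\<^bsub>H\<^esub> \<one>\<^bsub>H\<^esub>))"
      by (rule linear_mapD(3)[OF bilinear_mapD(2)[OF CC.pure_bilinear]]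
          counit_closed uv one_closed linear_mapD(1)[OF linear_counit_one])+
    then show "sw H (\<lambda>a b. a \<cdot> S b) u \<otimes>\<^sub>T sw H (\<lambda>c d. c \<cdot> S d) v =
      counit H u \<odot>\<^bsub>T\<^esub> (\<one>\<^bsub>H\<^esub> \<otimes>\<^sub>T (counit H v \<odot>\<^bsub>H\<^esub> \<one>\<^bsub>H\<^esub>))"
      by (simp add: antipode_right uv)
  qed
  also have "\<dots> = \<one>\<^bsub>H\<^esub> \<otimes>\<^sub>T (counit H y \<odot>\<^bsub>H\<^esub> \<one>\<^bsub>H\<^esub>)"
    by (rule sw_counit_left linear_rules linear_counit_one y)+
  also have "\<dots> = counit H y \<odot>\<^bsub>T\<^esub> (\<one>\<^bsub>H\<^esub> \<otimes>\<^sub>T \<one>\<^bsub>H\<^esub>)"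
    by (rule linear_mapD(3)[OF bilinear_mapD(1)[OF CC.pure_bilinear]] counit_closed y one_closed)+
  finally show "sw T (\<lambda>u v. A.tmult (comult H u) (sw T (\<lambda>c d. S c \<otimes>\<^sub>T S d) v)) y =
    counit H y \<odot>\<^bsub>T\<^esub> (\<one>\<^bsub>H\<^esub> \<otimes>\<^sub>T \<one>\<^bsub>H\<^esub>)" .
qed

lemma antipode_coalgebra_hom:
  assumes "cocommutative R H"
  shows "coalgebra_hom R H H S"
  unfolding coalgebra_hom_def
  using assms by (simp add: antipode_linear comult_antipode counit_antipode)

lemma coalgebra_H: "coalgebra R H" by unfold_locales

text \<open>The antipode axiom read at \<open>f(x)\<close>, whose coproduct is \<open>f(x\<^sub>1) \<otimes>
  f(x\<^sub>2)\<close>. So \<open>S \<circ> f\<close> is the convolution inverse of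
  \<open>f\<close>.\<close>

lemma antipode_hom_inverse:
  assumes "coalgebra R D" "coalgebra_hom R D H f" and x: "x \<in> carrier D"
  shows "sweedler R D H (\<lambda>a b. S (f a) \<cdot> f b) x = counit D x \<odot>\<^bsub>H\<^esub> \<one>\<^bsub>H\<^esub>"
    and "sweedler R D H (\<lambda>a b. f a \<cdot> S (f b)) x = counit D x \<odot>\<^bsub>H\<^esub> \<one>\<^bsub>H\<^esub>"
proof -
  interpret D: coalgebra R D by fact
  note fD = D.coalgebra_homD[OF assms(2)]
  have "bilinear_map R H H H (\<lambda>a b. S a \<cdot> b)" "bilinear_map R H H H (\<lambda>a b. a \<cdot> S b)"
    by (rule hopf_linear | assumption)+
  note eqs = this[THEN D.sw_coalgebra_hom[OF coalgebra_H assms(2) module_C _ x]]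
  show "sweedler R D H (\<lambda>a b. S (f a) \<cdot> f b) x = counit D x \<odot>\<^bsub>H\<^esub> \<one>\<^bsub>H\<^esub>"
    using eqs(1) fD x by (simp add: antipode_left)
  show "sweedler R D H (\<lambda>a b. f a \<cdot> S (f b)) x = counit D x \<odot>\<^bsub>H\<^esub> \<one>\<^bsub>H\<^esub>"
    using eqs(2) fD x by (simp add: antipode_right)
qed

end

section \<open>Operations related by a twist map\<close>

text \<open>Hopf trusses and weak twisted post-Hopf algebras share these data, with \<open>tri\<close> for
  \<open>\<rhd>\<close> and \<open>circ\<close> for \<open>\<circ>\<close>: in the former
  \<open>\<circ>\<close> is given and \<open>\<rhd>\<close> derived, in the latter conversely. In
  this locale the remaining axioms of the two structures are compared, whichever operation came
  first.\<close>

locale hopf_twist = hopf_algebra R H for R (structure) and H (structure) +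
  fixes \<phi> :: "'c \<Rightarrow> 'c" and tri circ :: "'c \<Rightarrow> 'c \<Rightarrow> 'c"
  assumes cocomm: "cocommutative R H"
    and phi_hom: "coalgebra_hom R H H \<phi>"
    and tri_op: "coalgebra_operation R H tri"
    and circ_op: "coalgebra_operation R H circ"
    and circ_eq: "\<lbrakk>x \<in> carrier H; y \<in> carrier H\<rbrakk> \<Longrightarrow>
      circ x y = sweedler R H H (\<lambda>a b. \<phi> a \<otimes>\<^bsub>H\<^esub> tri b y) x"
begin

notation pt (infixl "\<otimes>\<^sub>T" 75)
notation hmult (infixl "\<cdot>" 70)

lemmas phiD = coalgebra_homD[OF phi_hom]
lemmas triD = operationD[OF tri_op]
lemmas circD = operationD[OF circ_op]

lemmas twist_linear = hopf_linear phiD(2) triD(4) circD(4) linear_comp[OF phiD(1)]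
  linear_bilinear_left[OF triD(1)] linear_bilinear_right[OF triD(1)]
  linear_bilinear_left[OF circD(1)] linear_bilinear_right[OF circD(1)]

text \<open>By definition \<open>\<circ>\<close> is the convolution of \<open>\<Phi>\<close> with
  \<open>\<rhd>\<close>, and \<open>S \<circ> \<Phi>\<close> is the inverse of
  \<open>\<Phi>\<close>. So each of the two operations determines the other.\<close>

lemma tri_eq:
  assumes x: "x \<in> carrier H" and y: "y \<in> carrier H"
  shows "tri x y = sw H (\<lambda>a b. S (\<phi> a) \<cdot> circ b y) x"
proof -
  have "sw H (\<lambda>a b. S (\<phi> a) \<cdot> circ b y) x =
    sw H (\<lambda>a u. S (\<phi> a) \<cdot> sw H (\<lambda>b c. \<phi> b \<cdot> tri c y) u) x"
    by (rule sw_cong) (simp add: circ_eq y)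
  also have "\<dots> = tri x y"
    by (rule convolution_cancel_left[OF mult_algebra] twist_linear antipode_hom_inverse(1)[OF coalgebra_H phi_hom] x y | assumption)+
  finally show ?thesis ..
qed

lemma convolution_circ:
  assumes x: "x \<in> carrier H" and y: "y \<in> carrier H" and g: "linear_map R H H g"
  shows "sw H (\<lambda>u c. circ u y \<cdot> g c) x = sw H (\<lambda>a u. \<phi> a \<cdot> sw H (\<lambda>b c. tri b y \<cdot> g c) u) x"
proof -
  have "sw H (\<lambda>u c. circ u y \<cdot> g c) x = sw H (\<lambda>u c. sw H (\<lambda>a b. \<phi> a \<cdot> tri b y) u \<cdot> g c) x"
    by (rule sw_cong) (simp add: circ_eq y)
  also have "\<dots> = sw H (\<lambda>a u. \<phi> a \<cdot> sw H (\<lambda>b c. tri b y \<cdot> g c) u) x"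
    by (rule convolution_assoc[OF mult_algebra] twist_linear g x y | assumption)+
  finally show ?thesis .
qed

text \<open>In the sum on the right-hand side of the truss law, the last two factors
  \<open>S(\<Phi>(x\<^sub>2)) (x\<^sub>3 \<circ> z)\<close> combine to an application of
  \<open>\<rhd>\<close>.\<close>

lemma truss_sum_eq:
  assumes x: "x \<in> carrier H" and y: "y \<in> carrier H" and z: "z \<in> carrier H"
  shows "sw H (\<lambda>x1 u. sw H (\<lambda>x2 x3. circ x1 y \<cdot> S (\<phi> x2) \<cdot> circ x3 z) u) x =
    sw H (\<lambda>a u. \<phi> a \<cdot> sw H (\<lambda>b c. tri b y \<cdot> tri c z) u) x"
proof -
  have "sw H (\<lambda>x1 u. sw H (\<lambda>x2 x3. circ x1 y \<cdot> S (\<phi> x2) \<cdot> circ x3 z) u) x =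
    sw H (\<lambda>x1 u. sw H (\<lambda>x2 x3. circ x1 y \<cdot> (S (\<phi> x2) \<cdot> circ x3 z)) u) x"
    by (rule sw_cong A.m_assoc twist_linear y z | assumption)+
  also have "\<dots> = sw H (\<lambda>x1 u. circ x1 y \<cdot> sw H (\<lambda>x2 x3. S (\<phi> x2) \<cdot> circ x3 z) u) x"
    by (rule sw_cong linear_sw[symmetric] twist_linear y z | assumption)+
  also have "\<dots> = sw H (\<lambda>x1 u. circ x1 y \<cdot> tri u z) x"
    by (rule sw_cong) (simp add: tri_eq z)
  also have "\<dots> = sw H (\<lambda>a u. \<phi> a \<cdot> sw H (\<lambda>b c. tri b y \<cdot> tri c z) u) x"
    by (rule convolution_circ twist_linear x y z | assumption)+
  finally show ?thesis .
qed

text \<open>The truss law is the convolution of \<open>\<Phi>\<close> with the law that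
  \<open>\<rhd>\<close> distributes over products, and the convolution-invertible
  \<open>\<Phi>\<close> can be cancelled.\<close>

lemma circ_mult_iff_tri_mult:
  assumes y: "y \<in> carrier H" and z: "z \<in> carrier H"
  shows "(\<forall>x \<in> carrier H. circ x (y \<cdot> z) =
      sw H (\<lambda>x1 u. sw H (\<lambda>x2 x3. circ x1 y \<cdot> S (\<phi> x2) \<cdot> circ x3 z) u) x) \<longleftrightarrow>
    (\<forall>x \<in> carrier H. tri x (y \<cdot> z) = sw H (\<lambda>a b. tri a y \<cdot> tri b z) x)" (is "?l \<longleftrightarrow> ?r")
proof
  assume r: ?r
  show ?l
  proof
    fix x assume x: "x \<in> carrier H"
    have "circ x (y \<cdot> z) = sw H (\<lambda>a u. \<phi> a \<cdot> tri u (y \<cdot> z)) x"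
      by (simp add: circ_eq x y z)
    also have "\<dots> = sw H (\<lambda>a u. \<phi> a \<cdot> sw H (\<lambda>b c. tri b y \<cdot> tri c z) u) x"
      by (rule sw_cong) (simp add: r)
    finally show "circ x (y \<cdot> z) =
      sw H (\<lambda>x1 u. sw H (\<lambda>x2 x3. circ x1 y \<cdot> S (\<phi> x2) \<cdot> circ x3 z) u) x"
      by (simp add: truss_sum_eq x y z)
  qed
next
  assume l: ?l
  show ?r
  proof
    fix x assume x: "x \<in> carrier H"
    have "tri x (y \<cdot> z) = sw H (\<lambda>a u. S (\<phi> a) \<cdot> circ u (y \<cdot> z)) x"
      by (simp add: tri_eq x y z)
    also have "\<dots> = sw H (\<lambda>a u. S (\<phi> a) \<cdot>
        sw H (\<lambda>b v. \<phi> b \<cdot> sw H (\<lambda>c d. tri c y \<cdot> tri d z) v) u) x"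
      by (rule sw_cong) (simp add: l truss_sum_eq y z)
    also have "\<dots> = sw H (\<lambda>c d. tri c y \<cdot> tri d z) x"
      by (rule convolution_cancel_left[OF mult_algebra] twist_linear
          antipode_hom_inverse(1)[OF coalgebra_H phi_hom] x y z | assumption)+
    finally show "tri x (y \<cdot> z) = sw H (\<lambda>a b. tri a y \<cdot> tri b z) x" .
  qed
qed

text \<open>The coproduct of \<open>x \<circ> y\<close> is \<open>(x\<^sub>1 \<circ> y\<^sub>1) \<otimes>
  (x\<^sub>2 \<circ> y\<^sub>2)\<close>. This lemma and the next one write the two sides of
  associativity as convolutions with the same first factor \<open>\<Phi>(x \<circ> y)\<close>.\<close>

lemma circ_circ_left:
  assumes x: "x \<in> carrier H" and y: "y \<in> carrier H" and z: "z \<in> carrier H"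
  shows "circ (circ x y) z = sw H (\<lambda>x1 x2. sw H (\<lambda>y1 y2.
    \<phi> (circ x1 y1) \<cdot> tri (circ x2 y2) z) y) x"
proof -
  have "circ (circ x y) z = sw H (\<lambda>a b. \<phi> a \<cdot> tri b z) (circ x y)"
    by (simp add: circ_eq[of "circ x y"] circD x y z)
  also have "\<dots> = sw H (\<lambda>x1 x2. sw H (\<lambda>y1 y2. \<phi> (circ x1 y1) \<cdot> tri (circ x2 y2) z) y) x"
    by (rule sw_operation[OF circ_op] twist_linear x y z | assumption)+
  finally show ?thesis .
qed

text \<open>Expanding \<open>x \<circ> (y \<circ> z)\<close> gives \<open>\<Phi>(x\<^sub>1) (x\<^sub>2
  \<rhd> \<Phi>(y\<^sub>1)) (x\<^sub>3 \<rhd> (y\<^sub>2 \<rhd> z))\<close>. The first two factors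
  form \<open>x\<^sub>1 \<circ> \<Phi>(y\<^sub>1) = \<Phi>(x\<^sub>1 \<circ> y\<^sub>1)\<close>.\<close>

lemma circ_circ_right:
  assumes tri_mult: "\<And>x y z. \<lbrakk>x \<in> carrier H; y \<in> carrier H; z \<in> carrier H\<rbrakk> \<Longrightarrow>
      tri x (y \<cdot> z) = sw H (\<lambda>a b. tri a y \<cdot> tri b z) x"
    and phi_circ: "\<And>x y. \<lbrakk>x \<in> carrier H; y \<in> carrier H\<rbrakk> \<Longrightarrow> \<phi> (circ x y) = circ x (\<phi> y)"
    and x: "x \<in> carrier H" and y: "y \<in> carrier H" and z: "z \<in> carrier H"
  shows "circ x (circ y z) = sw H (\<lambda>x1 x2. sw H (\<lambda>y1 y2.
    \<phi> (circ x1 y1) \<cdot> tri x2 (tri y2 z)) y) x"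
proof -
  have "circ x (circ y z) = sw H (\<lambda>a u. \<phi> a \<cdot> tri u (circ y z)) x"
    by (simp add: circ_eq[of x] circD x y z)
  also have "\<dots> = sw H (\<lambda>a u. \<phi> a \<cdot> tri u (sw H (\<lambda>y1 y2. \<phi> y1 \<cdot> tri y2 z) y)) x"
    by (simp add: circ_eq y z)
  also have "\<dots> = sw H (\<lambda>a u. sw H (\<lambda>y1 y2. \<phi> a \<cdot> tri u (\<phi> y1 \<cdot> tri y2 z)) y) x"
    by (rule sw_cong linear_sw twist_linear x y z | assumption)+
  also have "\<dots> = sw H (\<lambda>y1 y2. sw H (\<lambda>a u. \<phi> a \<cdot> tri u (\<phi> y1 \<cdot> tri y2 z)) x) y"
    by (rule sw_swap twist_linear x y z | assumption)+
  also have "\<dots> = sw H (\<lambda>y1 y2. sw H (\<lambda>a u. \<phi> a \<cdot>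
      sw H (\<lambda>b c. tri b (\<phi> y1) \<cdot> tri c (tri y2 z)) u) x) y"
    by (rule sw_cong arg_cong2[where f = "\<lambda>s t. s \<cdot> t", OF refl] tri_mult twist_linear x y z | assumption)+
  also have "\<dots> = sw H (\<lambda>y1 y2. sw H (\<lambda>u c. circ u (\<phi> y1) \<cdot> tri c (tri y2 z)) x) y"
    by (rule sw_cong convolution_circ[symmetric] twist_linear x y z | assumption)+
  also have "\<dots> = sw H (\<lambda>x1 x2. sw H (\<lambda>y1 y2. circ x1 (\<phi> y1) \<cdot> tri x2 (tri y2 z)) y) x"
    by (rule sw_swap twist_linear x y z | assumption)+
  also have "\<dots> = sw H (\<lambda>x1 x2. sw H (\<lambda>y1 y2. \<phi> (circ x1 y1) \<cdot> tri x2 (tri y2 z)) y) x"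
    by (intro sw_cong) (simp add: phi_circ)
  finally show ?thesis .
qed

text \<open>The map \<open>p(x, y) = \<Phi>(x \<circ> y)\<close> is a coalgebra morphism from \<open>H
  \<otimes> H\<close> to \<open>H\<close>, so \<open>S \<circ> p\<close> is its inverse in the
  convolution algebra of bilinear maps, and \<open>(S \<circ> p) * (p * F) = F\<close>.
  Associativity of this convolution is coassociativity in each of the two variables.\<close>

lemma sw_two_cancel:
  assumes F: "bilinear_map R H H H F" and x: "x \<in> carrier H" and y: "y \<in> carrier H"
  defines "p \<equiv> \<lambda>x y. \<phi> (circ x y)"
  shows "sw H (\<lambda>a u. sw H (\<lambda>c v. S (p a c) \<cdot>
    sw H (\<lambda>b b'. sw H (\<lambda>d d'. p b d \<cdot> F b' d') v) u) y) x = F x y"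
proof -
  have p: "bilinear_map R H H H p"
    unfolding p_def by (rule twist_linear | assumption)+
  note linear_rules = hopf_linear linear_bilinear_left[OF F] linear_bilinear_right[OF F] bilinear_mapD(3)[OF F]
     linear_bilinear_left[OF p] linear_bilinear_right[OF p] bilinear_mapD(3)[OF p]
  have inv: "sw H (\<lambda>a b. sw H (\<lambda>c d. S (p a c) \<cdot> p b d) v) u =
      counit H u \<odot>\<^bsub>H\<^esub> (counit H v \<odot>\<^bsub>H\<^esub> \<one>\<^bsub>H\<^esub>)"
    if u: "u \<in> carrier H" and v: "v \<in> carrier H" for u v
  proof -
    have "sw H (\<lambda>a b. sw H (\<lambda>c d. S (p a c) \<cdot> p b d) v) u = sw H (\<lambda>a b. S (\<phi> a) \<cdot> \<phi> b) (circ u v)"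
      unfolding p_def by (rule sw_operation[OF circ_op, symmetric] twist_linear u v | assumption)+
    also have "\<dots> = counit H (circ u v) \<odot>\<^bsub>H\<^esub> \<one>\<^bsub>H\<^esub>"
      by (rule antipode_hom_inverse(1)[OF coalgebra_H phi_hom circD(4)[OF u v]])
    finally show ?thesis
      using u v by (simp add: circD(3) smult_assoc1 counit_closed)
  qed
  have "sw H (\<lambda>a u. sw H (\<lambda>c v. S (p a c) \<cdot>
      sw H (\<lambda>b b'. sw H (\<lambda>d d'. p b d \<cdot> F b' d') v) u) y) x =
    sw H (\<lambda>a u. sw H (\<lambda>c v. sw H (\<lambda>b b'. S (p a c) \<cdot>
      sw H (\<lambda>d d'. p b d \<cdot> F b' d') v) u) y) x"
    by (rule sw_cong linear_sw linear_rules x y | assumption)+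
  also have "\<dots> = sw H (\<lambda>a u. sw H (\<lambda>c v. sw H (\<lambda>b b'. sw H (\<lambda>d d'.
      S (p a c) \<cdot> (p b d \<cdot> F b' d')) v) u) y) x"
    by (rule sw_cong linear_sw linear_rules x y | assumption)+
  also have "\<dots> = sw H (\<lambda>a u. sw H (\<lambda>c v. sw H (\<lambda>b b'. sw H (\<lambda>d d'.
      (S (p a c) \<cdot> p b d) \<cdot> F b' d') v) u) y) x"
    by (rule sw_cong A.m_assoc[symmetric] linear_rules x y | assumption)+
  \<comment> \<open>The sums over \<open>y\<close> and over \<open>x\<close> are rebracketed in turn, so that \<open>S \<circ> p\<close> is summed against \<open>p\<close>.\<close>
  also have "\<dots> = sw H (\<lambda>a u. sw H (\<lambda>b b'. sw H (\<lambda>c v. sw H (\<lambda>d d'.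
      (S (p a c) \<cdot> p b d) \<cdot> F b' d') v) y) u) x"
    by (rule sw_cong sw_swap linear_rules x y | assumption)+
  also have "\<dots> = sw H (\<lambda>a u. sw H (\<lambda>b b'. sw H (\<lambda>v d'. sw H (\<lambda>c d.
      (S (p a c) \<cdot> p b d) \<cdot> F b' d') v) y) u) x"
    by (rule sw_cong sw_coassoc[symmetric] linear_rules x y | assumption)+
  also have "\<dots> = sw H (\<lambda>u b'. sw H (\<lambda>a b. sw H (\<lambda>v d'. sw H (\<lambda>c d.
      (S (p a c) \<cdot> p b d) \<cdot> F b' d') v) y) u) x"
    by (rule sw_coassoc[symmetric] linear_rules x y | assumption)+
  also have "\<dots> = sw H (\<lambda>u b'. sw H (\<lambda>v d'. sw H (\<lambda>a b. sw H (\<lambda>c d.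
      (S (p a c) \<cdot> p b d) \<cdot> F b' d') v) u) y) x"
    by (rule sw_cong sw_swap linear_rules x y | assumption)+
  also have "\<dots> = sw H (\<lambda>u b'. sw H (\<lambda>v d'. sw H (\<lambda>a b.
      sw H (\<lambda>c d. S (p a c) \<cdot> p b d) v \<cdot> F b' d') u) y) x"
    by (rule sw_cong linear_sw[symmetric, where h = "\<lambda>s. s \<cdot> _"] linear_rules x y | assumption)+
  also have "\<dots> = sw H (\<lambda>u b'. sw H (\<lambda>v d'.
      sw H (\<lambda>a b. sw H (\<lambda>c d. S (p a c) \<cdot> p b d) v) u \<cdot> F b' d') y) x"
    by (rule sw_cong linear_sw[symmetric, where h = "\<lambda>s. s \<cdot> _"] linear_rules x y | assumption)+
  also have "\<dots> = sw H (\<lambda>u b'. sw H (\<lambda>v d'. counit H v \<odot>\<^bsub>H\<^esub> (counit H u \<odot>\<^bsub>H\<^esub> F b' d')) y) x"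
  proof (intro sw_cong)
    fix u b' v d'
    assume c: "u \<in> carrier H" "b' \<in> carrier H" "v \<in> carrier H" "d' \<in> carrier H"
    then have Fc: "F b' d' \<in> carrier H" by (simp add: bilinear_mapD(3)[OF F])
    have "counit H u \<odot>\<^bsub>H\<^esub> (counit H v \<odot>\<^bsub>H\<^esub> \<one>\<^bsub>H\<^esub>) =
      (counit H v \<otimes>\<^bsub>R\<^esub> counit H u) \<odot>\<^bsub>H\<^esub> \<one>\<^bsub>H\<^esub>"
      using c by (simp add: smult_assoc1[symmetric] counit_closed m_comm)
    then have "sw H (\<lambda>a b. sw H (\<lambda>c d. S (p a c) \<cdot> p b d) v) u =
      (counit H v \<otimes>\<^bsub>R\<^esub> counit H u) \<odot>\<^bsub>H\<^esub> \<one>\<^bsub>H\<^esub>"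
      using inv[OF c(1,3)] by simp
    then show "sw H (\<lambda>a b. sw H (\<lambda>c d. S (p a c) \<cdot> p b d) v) u \<cdot> F b' d' =
      counit H v \<odot>\<^bsub>H\<^esub> (counit H u \<odot>\<^bsub>H\<^esub> F b' d')"
      using c Fc by (simp add: A.smult_e_left counit_closed) (simp add: smult_assoc1 counit_closed)
  qed
  also have "\<dots> = sw H (\<lambda>u b'. counit H u \<odot>\<^bsub>H\<^esub> F b' y) x"
    by (rule sw_cong sw_counit_left linear_smult counit_closed linear_rules x y | assumption)+
  also have "\<dots> = F x y"
    by (rule sw_counit_left linear_rules x y)+
  finally show ?thesis .
qed

text \<open>Associativity of \<open>\<circ>\<close> is the action law \<open>(x \<circ> y) \<rhd> z = x
  \<rhd> (y \<rhd> z)\<close> convolved with the invertible map \<open>\<Phi>(x \<circ>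
  y)\<close>.\<close>

lemma circ_assoc_iff_tri_circ:
  assumes tri_mult: "\<And>x y z. \<lbrakk>x \<in> carrier H; y \<in> carrier H; z \<in> carrier H\<rbrakk> \<Longrightarrow>
      tri x (y \<cdot> z) = sw H (\<lambda>a b. tri a y \<cdot> tri b z) x"
    and phi_circ: "\<And>x y. \<lbrakk>x \<in> carrier H; y \<in> carrier H\<rbrakk> \<Longrightarrow> \<phi> (circ x y) = circ x (\<phi> y)"
    and z: "z \<in> carrier H"
  shows "(\<forall>x \<in> carrier H. \<forall>y \<in> carrier H. circ (circ x y) z = circ x (circ y z)) \<longleftrightarrow>
    (\<forall>x \<in> carrier H. \<forall>y \<in> carrier H. tri (circ x y) z = tri x (tri y z))" (is "?l \<longleftrightarrow> ?r")
proof
  assume r: ?r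
  show ?l
  proof (intro ballI)
    fix x y assume xy: "x \<in> carrier H" "y \<in> carrier H"
    have "circ (circ x y) z = sw H (\<lambda>x1 x2. sw H (\<lambda>y1 y2.
        \<phi> (circ x1 y1) \<cdot> tri (circ x2 y2) z) y) x"
      by (rule circ_circ_left[OF xy z])
    also have "\<dots> = sw H (\<lambda>x1 x2. sw H (\<lambda>y1 y2. \<phi> (circ x1 y1) \<cdot> tri x2 (tri y2 z)) y) x"
      by (intro sw_cong) (simp add: r)
    also have "\<dots> = circ x (circ y z)"
      by (rule circ_circ_right[OF tri_mult phi_circ xy z, symmetric])
    finally show "circ (circ x y) z = circ x (circ y z)" .
  qed
next
  assume l: ?l
  let ?F = "\<lambda>x y. tri (circ x y) z" and ?G = "\<lambda>x y. tri x (tri y z)"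
  have F: "bilinear_map R H H H ?F" and G: "bilinear_map R H H H ?G"
    by (rule twist_linear z | assumption)+
  show ?r
  proof (intro ballI)
    fix x y assume x: "x \<in> carrier H" and y: "y \<in> carrier H"
    have "?F x y = sw H (\<lambda>a u. sw H (\<lambda>c v. S (\<phi> (circ a c)) \<cdot>
        sw H (\<lambda>b b'. sw H (\<lambda>d d'. \<phi> (circ b d) \<cdot> ?F b' d') v) u) y) x"
      using sw_two_cancel[OF F x y] ..
    also have "\<dots> = sw H (\<lambda>a u. sw H (\<lambda>c v. S (\<phi> (circ a c)) \<cdot>
        sw H (\<lambda>b b'. sw H (\<lambda>d d'. \<phi> (circ b d) \<cdot> ?G b' d') v) u) y) x"
    proof (intro sw_cong)
      fix a u c v assume c: "u \<in> carrier H" "v \<in> carrier H"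
      have "sw H (\<lambda>b b'. sw H (\<lambda>d d'. \<phi> (circ b d) \<cdot> ?F b' d') v) u = circ (circ u v) z"
        by (rule circ_circ_left[OF c z, symmetric])
      also have "\<dots> = circ u (circ v z)"
        using l c by simp
      also have "\<dots> = sw H (\<lambda>b b'. sw H (\<lambda>d d'. \<phi> (circ b d) \<cdot> ?G b' d') v) u"
        by (rule circ_circ_right[OF tri_mult phi_circ c z])
      finally show "S (\<phi> (circ a c)) \<cdot> sw H (\<lambda>b b'. sw H (\<lambda>d d'. \<phi> (circ b d) \<cdot> ?F b' d') v) u =
        S (\<phi> (circ a c)) \<cdot> sw H (\<lambda>b b'. sw H (\<lambda>d d'. \<phi> (circ b d) \<cdot> ?G b' d') v) u"
        by (rule arg_cong)
    qed
    also have "\<dots> = ?G x y"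
      by (rule sw_two_cancel[OF G x y])
    finally show "?F x y = ?G x y" .
  qed
qed

end

lemma (in coalgebra) coalgebra_operation_cong:
  assumes "\<And>x y. \<lbrakk>x \<in> carrier C; y \<in> carrier C\<rbrakk> \<Longrightarrow> f x y = g x y" "coalgebra_operation R C g"
  shows "coalgebra_operation R C f"
proof -
  note g = operationD[OF assms(2)]
  have "bilinear_map R C C C f"
    using g(1) assms(1) by (simp add: bilinear_map_def linear_map_def Pi_def)
  moreover have "sw T (\<lambda>x1 x2. sw T (\<lambda>y1 y2. f x1 y1 \<otimes>\<^sub>T f x2 y2) y) x =
      sw T (\<lambda>x1 x2. sw T (\<lambda>y1 y2. g x1 y1 \<otimes>\<^sub>T g x2 y2) y) x" for x y
    by (intro sw_cong) (simp add: assms(1))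
  ultimately show ?thesis
    by (simp add: coalgebra_operation_iff assms(1) g)
qed

context hopf_truss begin

text \<open>Put \<open>L(x) = x \<circ> 1\<close>. The truss law at \<open>y = z = 1\<close> says \<open>L =
  L * (S \<circ> \<Phi>) * L\<close> for convolution. As a coalgebra map, \<open>L\<close> is
  invertible, whence \<open>(S \<circ> \<Phi>) * L\<close> is the unit. So \<open>L\<close> and
  \<open>\<Phi>\<close> are both inverse to \<open>S \<circ> \<Phi>\<close>.\<close>

lemma truss_map_eq_circ_one:
  assumes x: "x \<in> carrier H"
  shows "truss_map H x = x \<star>\<^bsub>H\<^esub> \<one>\<^bsub>H\<^esub>"
proof -
  define S where "S = antipode H"
  define \<Phi> where "\<Phi> = truss_map H"
  define L where "L = (\<lambda>x. x \<star>\<^bsub>H\<^esub> \<one>\<^bsub>H\<^esub>)"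
  note circD = operationD[OF circ_coalgebra]
  note phi_hom = truss_map_coalgebra[folded \<Phi>_def]
  note phiD = coalgebra_homD[OF phi_hom]
  have L: "linear_map R H H L"
    unfolding L_def by (rule bilinear_mapD(2)[OF circD(1)]) simp
  have L_hom: "coalgebra_hom R H H L"
    unfolding coalgebra_hom_def
  proof (intro conjI ballI L)
    fix x assume x: "x \<in> carrier H"
    show "counit H (L x) = counit H x"
      using x by (simp add: L_def circD(3) counit_one counit_closed)
    have "comult H (L x) = sw T (\<lambda>x1 x2. sw T (\<lambda>y1 y2. pt (x1 \<star>\<^bsub>H\<^esub> y1) (x2 \<star>\<^bsub>H\<^esub> y2)) \<one>\<^bsub>H\<^esub>) x"
      using circD(2) x by (simp add: L_def)
    also have "\<dots> = sw T (\<lambda>x1 x2. pt (L x1) (L x2)) x"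
      unfolding L_def
      by (rule sw_cong sw_one hopf_linear linear_bilinear_left[OF circD(1)]
          linear_bilinear_right[OF circD(1)] circD(4) | assumption)+
    finally show "comult H (L x) = sw T (\<lambda>a b. pt (L a) (L b)) x" .
  qed
  note linear_rules = hopf_linear linear_comp[OF L] linear_mapD(1)[OF L] linear_comp[OF phiD(1)] phiD(2) L phiD(1)
  have L_eq: "L x = sw H (\<lambda>a u. L a \<otimes>\<^bsub>H\<^esub> sw H (\<lambda>b c. S (\<Phi> b) \<otimes>\<^bsub>H\<^esub> L c) u) x"
    if x: "x \<in> carrier H" for x
  proof -
    have "L x = sw H (\<lambda>a u. sw H (\<lambda>b c. L a \<otimes>\<^bsub>H\<^esub> S (\<Phi> b) \<otimes>\<^bsub>H\<^esub> L c) u) x"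
      using circ_mult[OF x one_closed one_closed] by (simp add: L_def S_def \<Phi>_def)
    also have "\<dots> = sw H (\<lambda>a u. sw H (\<lambda>b c. L a \<otimes>\<^bsub>H\<^esub> (S (\<Phi> b) \<otimes>\<^bsub>H\<^esub> L c)) u) x"
      unfolding S_def by (rule sw_cong A.m_assoc linear_rules | assumption)+
    also have "\<dots> = sw H (\<lambda>a u. L a \<otimes>\<^bsub>H\<^esub> sw H (\<lambda>b c. S (\<Phi> b) \<otimes>\<^bsub>H\<^esub> L c) u) x"
      unfolding S_def by (rule sw_cong linear_sw[symmetric] linear_rules | assumption)+
    finally show ?thesis .
  qed
  let ?K = "\<lambda>x. sw H (\<lambda>b c. S (\<Phi> b) \<otimes>\<^bsub>H\<^esub> L c) x"
  have K: "linear_map R H H ?K"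
    unfolding S_def by (rule linear_rules | assumption)+
  have SL: "linear_map R H H (\<lambda>x. S (L x))" "linear_map R H H (\<lambda>x. S (\<Phi> x))"
    unfolding S_def by (rule linear_rules)+
  \<comment> \<open>The truss law says that \<open>L\<close> convolved with \<open>?K\<close> is \<open>L\<close> again.\<close>
  have K_eq: "?K x = counit H x \<odot>\<^bsub>H\<^esub> \<one>\<^bsub>H\<^esub>" if x: "x \<in> carrier H" for x
  proof -
    have "?K x = sw H (\<lambda>a u. S (L a) \<otimes>\<^bsub>H\<^esub> sw H (\<lambda>b c. L b \<otimes>\<^bsub>H\<^esub> ?K c) u) x"
      by (rule convolution_cancel_left[OF mult_algebra SL(1) L K _ x, symmetric])
        (simp add: S_def antipode_hom_inverse[OF coalgebra_H L_hom])
    also have "\<dots> = sw H (\<lambda>a u. S (L a) \<otimes>\<^bsub>H\<^esub> L u) x"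
      by (rule sw_cong) (simp add: L_eq[symmetric])
    also have "\<dots> = counit H x \<odot>\<^bsub>H\<^esub> \<one>\<^bsub>H\<^esub>"
      unfolding S_def by (rule antipode_hom_inverse[OF coalgebra_H L_hom x])
    finally show ?thesis .
  qed
  have "\<Phi> x = L x"
    by (rule convolution_inverse_unique[OF mult_algebra phiD(1) SL(2) L _ K_eq x])
      (simp_all add: S_def antipode_hom_inverse[OF coalgebra_H phi_hom])
  then show ?thesis by (simp add: \<Phi>_def L_def)
qed

end

section \<open>Records with the same underlying Hopf algebra\<close>

lemma sweedler_cong:
  assumes "carrier C' = carrier C" "ring.add C' = ring.add C" "smult C' = smult C"
    and "comult C' = comult C"
    and "carrier P' = carrier P" "ring.add P' = ring.add P"
  shows "sweedler R C' P' = sweedler R C P"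
  by (intro ext)
    (simp add: sweedler_def assms(4-6) tensor_cong(1)[OF assms(1-3) assms(1-3)] tensor_lift_def hom_def)

lemma underlying_fields:
  assumes "hopf_algebra.truncate H' = hopf_algebra.truncate H"
  shows "carrier H' = carrier H" "ring.add H' = ring.add H" "smult H' = smult H"
    "comult H' = comult H" "counit H' = counit H" "antipode H' = antipode H"
    "monoid.mult H' = monoid.mult H" "one H' = one H" "ring.zero H' = ring.zero H"
  using assms by (simp_all add: hopf_algebra.truncate_def)

text \<open>Equality of truncations means that two records, possibly of different types, have the same
  underlying Hopf algebra. All notions concerning Hopf algebras read only the truncated fields.\<close>

lemma underlying_transfer:
  assumes E: "hopf_algebra.truncate H' = hopf_algebra.truncate H"
  shows "tensor R H' N = tensor R H N" "tensor R M H' = tensor R M H"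
    "pure_tensor R H' N = pure_tensor R H N" "pure_tensor R M H' = pure_tensor R M H"
    "tensor_lift R H' N = tensor_lift R H N" "tensor_lift R M H' = tensor_lift R M H"
    "sweedler R H' P = sweedler R H P" "sweedler R C H' = sweedler R C H"
    and underlying_transfer_hopf:
    "tensor_coalgebra R H' H' = tensor_coalgebra R H H"
    "cocommutative R H' = cocommutative R H"
    "coalgebra_operation R H' f = coalgebra_operation R H f"
    "hopf_algebra_extensional R H' = hopf_algebra_extensional R H"
proof -
  note F = underlying_fields[OF E]
  show t: "tensor R H' N = tensor R H N" "tensor R M H' = tensor R M H"
    "pure_tensor R H' N = pure_tensor R H N" "pure_tensor R M H' = pure_tensor R M H"
    "tensor_lift R H' N = tensor_lift R H N" "tensor_lift R M H' = tensor_lift R M H" for M N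
    using tensor_cong[of H' H N N] tensor_cong[of M M H' H] by (simp_all add: F)
  show s: "sweedler R H' P = sweedler R H P" "sweedler R C H' = sweedler R C H" for C P
    by (rule sweedler_cong; simp add: F)+
  have t2: "tensor R H' H' = tensor R H H" "pure_tensor R H' H' = pure_tensor R H H"
    "tensor_lift R H' H' = tensor_lift R H H"
    using tensor_cong[of H' H H' H] by (simp_all add: F)
  show tc: "tensor_coalgebra R H' H' = tensor_coalgebra R H H"
    by (simp add: tensor_coalgebra_def t2 sweedler_cong[of H' H] F)
  show "cocommutative R H' = cocommutative R H"
    by (simp add: cocommutative_def t2 sweedler_cong[of H' H] F)
  have "tensor_lift R H H (add_monoid H') = tensor_lift R H H (add_monoid H)"
    by (intro ext) (simp add: tensor_lift_def hom_def F)
  then show "coalgebra_operation R H' f = coalgebra_operation R H f"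
    by (simp add: coalgebra_operation_def bilinear_map_def linear_map_def coalgebra_hom_def t2 tc F)
  show "hopf_algebra_extensional R H' = hopf_algebra_extensional R H"
    by (simp add: hopf_algebra_extensional_def F)
qed

lemma coalgebra_hom_transfer:
  assumes "hopf_algebra.truncate H' = hopf_algebra.truncate H"
    and "hopf_algebra.truncate K' = hopf_algebra.truncate K"
  shows "coalgebra_hom R H' K' f = coalgebra_hom R H K f"
  by (simp add: coalgebra_hom_def linear_map_def underlying_fields[OF assms(1)]
      underlying_fields[OF assms(2)] underlying_transfer[OF assms(1)] underlying_transfer[OF assms(2)])

lemma hopf_algebra_hom_transfer:
  assumes "hopf_algebra.truncate H' = hopf_algebra.truncate H"
    and "hopf_algebra.truncate K' = hopf_algebra.truncate K"
  shows "hopf_algebra_hom R H' K' f = hopf_algebra_hom R H K f"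
  by (simp add: hopf_algebra_hom_def ring_hom_def coalgebra_hom_transfer[OF assms]
      underlying_fields[OF assms(1)] underlying_fields[OF assms(2)])

lemma hopf_algebra_transfer:
  assumes E: "hopf_algebra.truncate H' = hopf_algebra.truncate H"
    and "hopf_algebra R H"
  shows "hopf_algebra R H'"
proof -
  interpret hopf_algebra R H by fact
  note F = underlying_fields[OF E] and G = underlying_transfer[OF E] underlying_transfer_hopf[OF E]
  have ag: "abelian_group H'"
  proof (rule abelian_groupI)
    show "\<exists>y \<in> carrier H'. y \<oplus>\<^bsub>H'\<^esub> x = \<zero>\<^bsub>H'\<^esub>" if "x \<in> carrier H'" for x
      using that by (intro bexI[of _ "\<ominus>\<^bsub>H\<^esub> x"]) (simp_all add: F M.l_neg)
  qed (simp_all add: F M.a_ac)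
  have "monoid H'"
    by (rule monoidI) (simp_all add: F m_assoc)
  with ag have ring: "ring H'"
    by (rule ringI) (simp_all add: F l_distr r_distr)
  have module: "module R H'"
    by (rule moduleI)
      (simp_all add: F ag is_cring smult_l_distr smult_r_distr smult_assoc1)
  have "coalgebra_axioms R H'"
    using comult_linear counit_linear coassoc counit_left counit_right
    by (intro coalgebra_axioms.intro) (simp_all add: linear_map_def linear_form_def F G)
  then have "coalgebra R H'"
    by (intro coalgebra.intro module field_axioms)
  moreover have "hopf_algebra_axioms R H'"
    using mult_coalgebra comult_one counit_one antipode_linear antipode_left antipode_right
    by (intro hopf_algebra_axioms.intro) (simp_all add: linear_map_def F G)
  ultimately show ?thesis
    by (intro hopf_algebra.intro ring)
qed

section \<open>Homomorphisms\<close>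

lemma (in coalgebra) coalgebra_hom_cong:
  assumes "\<And>x. x \<in> carrier C \<Longrightarrow> f x = g x" "coalgebra_hom R C D g"
  shows "coalgebra_hom R C D f"
proof -
  have "sw (tensor R D D) (\<lambda>a b. pure_tensor R D D (f a) (f b)) x =
      sw (tensor R D D) (\<lambda>a b. pure_tensor R D D (g a) (g b)) x" for x
    by (rule sw_cong) (simp add: assms(1))
  then show ?thesis
    using assms by (simp add: coalgebra_hom_def linear_map_def Pi_def)
qed

lemma (in hopf_algebra) hopf_algebra_hom_id: "hopf_algebra_hom R H H (\<lambda>x \<in> carrier H. x)"
proof -
  have "coalgebra_hom R H H (\<lambda>x. x)"
    unfolding coalgebra_hom_def
  proof (intro conjI ballI linear_id)
    show "comult H x = sw T (\<lambda>a b. pt a b) x" if "x \<in> carrier H" for x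
      unfolding sweedler_def
      by (rule CC.tensor_linear_eqI[OF linear_id CC.lift_linear _ comult_closed[OF that]])
        (simp_all add: CC.module_tensor CC.pure_bilinear CC.lift_pure)
  qed auto
  then have "coalgebra_hom R H H (\<lambda>x \<in> carrier H. x)"
    by (rule coalgebra_hom_cong[rotated]) simp
  then show ?thesis
    by (simp add: hopf_algebra_hom_def ring_hom_def antipode_closed)
qed

lemma hopf_algebra_hom_compose:
  assumes H: "hopf_algebra R H" and K: "hopf_algebra R K" and L: "hopf_algebra R L"
    and f: "hopf_algebra_hom R H K f" and g: "hopf_algebra_hom R K L g"
  shows "hopf_algebra_hom R H L (compose (carrier H) g f)"
proof -
  interpret H: hopf_algebra R H by fact
  interpret K: hopf_algebra R K by fact
  interpret L: hopf_algebra R L by fact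
  have "coalgebra_hom R H L (\<lambda>x. g (f x))"
    using f g by (intro H.coalgebra_hom_comp[OF K.coalgebra_H L.coalgebra_H])
      (simp_all add: hopf_algebra_hom_def)
  then have "coalgebra_hom R H L (compose (carrier H) g f)"
    by (rule H.coalgebra_hom_cong[rotated]) (simp add: compose_eq)
  then show ?thesis
    using f g
    by (auto simp: hopf_algebra_hom_def ring_hom_def compose_eq H.antipode_closed Pi_def)
qed

lemma hopf_algebra_homD:
  assumes "hopf_algebra_hom R H K f"
  shows "coalgebra_hom R H K f" "linear_map R H K f"
    "x \<in> carrier H \<Longrightarrow> f x \<in> carrier K"
    "\<lbrakk>x \<in> carrier H; y \<in> carrier H\<rbrakk> \<Longrightarrow> f (x \<otimes>\<^bsub>H\<^esub> y) = f x \<otimes>\<^bsub>K\<^esub> f y"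
    "x \<in> carrier H \<Longrightarrow> f (antipode H x) = antipode K (f x)"
  using assms by (auto simp: hopf_algebra_hom_def ring_hom_def coalgebra_hom_def)

text \<open>Homomorphisms commute with Sweedler sums. This is applied to \<open>\<circ>\<close> as the
  convolution of \<open>\<Phi>\<close> with \<open>\<rhd>\<close>, and to \<open>\<rhd>\<close> as
  the convolution of \<open>S \<circ> \<Phi>\<close> with \<open>\<circ>\<close>.\<close>

lemma hopf_hom_convolution:
  assumes "hopf_algebra R H" "hopf_algebra R K" and f: "hopf_algebra_hom R H K f"
    and g: "linear_map R H H g" and g': "linear_map R K K g'"
    and b: "bilinear_map R H H H b" and b': "bilinear_map R K K K b'"
    and fg: "\<And>x. x \<in> carrier H \<Longrightarrow> f (g x) = g' (f x)"
    and fb: "\<And>x y. \<lbrakk>x \<in> carrier H; y \<in> carrier H\<rbrakk> \<Longrightarrow> f (b x y) = b' (f x) (f y)"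
    and x: "x \<in> carrier H" and y: "y \<in> carrier H"
  shows "f (sweedler R H H (\<lambda>u v. g u \<otimes>\<^bsub>H\<^esub> b v y) x) =
    sweedler R K K (\<lambda>u v. g' u \<otimes>\<^bsub>K\<^esub> b' v (f y)) (f x)"
proof -
  interpret H: hopf_algebra R H by fact
  interpret K: hopf_algebra R K by fact
  note fD = hopf_algebra_homD[OF f]
  have "f (sweedler R H H (\<lambda>u v. g u \<otimes>\<^bsub>H\<^esub> b v y) x) =
      H.sw K (\<lambda>u v. f (g u \<otimes>\<^bsub>H\<^esub> b v y)) x"
    by (rule H.linear_sw K.module_C fD H.hopf_linear linear_comp[OF g] linear_mapD(1)[OF g]
        linear_bilinear_left[OF b] linear_bilinear_right[OF b] bilinear_mapD(3)[OF b] x y | assumption)+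
  also have "\<dots> = H.sw K (\<lambda>u v. g' (f u) \<otimes>\<^bsub>K\<^esub> b' (f v) (f y)) x"
    by (rule H.sw_cong)
      (simp add: fD fg fb y linear_mapD(1)[OF g] bilinear_mapD(3)[OF b])
  also have "\<dots> = sweedler R K K (\<lambda>u v. g' u \<otimes>\<^bsub>K\<^esub> b' v (f y)) (f x)"
    by (rule H.sw_coalgebra_hom[OF K.coalgebra_H fD(1), symmetric] K.hopf_linear linear_comp[OF g']
        linear_mapD(1)[OF g'] linear_bilinear_left[OF b'] linear_bilinear_right[OF b']
        bilinear_mapD(3)[OF b'] fD x y | assumption)+
  finally show ?thesis .
qed

text \<open>Each of \<open>\<circ>\<close> and \<open>\<rhd>\<close> is obtained from the other by a formula
  involving only \<open>\<Phi>\<close>, the product, the coproduct and the antipode, all of which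
  are preserved by the homomorphism.\<close>

lemma hopf_twist_hom_iff:
  assumes "hopf_twist R H \<phi> tri c" "hopf_twist R K \<phi>' tri' c'"
    and f: "hopf_algebra_hom R H K f"
    and f\<phi>: "\<And>x. x \<in> carrier H \<Longrightarrow> f (\<phi> x) = \<phi>' (f x)"
  shows "(\<forall>x \<in> carrier H. \<forall>y \<in> carrier H. f (c x y) = c' (f x) (f y)) \<longleftrightarrow>
    (\<forall>x \<in> carrier H. \<forall>y \<in> carrier H. f (tri x y) = tri' (f x) (f y))" (is "?l \<longleftrightarrow> ?r")
proof -
  interpret H: hopf_twist R H \<phi> tri c by fact
  interpret K: hopf_twist R K \<phi>' tri' c' by fact
  note fD = hopf_algebra_homD[OF f]
  note conv = hopf_hom_convolution[OF H.hopf_algebra_axioms K.hopf_algebra_axioms f]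
  show ?thesis
  proof
    assume r: ?r
    show ?l
    proof (intro ballI)
      fix x y assume xy: "x \<in> carrier H" "y \<in> carrier H"
      have "f (c x y) = f (H.sw H (\<lambda>u v. \<phi> u \<otimes>\<^bsub>H\<^esub> tri v y) x)"
        by (simp add: H.circ_eq xy)
      also have "\<dots> = K.sw K (\<lambda>u v. \<phi>' u \<otimes>\<^bsub>K\<^esub> tri' v (f y)) (f x)"
        by (rule conv[OF H.phiD(1) K.phiD(1) H.triD(1) K.triD(1) f\<phi> _ xy]) (simp_all add: r)
      finally show "f (c x y) = c' (f x) (f y)"
        by (simp add: K.circ_eq xy fD)
    qed
  next
    assume l: ?l
    show ?r
    proof (intro ballI)
      fix x y assume xy: "x \<in> carrier H" "y \<in> carrier H"
      have "f (tri x y) = f (H.sw H (\<lambda>u v. antipode H (\<phi> u) \<otimes>\<^bsub>H\<^esub> c v y) x)"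
        by (simp add: H.tri_eq xy)
      also have "\<dots> = K.sw K (\<lambda>u v. antipode K (\<phi>' u) \<otimes>\<^bsub>K\<^esub> c' v (f y)) (f x)"
        by (rule conv[OF linear_comp[OF H.antipode_linear H.phiD(1)]
              linear_comp[OF K.antipode_linear K.phiD(1)] H.circD(1) K.circD(1) _ _ xy])
          (simp_all add: l f\<phi> fD H.phiD)
      finally show "f (tri x y) = tri' (f x) (f y)"
        by (simp add: K.tri_eq xy fD)
    qed
  qed
qed

section \<open>The correspondence of objects\<close>

text \<open>Both object maps keep the underlying Hopf algebra and \<open>\<Phi>\<close>. The new operation
  is undefined outside the carrier, as the objects of the categories are extensional.\<close>

definition truss_to_wtp ::
    "('k, 'm) ring_scheme \<Rightarrow> ('k, 'a, 'x) hopf_truss_scheme \<Rightarrow> ('k, 'a) wtp_hopf" where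
  "truss_to_wtp R H = hopf_algebra.extend (hopf_algebra.truncate H) (wtp_hopf.fields
     (\<lambda>x y. if x \<in> carrier H \<and> y \<in> carrier H
       then sweedler R H H (\<lambda>a b. antipode H (truss_map H a) \<otimes>\<^bsub>H\<^esub> (b \<star>\<^bsub>H\<^esub> y)) x else undefined)
     (truss_map H))"

definition wtp_to_truss ::
    "('k, 'm) ring_scheme \<Rightarrow> ('k, 'a, 'x) wtp_hopf_scheme \<Rightarrow> ('k, 'a) hopf_truss" where
  "wtp_to_truss R H = hopf_algebra.extend (hopf_algebra.truncate H) (hopf_truss.fields
     (\<lambda>x y. if x \<in> carrier H \<and> y \<in> carrier H then wtp_circ R H x y else undefined)
     (twist_map H))"

lemma truss_to_wtp_simps:
  "hopf_algebra.truncate (truss_to_wtp R H) = hopf_algebra.truncate H"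
  "twist_map (truss_to_wtp R H) = truss_map H"
  "rhd (truss_to_wtp R H) = (\<lambda>x y. if x \<in> carrier H \<and> y \<in> carrier H
     then sweedler R H H (\<lambda>a b. antipode H (truss_map H a) \<otimes>\<^bsub>H\<^esub> (b \<star>\<^bsub>H\<^esub> y)) x else undefined)"
  by (simp_all add: truss_to_wtp_def hopf_algebra.extend_def hopf_algebra.truncate_def
      wtp_hopf.fields_def)

lemma wtp_to_truss_simps:
  "hopf_algebra.truncate (wtp_to_truss R H) = hopf_algebra.truncate H"
  "truss_map (wtp_to_truss R H) = twist_map H"
  "circ (wtp_to_truss R H) =
     (\<lambda>x y. if x \<in> carrier H \<and> y \<in> carrier H then wtp_circ R H x y else undefined)"
  by (simp_all add: wtp_to_truss_def hopf_algebra.extend_def hopf_algebra.truncate_def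
      hopf_truss.fields_def)

lemma (in hopf_truss) hopf_twist_truss:
  "hopf_twist R H (truss_map H) (rhd (truss_to_wtp R H)) (circ H)"
proof (intro hopf_twist.intro hopf_twist_axioms.intro)
  note phi = truss_map_coalgebra
  note circD = operationD[OF circ_coalgebra]
  note phiD = coalgebra_homD[OF phi]
  have "coalgebra_operation R H (\<lambda>x y. sw H (\<lambda>a b. S (truss_map H a) \<otimes>\<^bsub>H\<^esub> (b \<star>\<^bsub>H\<^esub> y)) x)"
    by (rule convolution_operation[OF cocomm mult_coalgebra
          coalgebra_hom_comp[OF coalgebra_H coalgebra_H phi antipode_coalgebra_hom[OF cocomm]]
          circ_coalgebra])
  then show "coalgebra_operation R H (rhd (truss_to_wtp R H))"
    by (rule coalgebra_operation_cong[rotated]) (simp add: truss_to_wtp_simps)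
  fix x y assume xy: "x \<in> carrier H" "y \<in> carrier H"
  have "sw H (\<lambda>a b. truss_map H a \<otimes>\<^bsub>H\<^esub> rhd (truss_to_wtp R H) b y) x =
    sw H (\<lambda>a u. truss_map H a \<otimes>\<^bsub>H\<^esub>
      sw H (\<lambda>b c. S (truss_map H b) \<otimes>\<^bsub>H\<^esub> (c \<star>\<^bsub>H\<^esub> y)) u) x"
    by (rule sw_cong) (simp add: truss_to_wtp_simps xy)
  also have "\<dots> = x \<star>\<^bsub>H\<^esub> y"
    by (rule convolution_cancel_left[OF mult_algebra] antipode_hom_inverse(2)[OF coalgebra_H phi]
        phiD(1) hopf_linear bilinear_mapD(2)[OF circD(1)] xy | assumption)+
  finally show "x \<star>\<^bsub>H\<^esub> y = sw H (\<lambda>a b. truss_map H a \<otimes>\<^bsub>H\<^esub> rhd (truss_to_wtp R H) b y) x" ..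
qed (rule hopf_algebra_axioms cocomm truss_map_coalgebra circ_coalgebra)+

lemma (in wtp_hopf) hopf_twist_wtp:
  "hopf_twist R H (twist_map H) (rhd H) (circ (wtp_to_truss R H))"
proof (intro hopf_twist.intro hopf_twist_axioms.intro)
  have "coalgebra_operation R H (wtp_circ R H)"
    unfolding wtp_circ_def[abs_def]
    by (rule convolution_operation[OF cocomm mult_coalgebra twist_map_coalgebra rhd_coalgebra])
  then show "coalgebra_operation R H (circ (wtp_to_truss R H))"
    by (rule coalgebra_operation_cong[rotated]) (simp add: wtp_to_truss_simps)
  show "circ (wtp_to_truss R H) x y = sw H (\<lambda>a b. twist_map H a \<otimes>\<^bsub>H\<^esub> (b \<rhd>\<^bsub>H\<^esub> y)) x"
    if "x \<in> carrier H" "y \<in> carrier H" for x y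
    using that by (simp add: wtp_to_truss_simps wtp_circ_def)
qed (rule hopf_algebra_axioms cocomm twist_map_coalgebra rhd_coalgebra)+

lemma (in hopf_truss) truss_to_wtp_circ:
  assumes "x \<in> carrier H" "y \<in> carrier H"
  shows "wtp_circ R (truss_to_wtp R H) x y = x \<star>\<^bsub>H\<^esub> y"
proof -
  interpret hopf_twist R H "truss_map H" "rhd (truss_to_wtp R H)" "circ H" by (rule hopf_twist_truss)
  note E = truss_to_wtp_simps(1)[of R H]
  show ?thesis
    using circ_eq[OF assms]
    by (simp add: wtp_circ_def underlying_fields[OF E] underlying_transfer[OF E] truss_to_wtp_simps(2))
qed

lemma (in hopf_truss) wtp_hopf_truss_to_wtp: "wtp_hopf R (truss_to_wtp R H)"
proof -
  interpret hopf_twist R H "truss_map H" "rhd (truss_to_wtp R H)" "circ H" by (rule hopf_twist_truss)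
  note E = truss_to_wtp_simps(1)[of R H]
  note F = underlying_fields[OF E] and G = underlying_transfer[OF E] underlying_transfer_hopf[OF E]
  have phi_circ: "truss_map H (x \<star>\<^bsub>H\<^esub> y) = x \<star>\<^bsub>H\<^esub> truss_map H y"
    if "x \<in> carrier H" "y \<in> carrier H" for x y
    using that by (simp add: truss_map_eq_circ_one circD circ_assoc)
  have tri_mult: "rhd (truss_to_wtp R H) x (y \<otimes>\<^bsub>H\<^esub> z) =
      sw H (\<lambda>a b. rhd (truss_to_wtp R H) a y \<otimes>\<^bsub>H\<^esub> rhd (truss_to_wtp R H) b z) x"
    if "x \<in> carrier H" "y \<in> carrier H" "z \<in> carrier H" for x y z
    using circ_mult_iff_tri_mult[OF that(2,3)] circ_mult that by blast
  have tri_circ: "rhd (truss_to_wtp R H) (x \<star>\<^bsub>H\<^esub> y) z =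
      rhd (truss_to_wtp R H) x (rhd (truss_to_wtp R H) y z)"
    if "x \<in> carrier H" "y \<in> carrier H" "z \<in> carrier H" for x y z
    using circ_assoc_iff_tri_circ[OF tri_mult phi_circ that(3)] circ_assoc that by blast
  show ?thesis
  proof (intro wtp_hopf.intro wtp_hopf_axioms.intro)
    show "hopf_algebra R (truss_to_wtp R H)"
      by (rule hopf_algebra_transfer[OF E hopf_algebra_axioms])
    show "cocommutative R (truss_to_wtp R H)"
      by (simp add: G cocomm)
    show "coalgebra_operation R (truss_to_wtp R H) (rhd (truss_to_wtp R H))"
      by (simp add: G tri_op)
    show "coalgebra_hom R (truss_to_wtp R H) (truss_to_wtp R H) (twist_map (truss_to_wtp R H))"
      by (simp add: coalgebra_hom_transfer[OF E E] truss_to_wtp_simps(2) phi_hom)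
  qed (simp_all add: F G truss_to_wtp_circ truss_to_wtp_simps(2) tri_mult tri_circ phi_circ phiD(2))
qed

lemma (in wtp_hopf) hopf_truss_wtp_to_truss: "hopf_truss R (wtp_to_truss R H)"
proof -
  interpret hopf_twist R H "twist_map H" "rhd H" "circ (wtp_to_truss R H)" by (rule hopf_twist_wtp)
  note E = wtp_to_truss_simps(1)[of R H]
  note F = underlying_fields[OF E] and G = underlying_transfer[OF E] underlying_transfer_hopf[OF E]
  have circ: "circ (wtp_to_truss R H) x y = wtp_circ R H x y"
    if "x \<in> carrier H" "y \<in> carrier H" for x y
    using that by (simp add: wtp_to_truss_simps)
  have circ_closed: "wtp_circ R H x y \<in> carrier H" if "x \<in> carrier H" "y \<in> carrier H" for x y
    using circD(4)[OF that] circ[OF that] by simp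
  show ?thesis
  proof (intro hopf_truss.intro hopf_truss_axioms.intro)
    show "hopf_algebra R (wtp_to_truss R H)"
      by (rule hopf_algebra_transfer[OF E hopf_algebra_axioms])
    show "cocommutative R (wtp_to_truss R H)"
      by (simp add: G cocomm)
    show "coalgebra_operation R (wtp_to_truss R H) (circ (wtp_to_truss R H))"
      by (simp add: G circ_op)
    show "coalgebra_hom R (wtp_to_truss R H) (wtp_to_truss R H) (truss_map (wtp_to_truss R H))"
      by (simp add: coalgebra_hom_transfer[OF E E] wtp_to_truss_simps(2) phi_hom)
    fix x y z
    assume "x \<in> carrier (wtp_to_truss R H)" "y \<in> carrier (wtp_to_truss R H)"
      "z \<in> carrier (wtp_to_truss R H)"
    then have xyz: "x \<in> carrier H" "y \<in> carrier H" "z \<in> carrier H" by (simp_all add: F)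
    let ?c = "circ (wtp_to_truss R H)"
    have "\<And>x y. \<lbrakk>x \<in> carrier H; y \<in> carrier H\<rbrakk> \<Longrightarrow> twist_map H (?c x y) = ?c x (twist_map H y)"
      by (simp add: circ twist_map_circ phiD(2))
    moreover have "\<forall>x \<in> carrier H. \<forall>y \<in> carrier H. ?c x y \<rhd>\<^bsub>H\<^esub> z = x \<rhd>\<^bsub>H\<^esub> (y \<rhd>\<^bsub>H\<^esub> z)"
      by (simp add: circ circ_rhd xyz)
    ultimately show "?c (?c x y) z = ?c x (?c y z)"
      using circ_assoc_iff_tri_circ[OF rhd_mult _ xyz(3)] xyz by blast
    have "?c x (y \<otimes>\<^bsub>H\<^esub> z) = sw H (\<lambda>x1 u. sw H (\<lambda>x2 x3.
        ?c x1 y \<otimes>\<^bsub>H\<^esub> S (twist_map H x2) \<otimes>\<^bsub>H\<^esub> ?c x3 z) u) x"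
      using circ_mult_iff_tri_mult[OF xyz(2,3)] rhd_mult xyz by blast
    then show "?c x (y \<otimes>\<^bsub>wtp_to_truss R H\<^esub> z) =
      sweedler R (wtp_to_truss R H) (wtp_to_truss R H) (\<lambda>x1 u.
        sweedler R (wtp_to_truss R H) (wtp_to_truss R H) (\<lambda>x2 x3.
          ?c x1 y \<otimes>\<^bsub>wtp_to_truss R H\<^esub>
          antipode (wtp_to_truss R H) (truss_map (wtp_to_truss R H) x2) \<otimes>\<^bsub>wtp_to_truss R H\<^esub>
          ?c x3 z) u) x"
      by (simp add: F G wtp_to_truss_simps(2))
  qed
qed

lemma truss_wtp_truss:
  assumes "hopf_truss R H" "case_prod (circ H) \<in> extensional (carrier H \<times> carrier H)"
  shows "wtp_to_truss R (truss_to_wtp R H) = H"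
proof -
  interpret hopf_truss R H by fact
  note E = truss_to_wtp_simps(1)[of R H]
  have "circ (wtp_to_truss R (truss_to_wtp R H)) x y = circ H x y" for x y
    using extensional_arb[OF assms(2), of "(x, y)"]
    by (auto simp: wtp_to_truss_simps(3) underlying_fields[OF E] truss_to_wtp_circ)
  moreover have "hopf_algebra.truncate (wtp_to_truss R (truss_to_wtp R H)) = hopf_algebra.truncate H"
    by (simp add: wtp_to_truss_simps truss_to_wtp_simps)
  ultimately show ?thesis
    using underlying_fields[of "wtp_to_truss R (truss_to_wtp R H)" H]
    by (intro hopf_truss.equality) (auto simp: wtp_to_truss_simps(2) truss_to_wtp_simps(2))
qed

lemma wtp_truss_wtp:
  assumes "wtp_hopf R H" "case_prod (rhd H) \<in> extensional (carrier H \<times> carrier H)"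
  shows "truss_to_wtp R (wtp_to_truss R H) = H"
proof -
  interpret wtp_hopf R H by fact
  interpret hopf_twist R H "twist_map H" "rhd H" "circ (wtp_to_truss R H)" by (rule hopf_twist_wtp)
  note E = wtp_to_truss_simps(1)[of R H]
  have "rhd (truss_to_wtp R (wtp_to_truss R H)) x y = rhd H x y" for x y
    using extensional_arb[OF assms(2), of "(x, y)"]
    by (auto simp: truss_to_wtp_simps(3) underlying_fields[OF E] underlying_transfer[OF E]
        wtp_to_truss_simps(2) tri_eq)
  moreover have "hopf_algebra.truncate (truss_to_wtp R (wtp_to_truss R H)) = hopf_algebra.truncate H"
    by (simp add: wtp_to_truss_simps truss_to_wtp_simps)
  ultimately show ?thesis
    using underlying_fields[of "truss_to_wtp R (wtp_to_truss R H)" H]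
    by (intro wtp_hopf.equality) (auto simp: wtp_to_truss_simps(2) truss_to_wtp_simps(2))
qed

lemma wtp_hopf_hom_iff_hopf_truss_hom:
  assumes "hopf_truss R H" "hopf_truss R K"
  shows "wtp_hopf_hom R (truss_to_wtp R H) (truss_to_wtp R K) f \<longleftrightarrow> hopf_truss_hom R H K f"
proof -
  note E = truss_to_wtp_simps(1)[of R H] truss_to_wtp_simps(1)[of R K]
  note tw = hopf_twist_hom_iff[OF hopf_truss.hopf_twist_truss[OF assms(1)] hopf_truss.hopf_twist_truss[OF assms(2)]]
  show ?thesis
    unfolding wtp_hopf_hom_def hopf_truss_hom_def hopf_algebra_hom_transfer[OF E]
      underlying_fields[OF E(1)] truss_to_wtp_simps(2)
    using tw[of f] by blast
qed

section \<open>The isomorphism of categories\<close>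

text \<open>The pattern shared by both categories: arrows are extensional functions between carriers that
  satisfy a condition preserved by composition.\<close>

lemma concrete_category:
  assumes Hom: "Hom C = (\<lambda>A B. {f \<in> extensional (car A). P A B f})"
    and Id: "Id C = (\<lambda>A. \<lambda>x \<in> car A. x)"
    and Comp: "Comp C = (\<lambda>A B D g f. compose (car A) g f)"
    and maps: "\<And>A B f. \<lbrakk>A \<in> Ob C; B \<in> Ob C; P A B f\<rbrakk> \<Longrightarrow> f \<in> car A \<rightarrow> car B"
    and id: "\<And>A. A \<in> Ob C \<Longrightarrow> P A A (\<lambda>x \<in> car A. x)"
    and comp: "\<And>A B D f g. \<lbrakk>A \<in> Ob C; B \<in> Ob C; D \<in> Ob C; P A B f; P B D g\<rbrakk> \<Longrightarrow>
      P A D (compose (car A) g f)"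
  shows "category C"
proof
  show "Comp C A A B f (Id C A) = f" if "A \<in> Ob C" "B \<in> Ob C" "f \<in> Hom C A B" for A B f
    using that by (auto simp: Hom Id Comp intro!: extensionalityI[of _ "car A"] simp: compose_def)
  show "Comp C A B B (Id C B) f = f" if "A \<in> Ob C" "B \<in> Ob C" "f \<in> Hom C A B" for A B f
    using that maps[of A B f]
    by (auto simp: Hom Id Comp intro!: extensionalityI[of _ "car A"] simp: compose_def)
  show "Comp C A D E h (Comp C A B D g f) = Comp C A B E (Comp C B D E h g) f"
    if "A \<in> Ob C" "B \<in> Ob C" "D \<in> Ob C" "E \<in> Ob C"
      "f \<in> Hom C A B" "g \<in> Hom C B D" "h \<in> Hom C D E" for A B D E f g h
    using that maps[of A B f] by (simp add: Hom Comp compose_assoc)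
qed (auto simp: Hom Id Comp id comp)

lemma category_HT: "category (HT R :: (('k, 'a) hopf_truss, 'a \<Rightarrow> 'a) category)"
proof (rule concrete_category[where car = carrier and P = "hopf_truss_hom R"])
  fix H :: "('k, 'a) hopf_truss"
  assume "H \<in> Ob (HT R)"
  then interpret hopf_truss R H
    by (simp add: HT_def)
  show "hopf_truss_hom R H H (\<lambda>x \<in> carrier H. x)"
    using operationD(4)[OF circ_coalgebra] coalgebra_homD(2)[OF truss_map_coalgebra]
    by (simp add: hopf_truss_hom_def hopf_algebra_hom_id)
next
  fix H K L :: "('k, 'a) hopf_truss" and f g
  assume Ob: "H \<in> Ob (HT R)" "K \<in> Ob (HT R)" "L \<in> Ob (HT R)"
    and f: "hopf_truss_hom R H K f" and g: "hopf_truss_hom R K L g"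
  interpret H: hopf_truss R H using Ob by (simp add: HT_def)
  have "hopf_algebra_hom R H L (compose (carrier H) g f)"
    using Ob f g
    by (intro hopf_algebra_hom_compose[of R H K L])
      (simp_all add: HT_def hopf_truss_def hopf_truss_hom_def)
  moreover have "f x \<in> carrier K" if "x \<in> carrier H" for x
    using f hopf_algebra_homD(3) that by (auto simp: hopf_truss_hom_def)
  ultimately show "hopf_truss_hom R H L (compose (carrier H) g f)"
    using f g H.operationD(4)[OF H.circ_coalgebra] H.coalgebra_homD(2)[OF H.truss_map_coalgebra]
    by (simp add: hopf_truss_hom_def compose_eq)
qed (auto simp: HT_def hopf_truss_hom_def dest: hopf_algebra_homD(3))

lemma category_WTH: "category (WTH R :: (('k, 'a) wtp_hopf, 'a \<Rightarrow> 'a) category)"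
proof (rule concrete_category[where car = carrier and P = "wtp_hopf_hom R"])
  fix H :: "('k, 'a) wtp_hopf"
  assume "H \<in> Ob (WTH R)"
  then interpret wtp_hopf R H
    by (simp add: WTH_def)
  show "wtp_hopf_hom R H H (\<lambda>x \<in> carrier H. x)"
    using operationD(4)[OF rhd_coalgebra] coalgebra_homD(2)[OF twist_map_coalgebra]
    by (simp add: wtp_hopf_hom_def hopf_algebra_hom_id)
next
  fix H K L :: "('k, 'a) wtp_hopf" and f g
  assume Ob: "H \<in> Ob (WTH R)" "K \<in> Ob (WTH R)" "L \<in> Ob (WTH R)"
    and f: "wtp_hopf_hom R H K f" and g: "wtp_hopf_hom R K L g"
  interpret H: wtp_hopf R H using Ob by (simp add: WTH_def)
  have "hopf_algebra_hom R H L (compose (carrier H) g f)"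
    using Ob f g
    by (intro hopf_algebra_hom_compose[of R H K L])
      (simp_all add: WTH_def wtp_hopf_def wtp_hopf_hom_def)
  moreover have "f x \<in> carrier K" if "x \<in> carrier H" for x
    using f hopf_algebra_homD(3) that by (auto simp: wtp_hopf_hom_def)
  ultimately show "wtp_hopf_hom R H L (compose (carrier H) g f)"
    using f g H.operationD(4)[OF H.rhd_coalgebra] H.coalgebra_homD(2)[OF H.twist_map_coalgebra]
    by (simp add: wtp_hopf_hom_def compose_eq)
qed (auto simp: WTH_def wtp_hopf_hom_def dest: hopf_algebra_homD(3))

theorem theorem6p7:
  fixes R :: "('k, 'm) ring_scheme"
  assumes "field R"
    and char_zero: "\<And>n :: nat. n > 0 \<Longrightarrow> [n] \<cdot>\<^bsub>R\<^esub> \<one>\<^bsub>R\<^esub> \<noteq> \<zero>\<^bsub>R\<^esub>"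
  shows "isomorphic_categories
      (HT R :: (('k, 'a) hopf_truss, 'a \<Rightarrow> 'a) category)
      (WTH R :: (('k, 'a) wtp_hopf, 'a \<Rightarrow> 'a) category)"
proof -
  let ?HT = "HT R :: (('k, 'a) hopf_truss, 'a \<Rightarrow> 'a) category"
  let ?WTH = "WTH R :: (('k, 'a) wtp_hopf, 'a \<Rightarrow> 'a) category"
  have forward: "truss_to_wtp R H \<in> Ob ?WTH" "wtp_to_truss R (truss_to_wtp R H) = H" if "H \<in> Ob ?HT" for H
    using that
    by (auto simp: HT_def WTH_def hopf_truss.wtp_hopf_truss_to_wtp truss_wtp_truss
        underlying_transfer_hopf(4)[OF truss_to_wtp_simps(1)] underlying_fields[OF truss_to_wtp_simps(1)]
        truss_to_wtp_simps(2,3) extensional_def)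
  have backward: "wtp_to_truss R H \<in> Ob ?HT" "truss_to_wtp R (wtp_to_truss R H) = H" if "H \<in> Ob ?WTH" for H
    using that
    by (auto simp: HT_def WTH_def wtp_hopf.hopf_truss_wtp_to_truss wtp_truss_wtp
        underlying_transfer_hopf(4)[OF wtp_to_truss_simps(1)] underlying_fields[OF wtp_to_truss_simps(1)]
        wtp_to_truss_simps(2,3) extensional_def)
  have hom: "Hom ?WTH (truss_to_wtp R H) (truss_to_wtp R K) = Hom ?HT H K"
    if "H \<in> Ob ?HT" "K \<in> Ob ?HT" for H K
    using that by (simp add: HT_def WTH_def wtp_hopf_hom_iff_hopf_truss_hom underlying_fields[OF truss_to_wtp_simps(1)])
  have hom': "Hom ?HT (wtp_to_truss R H) (wtp_to_truss R K) = Hom ?WTH H K"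
    if "H \<in> Ob ?WTH" "K \<in> Ob ?WTH" for H K
    using hom[OF backward(1)[OF that(1)] backward(1)[OF that(2)]] that by (simp add: backward(2))
  \<comment> \<open>Both functors are the identity on arrows, since corresponding sets of arrows are equal.\<close>
  have "is_functor ?HT ?WTH (truss_to_wtp R) (\<lambda>H K f. f)"
    unfolding is_functor_def
    by (auto simp: forward hom) (auto simp: HT_def WTH_def underlying_fields[OF truss_to_wtp_simps(1)])
  moreover have "is_functor ?WTH ?HT (wtp_to_truss R) (\<lambda>H K f. f)"
    unfolding is_functor_def
    by (auto simp: backward hom') (auto simp: HT_def WTH_def underlying_fields[OF wtp_to_truss_simps(1)])
  ultimately show ?thesis
    unfolding isomorphic_categories_def
    using category_HT category_WTH forward(2) backward(2) by blast
qed

end
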